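(* Let $H$ be a Hopf algebra over a field $k$ and let $C=\mathrm{Im}(\overline E)$ be the base coalgebra of $H^{par}$. Then the $k$-linear map $$\lambda:C\to H\otimes C,\qquad \overline E(x)\mapsto p(x_{(1)})S(p(x_{(3)}))\otimes\overline E(x_{(2)})\quad(x\in H^{par})$$ (is well defined and) defines on $C$ a structure of a partial left $H$-comodule coalgebra.
   Context: $S$ denotes the antipode of $H$. A partial corepresentation of $H$ over a coalgebra $D$ is a linear map $\omega:D\to H$ with, for all $c\in D$: $\epsilon_H(\omega(c))=\epsilon_D(c)$; $\omega(c_{(1)})_{(1)}\otimes\omega(c_{(1)})_{(2)}S(\omega(c_{(2)}))=\omega(c_{(1)})\otimes\omega(c_{(2)})S(\omega(c_{(3)}))$; $\omega(c_{(1)})S(\omega(c_{(2)})_{(1)})\otimes\omega(c_{(2)})_{(2)}=\omega(c_{(1)})S(\omega(c_{(2)}))\otimes\omega(c_{(3)})$. $(C(H),p)$, $p:C(H)\to H$, is the cofree coalgebra over the vector space $H$. $H^{par}$ is the sum of all subcoalgebras $X\subseteq C(H)$ such that $p|_X$ is a partial corepresentation (the largest such subcoalgebra). Let $E:H^{par}\to H$, $E(x)=p(x_{(1)})S(p(x_{(2)}))$, let $\overline E:H^{par}\to C(H)$ be the unique coalgebra map with $p\circ\overline E=E$, and $C=\mathrm{Im}(\overline E)\subseteq C(H)$. A partial left $H$-comodule coalgebra (symmetric left partial coaction) is a coalgebra $C$ with a linear map $\lambda:C\to H\otimes C$, $\lambda(c)=c^{[-1]}\otimes c^{[0]}$, such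 that for all $c\in C$: (LPCC1) $c^{[-1]}\otimes{c^{[0]}}_{(1)}\otimes{c^{[0]}}_{(2)}={c_{(1)}}^{[-1]}{c_{(2)}}^{[-1]}\otimes{c_{(1)}}^{[0]}\otimes{c_{(2)}}^{[0]}$; (LPCC2) $\epsilon_H(c^{[-1]})c^{[0]}=c$; (LPCC3) $c^{[-1]}\otimes c^{[0][-1]}\otimes c^{[0][0]}={c_{(1)}}^{[-1]}\epsilon_C({c_{(1)}}^{[0]}){{c_{(2)}}^{[-1]}}_{(1)}\otimes{{c_{(2)}}^{[-1]}}_{(2)}\otimes{c_{(2)}}^{[0]}={{c_{(1)}}^{[-1]}}_{(1)}{c_{(2)}}^{[-1]}\epsilon_C({c_{(2)}}^{[0]})\otimes{{c_{(1)}}^{[-1]}}_{(2)}\otimes{c_{(1)}}^{[0]}$. *)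

theory Defs
  imports "HOL-Algebra.Module" "HOL-Algebra.AbelCoset"
begin

section \<open>Linear maps and tensor products\<close>

text \<open>
  Vector spaces over a field \<open>K\<close> are the modules over \<open>K\<close> of HOL-Algebra; the fields \<open>mult\<close> and
  \<open>one\<close> of the underlying record are ignored except for algebras.
\<close>

definition linear_map ::
    "('k, 'r) ring_scheme \<Rightarrow> ('k, 'a, 'm) module_scheme \<Rightarrow> ('k, 'b, 'n) module_scheme \<Rightarrow> ('a \<Rightarrow> 'b) \<Rightarrow> bool"
  where "linear_map K V W f \<longleftrightarrow>
    f \<in> carrier V \<rightarrow> carrier W \<and>
    (\<forall>x\<in>carrier V. \<forall>y\<in>carrier V. f (x \<oplus>\<^bsub>V\<^esub> y) = f x \<oplus>\<^bsub>W\<^esub> f y) \<and>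
    (\<forall>a\<in>carrier K. \<forall>x\<in>carrier V. f (a \<odot>\<^bsub>V\<^esub> x) = a \<odot>\<^bsub>W\<^esub> f x)"

definition free_module :: "('k, 'r) ring_scheme \<Rightarrow> 'a set \<Rightarrow> ('k, 'a \<Rightarrow> 'k) module"
  where "free_module K A =
    \<lparr>carrier = {f. (\<forall>z. f z \<in> carrier K) \<and> finite {z. f z \<noteq> \<zero>\<^bsub>K\<^esub>} \<and> {z. f z \<noteq> \<zero>\<^bsub>K\<^esub>} \<subseteq> A},
     mult = undefined, one = undefined,
     zero = (\<lambda>z. \<zero>\<^bsub>K\<^esub>), add = (\<lambda>f g z. f z \<oplus>\<^bsub>K\<^esub> g z),
     smult = (\<lambda>a f z. a \<otimes>\<^bsub>K\<^esub> f z)\<rparr>"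

definition free_gen :: "('k, 'r) ring_scheme \<Rightarrow> 'a \<Rightarrow> 'a \<Rightarrow> 'k"
  where "free_gen K z = (\<lambda>w. if w = z then \<one>\<^bsub>K\<^esub> else \<zero>\<^bsub>K\<^esub>)"

definition submodule_hull :: "('k, 'r) ring_scheme \<Rightarrow> ('k, 'a, 'm) module_scheme \<Rightarrow> 'a set \<Rightarrow> 'a set"
  where "submodule_hull K M A = \<Inter>{N. submodule N K M \<and> A \<subseteq> N}"

definition quotient_module ::
    "('k, 'r) ring_scheme \<Rightarrow> ('k, 'a, 'm) module_scheme \<Rightarrow> 'a set \<Rightarrow> ('k, 'a set) module"
  where "quotient_module K M N =
    \<lparr>carrier = a_rcosets\<^bsub>M\<^esub> N, mult = undefined, one = undefined,
     zero = N, add = set_add M,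
     smult = (\<lambda>a X. \<Union>x\<in>X. N +>\<^bsub>M\<^esub> (a \<odot>\<^bsub>M\<^esub> x))\<rparr>"

definition bilinear_relations ::
    "('k, 'r) ring_scheme \<Rightarrow> ('k, 'a, 'm) module_scheme \<Rightarrow> ('k, 'b, 'n) module_scheme \<Rightarrow> ('a \<times> 'b \<Rightarrow> 'k) set"
  where "bilinear_relations K V W = (let F = free_module K (carrier V \<times> carrier W) in
      {free_gen K (v \<oplus>\<^bsub>V\<^esub> v', w) \<ominus>\<^bsub>F\<^esub> (free_gen K (v, w) \<oplus>\<^bsub>F\<^esub> free_gen K (v', w)) | v v' w.
        v \<in> carrier V \<and> v' \<in> carrier V \<and> w \<in> carrier W} \<union>
      {free_gen K (v, w \<oplus>\<^bsub>W\<^esub> w') \<ominus>\<^bsub>F\<^esub> (free_gen K (v, w) \<oplus>\<^bsub>F\<^esub> free_gen K (v, w')) | v w w'.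
        v \<in> carrier V \<and> w \<in> carrier W \<and> w' \<in> carrier W} \<union>
      {free_gen K (a \<odot>\<^bsub>V\<^esub> v, w) \<ominus>\<^bsub>F\<^esub> a \<odot>\<^bsub>F\<^esub> free_gen K (v, w) | a v w.
        a \<in> carrier K \<and> v \<in> carrier V \<and> w \<in> carrier W} \<union>
      {free_gen K (v, a \<odot>\<^bsub>W\<^esub> w) \<ominus>\<^bsub>F\<^esub> a \<odot>\<^bsub>F\<^esub> free_gen K (v, w) | a v w.
        a \<in> carrier K \<and> v \<in> carrier V \<and> w \<in> carrier W})"

definition tensor_null ::
    "('k, 'r) ring_scheme \<Rightarrow> ('k, 'a, 'm) module_scheme \<Rightarrow> ('k, 'b, 'n) module_scheme \<Rightarrow> ('a \<times> 'b \<Rightarrow> 'k) set"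
  where "tensor_null K V W =
    submodule_hull K (free_module K (carrier V \<times> carrier W)) (bilinear_relations K V W)"

definition tensor ::
    "('k, 'r) ring_scheme \<Rightarrow> ('k, 'a, 'm) module_scheme \<Rightarrow> ('k, 'b, 'n) module_scheme
      \<Rightarrow> ('k, ('a \<times> 'b \<Rightarrow> 'k) set) module"
  where "tensor K V W =
    quotient_module K (free_module K (carrier V \<times> carrier W)) (tensor_null K V W)"

definition ptensor ::
    "('k, 'r) ring_scheme \<Rightarrow> ('k, 'a, 'm) module_scheme \<Rightarrow> ('k, 'b, 'n) module_scheme
      \<Rightarrow> 'a \<Rightarrow> 'b \<Rightarrow> ('a \<times> 'b \<Rightarrow> 'k) set"
  where "ptensor K V W v w =
    tensor_null K V W +>\<^bsub>free_module K (carrier V \<times> carrier W)\<^esub> free_gen K (v, w)"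

abbreviation "tensor3 K U V W \<equiv> tensor K U (tensor K V W)"

abbreviation "ptensor3 K U V W u v w \<equiv> ptensor K U (tensor K V W) u (ptensor K V W v w)"

text \<open>
  \<open>tsum K U t \<beta>\<close> is the image of the tensor \<open>t\<close> under the linear map to \<open>U\<close> induced by the bilinear
  map \<open>\<beta>\<close>: if \<open>t = \<Sum>\<^sub>i v\<^sub>i \<otimes> w\<^sub>i\<close>, it is \<open>\<Sum>\<^sub>i \<beta> v\<^sub>i w\<^sub>i\<close>. All representatives \<open>f\<close> of \<open>t\<close> give the same
  value when \<open>\<beta>\<close> is bilinear, which is the only situation in which it is used. Sweedler's
  notation \<open>\<beta>(c\<^sub>(\<^sub>1\<^sub>), c\<^sub>(\<^sub>2\<^sub>))\<close> becomes \<open>tsum K U (comult C c) (\<lambda>c1 c2. \<beta> c1 c2)\<close>, and similarly for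
  \<open>\<lambda>(c) = c\<^sup>[\<^sup>-\<^sup>1\<^sup>] \<otimes> c\<^sup>[\<^sup>0\<^sup>]\<close>.
\<close>

definition tsum ::
    "('k, 'r) ring_scheme \<Rightarrow> ('k, 'u, 'm) module_scheme \<Rightarrow> ('a \<times> 'b \<Rightarrow> 'k) set \<Rightarrow> ('a \<Rightarrow> 'b \<Rightarrow> 'u) \<Rightarrow> 'u"
  where "tsum K U t \<beta> =
    (THE u. \<forall>f\<in>t. u = (\<Oplus>\<^bsub>U\<^esub>z\<in>{z. f z \<noteq> \<zero>\<^bsub>K\<^esub>}. f z \<odot>\<^bsub>U\<^esub> \<beta> (fst z) (snd z)))"


section \<open>Coalgebras and Hopf algebras\<close>

record ('k, 'a) coalgebra = "('k, 'a) module" +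
  comult :: "'a \<Rightarrow> ('a \<times> 'a \<Rightarrow> 'k) set"
  counit :: "'a \<Rightarrow> 'k"

locale coalgebra = field K + module K C
  for K :: "('k, 'r) ring_scheme" and C :: "('k, 'a, 'm) coalgebra_scheme" +
  assumes comult_linear: "linear_map K C (tensor K C C) (comult C)"
    and counit_closed: "c \<in> carrier C \<Longrightarrow> counit C c \<in> carrier K"
    and counit_add: "\<lbrakk>c \<in> carrier C; d \<in> carrier C\<rbrakk> \<Longrightarrow>
      counit C (c \<oplus>\<^bsub>C\<^esub> d) = counit C c \<oplus>\<^bsub>K\<^esub> counit C d"
    and counit_smult: "\<lbrakk>a \<in> carrier K; c \<in> carrier C\<rbrakk> \<Longrightarrow>
      counit C (a \<odot>\<^bsub>C\<^esub> c) = a \<otimes>\<^bsub>K\<^esub> counit C c"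
    and coassoc: "c \<in> carrier C \<Longrightarrow>
      tsum K (tensor3 K C C C) (comult C c) (\<lambda>c1 c'.
        tsum K (tensor3 K C C C) (comult C c') (\<lambda>c2 c3. ptensor3 K C C C c1 c2 c3)) =
      tsum K (tensor3 K C C C) (comult C c) (\<lambda>c' c3.
        tsum K (tensor3 K C C C) (comult C c') (\<lambda>c1 c2. ptensor3 K C C C c1 c2 c3))"
    and counit_left: "c \<in> carrier C \<Longrightarrow>
      tsum K C (comult C c) (\<lambda>c1 c2. counit C c1 \<odot>\<^bsub>C\<^esub> c2) = c"
    and counit_right: "c \<in> carrier C \<Longrightarrow>
      tsum K C (comult C c) (\<lambda>c1 c2. counit C c2 \<odot>\<^bsub>C\<^esub> c1) = c"

definition coalgebra_map ::
    "('k, 'r) ring_scheme \<Rightarrow> ('k, 'a, 'm) coalgebra_scheme \<Rightarrow> ('k, 'b, 'n) coalgebra_scheme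
      \<Rightarrow> ('a \<Rightarrow> 'b) \<Rightarrow> bool"
  where "coalgebra_map K C D f \<longleftrightarrow>
    linear_map K C D f \<and>
    (\<forall>c\<in>carrier C. counit D (f c) = counit C c) \<and>
    (\<forall>c\<in>carrier C. comult D (f c) =
      tsum K (tensor K D D) (comult C c) (\<lambda>c1 c2. ptensor K D D (f c1) (f c2)))"

record ('k, 'a) hopf_algebra = "('k, 'a) coalgebra" +
  antipode :: "'a \<Rightarrow> 'a"

text \<open>\<open>Algebra.Module.algebra\<close> is restricted to commutative algebras, so the algebra axioms are
  spelled out.\<close>

locale hopf_algebra = coalgebra K H + H: ring H
  for K :: "('k, 'r) ring_scheme" and H :: "('k, 'h, 'm) hopf_algebra_scheme" +
  assumes smult_mult_left: "\<lbrakk>a \<in> carrier K; g \<in> carrier H; h \<in> carrier H\<rbrakk> \<Longrightarrow>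
      (a \<odot>\<^bsub>H\<^esub> g) \<otimes>\<^bsub>H\<^esub> h = a \<odot>\<^bsub>H\<^esub> (g \<otimes>\<^bsub>H\<^esub> h)"
    and smult_mult_right: "\<lbrakk>a \<in> carrier K; g \<in> carrier H; h \<in> carrier H\<rbrakk> \<Longrightarrow>
      g \<otimes>\<^bsub>H\<^esub> (a \<odot>\<^bsub>H\<^esub> h) = a \<odot>\<^bsub>H\<^esub> (g \<otimes>\<^bsub>H\<^esub> h)"
    and comult_mult: "\<lbrakk>g \<in> carrier H; h \<in> carrier H\<rbrakk> \<Longrightarrow>
      comult H (g \<otimes>\<^bsub>H\<^esub> h) =
      tsum K (tensor K H H) (comult H g) (\<lambda>g1 g2.
        tsum K (tensor K H H) (comult H h) (\<lambda>h1 h2.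
          ptensor K H H (g1 \<otimes>\<^bsub>H\<^esub> h1) (g2 \<otimes>\<^bsub>H\<^esub> h2)))"
    and comult_one: "comult H \<one>\<^bsub>H\<^esub> = ptensor K H H \<one>\<^bsub>H\<^esub> \<one>\<^bsub>H\<^esub>"
    and counit_mult: "\<lbrakk>g \<in> carrier H; h \<in> carrier H\<rbrakk> \<Longrightarrow>
      counit H (g \<otimes>\<^bsub>H\<^esub> h) = counit H g \<otimes>\<^bsub>K\<^esub> counit H h"
    and counit_one: "counit H \<one>\<^bsub>H\<^esub> = \<one>\<^bsub>K\<^esub>"
    and antipode_linear: "linear_map K H H (antipode H)"
    and antipode_left: "h \<in> carrier H \<Longrightarrow>
      tsum K H (comult H h) (\<lambda>h1 h2. antipode H h1 \<otimes>\<^bsub>H\<^esub> h2) = counit H h \<odot>\<^bsub>H\<^esub> \<one>\<^bsub>H\<^esub>"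
    and antipode_right: "h \<in> carrier H \<Longrightarrow>
      tsum K H (comult H h) (\<lambda>h1 h2. h1 \<otimes>\<^bsub>H\<^esub> antipode H h2) = counit H h \<odot>\<^bsub>H\<^esub> \<one>\<^bsub>H\<^esub>"


section \<open>Subcoalgebras\<close>

definition tensor_incl ::
    "('k, 'r) ring_scheme \<Rightarrow> ('k, 'a) coalgebra \<Rightarrow> ('a \<times> 'a \<Rightarrow> 'k) set \<Rightarrow> ('a \<times> 'a \<Rightarrow> 'k) set"
  where "tensor_incl K D t = tsum K (tensor K D D) t (\<lambda>a b. ptensor K D D a b)"

definition subcoalgebra :: "('k, 'r) ring_scheme \<Rightarrow> ('k, 'a) coalgebra \<Rightarrow> 'a set \<Rightarrow> bool"
  where "subcoalgebra K D X \<longleftrightarrow>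
    submodule X K D \<and>
    (\<forall>x\<in>X. comult D x \<in>
      tensor_incl K D ` carrier (tensor K (D\<lparr>carrier := X\<rparr>) (D\<lparr>carrier := X\<rparr>)))"

text \<open>
  The tensor product of two copies of \<open>X\<close> consists of cosets of formal sums supported on \<open>X \<times> X\<close>, so
  its elements are not elements of the tensor square of \<open>D\<close>, and the comultiplication has to be
  pulled back along the inclusion (which is injective over a field).
\<close>

definition restrict_coalgebra ::
    "('k, 'r) ring_scheme \<Rightarrow> ('k, 'a) coalgebra \<Rightarrow> 'a set \<Rightarrow> ('k, 'a) coalgebra"
  where "restrict_coalgebra K D X = D\<lparr>carrier := X,
    comult := (\<lambda>x. THE t. t \<in> carrier (tensor K (D\<lparr>carrier := X\<rparr>) (D\<lparr>carrier := X\<rparr>)) \<and>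
      tensor_incl K D t = comult D x)\<rparr>"

definition sum_submodules :: "('k, 'a, 'm) module_scheme \<Rightarrow> 'a set set \<Rightarrow> 'a set"
  where "sum_submodules M \<X> =
    {(\<Oplus>\<^bsub>M\<^esub>X\<in>F. g X) | F g. finite F \<and> F \<subseteq> \<X> \<and> (\<forall>X\<in>F. g X \<in> X)}"


section \<open>The cofree coalgebra\<close>

definition cofree_property ::
    "('k, 'r) ring_scheme \<Rightarrow> ('k, 'v, 'm) module_scheme \<Rightarrow> ('k, 'c) coalgebra \<Rightarrow> ('c \<Rightarrow> 'v)
      \<Rightarrow> ('k, 'd) coalgebra \<Rightarrow> bool"
  where "cofree_property K V C p D \<longleftrightarrow>
    (\<forall>f. linear_map K D V f \<longrightarrow>
      (\<exists>!F. F \<in> extensional (carrier D) \<and> coalgebra_map K D C F \<and>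
        (\<forall>d\<in>carrier D. p (F d) = f d)))"

text \<open>
  HOL cannot quantify over the types carrying the test coalgebras \<open>D\<close> inside a formula. Every
  finite-dimensional coalgebra is isomorphic to one carried by a set of functions \<open>nat \<Rightarrow> 'k\<close>, and every
  coalgebra is the directed union of its finite-dimensional subcoalgebras, so the universal property
  for the second family of test coalgebras already gives it for all coalgebras over \<open>K\<close>, of any type.
  The first family, which contains \<open>C\<close> and its subcoalgebras, is thus redundant; it is included for
  convenience.
\<close>

definition cofree_coalgebra ::
    "('k, 'r) ring_scheme \<Rightarrow> ('k, 'v, 'm) module_scheme \<Rightarrow> ('k, 'c) coalgebra \<Rightarrow> ('c \<Rightarrow> 'v) \<Rightarrow> bool"
  where "cofree_coalgebra K V C p \<longleftrightarrow>
    coalgebra K C \<and> linear_map K C V p \<and>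
    (\<forall>D :: ('k, 'c) coalgebra. coalgebra K D \<longrightarrow> cofree_property K V C p D) \<and>
    (\<forall>D :: ('k, nat \<Rightarrow> 'k) coalgebra. coalgebra K D \<longrightarrow> cofree_property K V C p D)"


section \<open>Partial corepresentations and partial comodule coalgebras\<close>

definition partial_corep ::
    "('k, 'r) ring_scheme \<Rightarrow> ('k, 'h, 'm) hopf_algebra_scheme \<Rightarrow> ('k, 'd) coalgebra \<Rightarrow> ('d \<Rightarrow> 'h) \<Rightarrow> bool"
  where "partial_corep K H D \<omega> \<longleftrightarrow>
    linear_map K D H \<omega> \<and>
    (\<forall>c\<in>carrier D. counit H (\<omega> c) = counit D c) \<and>
    (\<forall>c\<in>carrier D.
      tsum K (tensor K H H) (comult D c) (\<lambda>c1 c2.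
        tsum K (tensor K H H) (comult H (\<omega> c1)) (\<lambda>a b.
          ptensor K H H a (b \<otimes>\<^bsub>H\<^esub> antipode H (\<omega> c2)))) =
      tsum K (tensor K H H) (comult D c) (\<lambda>c1 c'.
        tsum K (tensor K H H) (comult D c') (\<lambda>c2 c3.
          ptensor K H H (\<omega> c1) (\<omega> c2 \<otimes>\<^bsub>H\<^esub> antipode H (\<omega> c3))))) \<and>
    (\<forall>c\<in>carrier D.
      tsum K (tensor K H H) (comult D c) (\<lambda>c1 c2.
        tsum K (tensor K H H) (comult H (\<omega> c2)) (\<lambda>a b.
          ptensor K H H (\<omega> c1 \<otimes>\<^bsub>H\<^esub> antipode H a) b)) =
      tsum K (tensor K H H) (comult D c) (\<lambda>c1 c'.
        tsum K (tensor K H H) (comult D c') (\<lambda>c2 c3.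
          ptensor K H H (\<omega> c1 \<otimes>\<^bsub>H\<^esub> antipode H (\<omega> c2)) (\<omega> c3))))"

locale partial_comodule_coalgebra = hopf_algebra K H + C: coalgebra K C
  for K :: "('k, 'r) ring_scheme" and H :: "('k, 'h, 'm) hopf_algebra_scheme"
    and C :: "('k, 'c) coalgebra" +
  fixes lam :: "'c \<Rightarrow> ('h \<times> 'c \<Rightarrow> 'k) set"
  assumes lam_linear: "linear_map K C (tensor K H C) lam"
    and LPCC1: "c \<in> carrier C \<Longrightarrow>
      tsum K (tensor3 K H C C) (lam c) (\<lambda>h d.
        tsum K (tensor3 K H C C) (comult C d) (\<lambda>d1 d2. ptensor3 K H C C h d1 d2)) =
      tsum K (tensor3 K H C C) (comult C c) (\<lambda>c1 c2.
        tsum K (tensor3 K H C C) (lam c1) (\<lambda>h1 d1.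
          tsum K (tensor3 K H C C) (lam c2) (\<lambda>h2 d2.
            ptensor3 K H C C (h1 \<otimes>\<^bsub>H\<^esub> h2) d1 d2)))"
    and LPCC2: "c \<in> carrier C \<Longrightarrow>
      tsum K C (lam c) (\<lambda>h d. counit H h \<odot>\<^bsub>C\<^esub> d) = c"
    and LPCC3_left: "c \<in> carrier C \<Longrightarrow>
      tsum K (tensor3 K H H C) (lam c) (\<lambda>h d.
        tsum K (tensor3 K H H C) (lam d) (\<lambda>h' d'. ptensor3 K H H C h h' d')) =
      tsum K (tensor3 K H H C) (comult C c) (\<lambda>c1 c2.
        tsum K (tensor3 K H H C) (lam c1) (\<lambda>h1 d1.
          tsum K (tensor3 K H H C) (lam c2) (\<lambda>h2 d2.
            tsum K (tensor3 K H H C) (comult H h2) (\<lambda>a b.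
              ptensor3 K H H C ((counit C d1 \<odot>\<^bsub>H\<^esub> h1) \<otimes>\<^bsub>H\<^esub> a) b d2))))"
    and LPCC3_right: "c \<in> carrier C \<Longrightarrow>
      tsum K (tensor3 K H H C) (lam c) (\<lambda>h d.
        tsum K (tensor3 K H H C) (lam d) (\<lambda>h' d'. ptensor3 K H H C h h' d')) =
      tsum K (tensor3 K H H C) (comult C c) (\<lambda>c1 c2.
        tsum K (tensor3 K H H C) (lam c1) (\<lambda>h1 d1.
          tsum K (tensor3 K H H C) (lam c2) (\<lambda>h2 d2.
            tsum K (tensor3 K H H C) (comult H h1) (\<lambda>a b.
              ptensor3 K H H C (a \<otimes>\<^bsub>H\<^esub> (counit C d2 \<odot>\<^bsub>H\<^esub> h2)) b d1))))"


section \<open>The universal coalgebra \<open>H\<^sup>p\<^sup>a\<^sup>r\<close> and its base coalgebra\<close>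

text \<open>In this section \<open>(CH, p)\<close> is a cofree coalgebra over the vector space \<open>H\<close>.\<close>

definition hpar ::
    "('k, 'r) ring_scheme \<Rightarrow> ('k, 'h, 'm) hopf_algebra_scheme \<Rightarrow> ('k, 'c) coalgebra \<Rightarrow> ('c \<Rightarrow> 'h)
      \<Rightarrow> ('k, 'c) coalgebra"
  where "hpar K H CH p = restrict_coalgebra K CH
    (sum_submodules CH {X. subcoalgebra K CH X \<and> partial_corep K H (restrict_coalgebra K CH X) p})"

definition base_E ::
    "('k, 'r) ring_scheme \<Rightarrow> ('k, 'h, 'm) hopf_algebra_scheme \<Rightarrow> ('k, 'c) coalgebra \<Rightarrow> ('c \<Rightarrow> 'h)
      \<Rightarrow> 'c \<Rightarrow> 'h"
  where "base_E K H CH p x =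
    tsum K H (comult (hpar K H CH p) x) (\<lambda>x1 x2. p x1 \<otimes>\<^bsub>H\<^esub> antipode H (p x2))"

definition base_Ebar ::
    "('k, 'r) ring_scheme \<Rightarrow> ('k, 'h, 'm) hopf_algebra_scheme \<Rightarrow> ('k, 'c) coalgebra \<Rightarrow> ('c \<Rightarrow> 'h)
      \<Rightarrow> 'c \<Rightarrow> 'c"
  where "base_Ebar K H CH p =
    (THE F. F \<in> extensional (carrier (hpar K H CH p)) \<and> coalgebra_map K (hpar K H CH p) CH F \<and>
      (\<forall>x\<in>carrier (hpar K H CH p). p (F x) = base_E K H CH p x))"

definition base_coalgebra ::
    "('k, 'r) ring_scheme \<Rightarrow> ('k, 'h, 'm) hopf_algebra_scheme \<Rightarrow> ('k, 'c) coalgebra \<Rightarrow> ('c \<Rightarrow> 'h)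
      \<Rightarrow> ('k, 'c) coalgebra"
  where "base_coalgebra K H CH p =
    restrict_coalgebra K CH (base_Ebar K H CH p ` carrier (hpar K H CH p))"

end

theory Submission
  imports Defs
begin

text \<open>
  Everything takes place in the convolution algebras \<open>Hom(P, B)\<close> of \<open>P = H\<^sup>p\<^sup>a\<^sup>r\<close> with values in \<open>B = K\<close>,
  \<open>H\<close> and \<open>H \<otimes> H\<close>. There \<open>E = p * S p\<close>, and the axioms of a partial corepresentation give
  \<open>E * p = p\<close>, the commutation of \<open>E \<otimes> 1\<close> with \<open>\<Delta> E\<close>, and \<open>\<Delta> E * (p \<otimes> 1) = (p \<otimes> 1) * (1 \<otimes> E)\<close>.
  To a functional \<open>A\<close> on \<open>P\<close> belongs \<open>\<phi>\<^sub>A = p * A * S p\<close>, the contraction of \<open>\<lambda>\<close> with \<open>A\<close>. Call \<open>A\<close> nice if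
  \<open>\<phi>\<^sub>A * p = p * A\<close> and \<open>\<phi>\<^sub>A\<close> satisfies the two rules displayed for \<open>\<Delta> E\<close>. The functionals on \<open>C(H)\<close>
  whose composite with \<open>Ebar\<close> is nice, with \<open>\<phi>\<^sub>A\<close> factoring through \<open>Ebar\<close>, include the counit and all
  \<open>f \<circ> p\<close>, and they are closed under convolution because \<open>\<phi>\<^bsub>A * B\<^esub> = \<phi>\<^sub>A * \<phi>\<^sub>B\<close>. Hence the common kernel of
  their pullbacks is a coideal of \<open>P\<close>, and the uniqueness part of cofreeness, applied to the quotient
  by it, shows that they separate the points of \<open>C\<close>. So \<open>\<lambda>\<close> is well defined, and its axioms may be
  tested on nice functionals: the first one becomes \<open>\<phi>\<^bsub>A * B\<^esub> = \<phi>\<^sub>A * \<phi>\<^sub>B\<close>, the third one the two rules.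
  Cofreeness speaks about coalgebras on one fixed type only, so quotients are realised on complements.
\<close>

text \<open>Elements of \<open>C\<close> can be reached only through the universal property of
  \<open>CH\<close>, so neither the kernel of \<open>Ebar\<close> nor the descent of the formula for
  the coaction can be computed directly; this forces the detour through functionals. The functionals
  \<open>f \<circ> p\<close> alone need not separate the points of \<open>C\<close>, but the family
  they generate does. Let \<open>N\<close> be its common kernel on \<open>P\<close> and
  \<open>q : P \<rightarrow> Q\<close> the quotient. Since every \<open>f \<circ> p\<close> belongs
  to the family, \<open>p \<circ> Ebar\<close> kills \<open>N\<close> and factors through
  \<open>q\<close>; the factor lifts to a coalgebra map \<open>G : Q \<rightarrow> CH\<close>, and
  uniqueness on \<open>P\<close> forces \<open>Ebar = G \<circ> q\<close>. What has to be carried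
  along the generated family is control over \<open>\<phi>\<close>, and niceness is the condition
  that survives convolution. It starts at \<open>A = f \<circ> E\<close>: applying \<open>f\<close>
  to the second leg of \<open>\<Delta> E * (p \<otimes> 1) = (p \<otimes> 1) * (1 \<otimes>
  E)\<close> gives \<open>\<psi> * p = p * A\<close> with
  \<open>\<psi> x = f(E(x)_2) E(x)_1\<close>, hence \<open>\<phi>_A = \<psi> * E\<close>, an
  expression in \<open>E = p \<circ> Ebar\<close> alone, which therefore factors through
  \<open>Ebar\<close>.\<close>

locale vector_spaces = field K for K :: "('k, 'r) ring_scheme" (structure)
begin

section \<open>Linear maps between vector spaces\<close>

abbreviation "vs V \<equiv> module K V"
abbreviation "lin V W f \<equiv> linear_map K V W f"

lemma linI:
  assumes "\<And>x. x \<in> carrier V \<Longrightarrow> f x \<in> carrier W"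
    and "\<And>x y. \<lbrakk>x \<in> carrier V; y \<in> carrier V\<rbrakk> \<Longrightarrow> f (x \<oplus>\<^bsub>V\<^esub> y) = f x \<oplus>\<^bsub>W\<^esub> f y"
    and "\<And>a x. \<lbrakk>a \<in> carrier K; x \<in> carrier V\<rbrakk> \<Longrightarrow> f (a \<odot>\<^bsub>V\<^esub> x) = a \<odot>\<^bsub>W\<^esub> f x"
  shows "lin V W f"
  using assms by (auto simp: linear_map_def)

lemma lin_closed: "lin V W f \<Longrightarrow> x \<in> carrier V \<Longrightarrow> f x \<in> carrier W"
  and lin_add: "lin V W f \<Longrightarrow> x \<in> carrier V \<Longrightarrow> y \<in> carrier V \<Longrightarrow> f (x \<oplus>\<^bsub>V\<^esub> y) = f x \<oplus>\<^bsub>W\<^esub> f y"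
  and lin_smult: "lin V W f \<Longrightarrow> a \<in> carrier K \<Longrightarrow> x \<in> carrier V \<Longrightarrow> f (a \<odot>\<^bsub>V\<^esub> x) = a \<odot>\<^bsub>W\<^esub> f x"
  by (auto simp: linear_map_def)

lemma lin_zero:
  assumes "vs V" "vs W" "lin V W f" shows "f \<zero>\<^bsub>V\<^esub> = \<zero>\<^bsub>W\<^esub>"
proof -
  interpret V: module K V by fact
  interpret W: module K W by fact
  have "f \<zero>\<^bsub>V\<^esub> = f (\<zero> \<odot>\<^bsub>V\<^esub> \<zero>\<^bsub>V\<^esub>)" by simp
  also have "\<dots> = \<zero> \<odot>\<^bsub>W\<^esub> f \<zero>\<^bsub>V\<^esub>" by (intro lin_smult[OF assms(3)]) auto
  also have "\<dots> = \<zero>\<^bsub>W\<^esub>" using lin_closed[OF assms(3), of "\<zero>\<^bsub>V\<^esub>"] by simp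
  finally show ?thesis .
qed

lemma lin_uminus:
  assumes "vs V" "vs W" "lin V W f" "x \<in> carrier V" shows "f (\<ominus>\<^bsub>V\<^esub> x) = \<ominus>\<^bsub>W\<^esub> f x"
proof -
  interpret V: module K V by fact
  interpret W: module K W by fact
  have "f (\<ominus>\<^bsub>V\<^esub> x) \<oplus>\<^bsub>W\<^esub> f x = f (\<ominus>\<^bsub>V\<^esub> x \<oplus>\<^bsub>V\<^esub> x)"
    using assms(3,4) by (simp add: lin_add)
  also have "\<dots> = \<zero>\<^bsub>W\<^esub>" using assms by (simp add: V.l_neg lin_zero)
  finally show ?thesis using assms lin_closed[OF assms(3)] by (simp add: W.minus_equality)
qed

lemma lin_minus:
  assumes "vs V" "vs W" "lin V W f" "x \<in> carrier V" "y \<in> carrier V"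
  shows "f (x \<ominus>\<^bsub>V\<^esub> y) = f x \<ominus>\<^bsub>W\<^esub> f y"
proof -
  interpret V: module K V by fact
  show ?thesis using assms by (simp add: a_minus_def lin_add lin_uminus)
qed

lemma eq_of_minus_zero:
  assumes "vs V" "x \<ominus>\<^bsub>V\<^esub> y = \<zero>\<^bsub>V\<^esub>" "x \<in> carrier V" "y \<in> carrier V"
  shows "x = y"
proof -
  interpret V: module K V by fact
  have "x = (x \<ominus>\<^bsub>V\<^esub> y) \<oplus>\<^bsub>V\<^esub> y" using assms(3,4) by (simp add: a_minus_def V.a_assoc V.l_neg)
  then show ?thesis using assms by simp
qed

lemma lin_cong:
  assumes "lin V W f" "vs V" "\<And>x. x \<in> carrier V \<Longrightarrow> f x = g x"
  shows "lin V W g"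
proof -
  interpret V: module K V by fact
  show ?thesis using assms by (auto simp: linear_map_def Pi_iff)
qed

subsection \<open>The free module\<close>

abbreviation "supp f \<equiv> {z. f z \<noteq> \<zero>}"

lemma free_module_simps:
  "f \<in> carrier (free_module K A) \<longleftrightarrow> (\<forall>z. f z \<in> carrier K) \<and> finite (supp f) \<and> supp f \<subseteq> A"
  "add (free_module K A) f g = (\<lambda>z. f z \<oplus> g z)"
  "zero (free_module K A) = (\<lambda>z. \<zero>)"
  "smult (free_module K A) a f = (\<lambda>z. a \<otimes> f z)"
  by (auto simp: free_module_def)

lemma free_module_vs: "vs (free_module K A)"
proof (rule moduleI)
  show "cring K" by (rule is_cring)
  show "abelian_group (free_module K A)"
  proof (rule abelian_groupI)
    fix x y assume x: "x \<in> carrier (free_module K A)" and y: "y \<in> carrier (free_module K A)"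
    have "supp (\<lambda>z. x z \<oplus> y z) \<subseteq> supp x \<union> supp y" by auto
    with x y show "x \<oplus>\<^bsub>free_module K A\<^esub> y \<in> carrier (free_module K A)"
      by (auto simp: free_module_simps intro: finite_subset)
    show "x \<oplus>\<^bsub>free_module K A\<^esub> y = y \<oplus>\<^bsub>free_module K A\<^esub> x"
      using x y by (auto simp: free_module_simps a_comm)
  next
    fix x y z assume "x \<in> carrier (free_module K A)" "y \<in> carrier (free_module K A)"
      "z \<in> carrier (free_module K A)"
    then show "x \<oplus>\<^bsub>free_module K A\<^esub> y \<oplus>\<^bsub>free_module K A\<^esub> z =
      x \<oplus>\<^bsub>free_module K A\<^esub> (y \<oplus>\<^bsub>free_module K A\<^esub> z)"
      by (auto simp: free_module_simps a_assoc)
  next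
    fix x assume x: "x \<in> carrier (free_module K A)"
    then show "\<zero>\<^bsub>free_module K A\<^esub> \<oplus>\<^bsub>free_module K A\<^esub> x = x" by (auto simp: free_module_simps)
    have "supp (\<lambda>z. \<ominus> x z) = supp x" using x by (auto simp: free_module_simps)
    with x show "\<exists>y\<in>carrier (free_module K A). y \<oplus>\<^bsub>free_module K A\<^esub> x = \<zero>\<^bsub>free_module K A\<^esub>"
      by (intro bexI[of _ "\<lambda>z. \<ominus> x z"]) (auto simp: free_module_simps l_neg)
  qed (auto simp: free_module_simps)
next
  fix a x assume a: "a \<in> carrier K" and x: "x \<in> carrier (free_module K A)"
  have "supp (\<lambda>z. a \<otimes> x z) \<subseteq> supp x" using a by auto
  with a x show "a \<odot>\<^bsub>free_module K A\<^esub> x \<in> carrier (free_module K A)"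
    by (auto simp: free_module_simps intro: finite_subset)
qed (auto simp: free_module_simps l_distr r_distr m_assoc)

lemma free_gen_closed: "z \<in> A \<Longrightarrow> free_gen K z \<in> carrier (free_module K A)"
  by (auto simp: free_module_simps free_gen_def)

text \<open>This is verbatim the sum in \<open>tsum\<close>, so that evaluating a tensor on a
  representative is an instance of linear extension from formal sums.\<close>

definition free_ext where
  "free_ext U b f = (\<Oplus>\<^bsub>U\<^esub>z\<in>supp f. f z \<odot>\<^bsub>U\<^esub> b z)"

text \<open>Supports shrink under cancellation and under multiplication by zero, so additivity and
  homogeneity are compared over a larger common index set, on which the extra terms vanish.\<close>

lemma free_ext_superset:
  assumes "vs U" "\<And>z. z \<in> A \<Longrightarrow> b z \<in> carrier U" "f \<in> carrier (free_module K A)"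
    and "finite B" "supp f \<subseteq> B" "B \<subseteq> A"
  shows "free_ext U b f = (\<Oplus>\<^bsub>U\<^esub>z\<in>B. f z \<odot>\<^bsub>U\<^esub> b z)"
proof -
  interpret U: module K U by fact
  show ?thesis unfolding free_ext_def
    using assms by (intro U.add.finprod_mono_neutral_cong_left) (auto simp: free_module_simps)
qed

lemma free_ext_lin:
  assumes "vs U" "\<And>z. z \<in> A \<Longrightarrow> b z \<in> carrier U"
  shows "lin (free_module K A) U (free_ext U b)"
proof -
  interpret U: module K U by fact
  interpret F: module K "free_module K A" by (rule free_module_vs)
  show ?thesis
  proof (rule linI)
    fix f assume "f \<in> carrier (free_module K A)"
    then show "free_ext U b f \<in> carrier U"
      unfolding free_ext_def using assms by (intro U.finsum_closed) (auto simp: free_module_simps)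
  next
    fix f g assume fg: "f \<in> carrier (free_module K A)" "g \<in> carrier (free_module K A)"
    let ?B = "supp f \<union> supp g"
    have B: "finite ?B" "?B \<subseteq> A" using fg by (auto simp: free_module_simps)
    have "free_ext U b (f \<oplus>\<^bsub>free_module K A\<^esub> g) = (\<Oplus>\<^bsub>U\<^esub>z\<in>?B. (f \<oplus>\<^bsub>free_module K A\<^esub> g) z \<odot>\<^bsub>U\<^esub> b z)"
      using F.a_closed[OF fg] fg B assms by (intro free_ext_superset) (auto simp: free_module_simps(2))
    also have "\<dots> = (\<Oplus>\<^bsub>U\<^esub>z\<in>?B. f z \<odot>\<^bsub>U\<^esub> b z \<oplus>\<^bsub>U\<^esub> g z \<odot>\<^bsub>U\<^esub> b z)"
    proof (intro U.finsum_cong' refl)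
      fix i assume "i \<in> ?B"
      then have "b i \<in> carrier U" using B assms by auto
      then show "(f \<oplus>\<^bsub>free_module K A\<^esub> g) i \<odot>\<^bsub>U\<^esub> b i = f i \<odot>\<^bsub>U\<^esub> b i \<oplus>\<^bsub>U\<^esub> g i \<odot>\<^bsub>U\<^esub> b i"
        using fg by (auto simp: free_module_simps U.smult_l_distr)
    qed (use fg B assms in \<open>auto simp: free_module_simps\<close>)
    also have "\<dots> = free_ext U b f \<oplus>\<^bsub>U\<^esub> free_ext U b g"
      using free_ext_superset[OF assms fg(1) B(1) _ B(2)] free_ext_superset[OF assms fg(2) B(1) _ B(2)] fg B assms
      by (subst U.finsum_addf) (auto simp: free_module_simps)
    finally show "free_ext U b (f \<oplus>\<^bsub>free_module K A\<^esub> g) = free_ext U b f \<oplus>\<^bsub>U\<^esub> free_ext U b g" .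
  next
    fix a f assume a: "a \<in> carrier K" and f: "f \<in> carrier (free_module K A)"
    have B: "finite (supp f)" "supp f \<subseteq> A" using f by (auto simp: free_module_simps)
    have "free_ext U b (a \<odot>\<^bsub>free_module K A\<^esub> f) = (\<Oplus>\<^bsub>U\<^esub>z\<in>supp f. (a \<odot>\<^bsub>free_module K A\<^esub> f) z \<odot>\<^bsub>U\<^esub> b z)"
      using F.smult_closed[OF a f] a B assms by (intro free_ext_superset) (auto simp: free_module_simps(4))
    also have "\<dots> = (\<Oplus>\<^bsub>U\<^esub>z\<in>supp f. a \<odot>\<^bsub>U\<^esub> (f z \<odot>\<^bsub>U\<^esub> b z))"
    proof (intro U.finsum_cong' refl)
      fix i assume "i \<in> supp f"
      then have "b i \<in> carrier U" using B assms by auto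
      then show "(a \<odot>\<^bsub>free_module K A\<^esub> f) i \<odot>\<^bsub>U\<^esub> b i = a \<odot>\<^bsub>U\<^esub> (f i \<odot>\<^bsub>U\<^esub> b i)"
        using f a by (auto simp: free_module_simps U.smult_assoc1)
    qed (use f a B assms in \<open>auto simp: free_module_simps\<close>)
    also have "\<dots> = a \<odot>\<^bsub>U\<^esub> free_ext U b f"
      unfolding free_ext_def using B a f assms
      by (subst U.finsum_smult_ldistr) (auto simp: free_module_simps)
    finally show "free_ext U b (a \<odot>\<^bsub>free_module K A\<^esub> f) = a \<odot>\<^bsub>U\<^esub> free_ext U b f" .
  qed
qed

lemma free_ext_gen:
  assumes "vs U" "b z \<in> carrier U"
  shows "free_ext U b (free_gen K z) = b z"
proof -
  interpret U: module K U by fact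
  have "supp (free_gen K z) = {z}" by (auto simp: free_gen_def)
  moreover have "(\<Oplus>\<^bsub>U\<^esub>w\<in>{z}. free_gen K z w \<odot>\<^bsub>U\<^esub> b w) = (\<Oplus>\<^bsub>U\<^esub>w\<in>{z}. b z)"
    using assms by (intro U.finsum_cong') (auto simp: free_gen_def)
  ultimately show ?thesis using assms by (simp add: free_ext_def Pi_iff)
qed

text \<open>Induction on the size of the support: erasing one point \<open>z\<close> of it leaves a
  smaller formal sum \<open>g\<close>.\<close>

lemma free_induct:
  assumes f: "f \<in> carrier (free_module K A)"
    and zero: "P \<zero>\<^bsub>free_module K A\<^esub>"
    and step: "\<And>a z g. \<lbrakk>a \<in> carrier K; z \<in> A; g \<in> carrier (free_module K A); P g\<rbrakk> \<Longrightarrow>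
       P (a \<odot>\<^bsub>free_module K A\<^esub> free_gen K z \<oplus>\<^bsub>free_module K A\<^esub> g)"
  shows "P f"
  using f
proof (induct "card (supp f)" arbitrary: f)
  case 0
  then have "f = (\<lambda>z. \<zero>)" by (auto simp: free_module_simps)
  then show ?case using zero by (simp add: free_module_simps)
next
  case (Suc n)
  then have "supp f \<noteq> {}" by fastforce
  then obtain z where z: "z \<in> supp f" by blast
  let ?g = "\<lambda>w. if w = z then \<zero> else f w"
  have s: "supp ?g = supp f - {z}" by auto
  have fin: "finite (supp f)" using Suc by (simp add: free_module_simps)
  have gc: "?g \<in> carrier (free_module K A)"
    using Suc(3) by (auto simp: free_module_simps intro: finite_subset[of _ "supp f"])
  have "card (supp ?g) = n" using Suc(2) z fin by (subst s) simp
  then have "P ?g" using gc by (intro Suc(1)) auto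
  moreover have "f = f z \<odot>\<^bsub>free_module K A\<^esub> free_gen K z \<oplus>\<^bsub>free_module K A\<^esub> ?g"
    using Suc(3) by (auto simp: free_module_simps free_gen_def)
  ultimately show ?case using step[of "f z" z ?g] gc z Suc(3) by (auto simp: free_module_simps)
qed

subsection \<open>Quotients\<close>

lemma submodule_zero: "vs M \<Longrightarrow> submodule N K M \<Longrightarrow> \<zero>\<^bsub>M\<^esub> \<in> N"
  using subgroup.one_closed[OF submodule.axioms(1)] by fastforce

text \<open>Closure under negation is multiplication by \<open>\<ominus> \<one>\<close>.\<close>

lemma submoduleI:
  assumes "vs M" "N \<subseteq> carrier M" "\<zero>\<^bsub>M\<^esub> \<in> N"
    and "\<And>x y. \<lbrakk>x \<in> N; y \<in> N\<rbrakk> \<Longrightarrow> x \<oplus>\<^bsub>M\<^esub> y \<in> N"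
    and smult: "\<And>a x. \<lbrakk>a \<in> carrier K; x \<in> N\<rbrakk> \<Longrightarrow> a \<odot>\<^bsub>M\<^esub> x \<in> N"
  shows "submodule N K M"
proof -
  interpret M: module K M by fact
  have "\<ominus>\<^bsub>M\<^esub> x \<in> N" if "x \<in> N" for x
  proof -
    have "\<ominus>\<^bsub>M\<^esub> x = (\<ominus> \<one>) \<odot>\<^bsub>M\<^esub> x" using that assms(2) by (auto simp: M.smult_l_minus)
    then show ?thesis using smult[OF _ that, of "\<ominus> \<one>"] by simp
  qed
  then show ?thesis using assms by (intro M.submoduleI) auto
qed

lemma submodule_triv: assumes "vs V" shows "submodule {\<zero>\<^bsub>V\<^esub>} K V"
proof -
  interpret V: module K V by fact
  show ?thesis by (rule submoduleI[OF assms]) auto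
qed

lemma submodule_common_kernel:
  assumes V: "vs V" and W: "vs W" and l: "\<And>f. f \<in> \<A> \<Longrightarrow> lin V W f"
  shows "submodule {x \<in> carrier V. \<forall>f\<in>\<A>. f x = \<zero>\<^bsub>W\<^esub>} K V"
proof -
  interpret V: module K V by fact
  interpret W: module K W by fact
  show ?thesis (is "submodule ?N K V")
  proof (rule submoduleI[OF V])
    show "\<zero>\<^bsub>V\<^esub> \<in> ?N" using lin_zero[OF V W l] by blast
  next
    fix x y assume "x \<in> ?N" "y \<in> ?N"
    then have xy: "x \<in> carrier V" "y \<in> carrier V"
      and z: "\<And>f. f \<in> \<A> \<Longrightarrow> f x = \<zero>\<^bsub>W\<^esub>" "\<And>f. f \<in> \<A> \<Longrightarrow> f y = \<zero>\<^bsub>W\<^esub>" by blast+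
    have "f (x \<oplus>\<^bsub>V\<^esub> y) = \<zero>\<^bsub>W\<^esub>" if "f \<in> \<A>" for f
      using lin_add[OF l[OF that] xy] z[OF that] by simp
    then show "x \<oplus>\<^bsub>V\<^esub> y \<in> ?N" using xy by blast
  next
    fix a x assume a: "a \<in> carrier K" and "x \<in> ?N"
    then have x: "x \<in> carrier V" and z: "\<And>f. f \<in> \<A> \<Longrightarrow> f x = \<zero>\<^bsub>W\<^esub>" by blast+
    have "f (a \<odot>\<^bsub>V\<^esub> x) = \<zero>\<^bsub>W\<^esub>" if "f \<in> \<A>" for f
      using lin_smult[OF l[OF that] a x] z[OF that] a by simp
    then show "a \<odot>\<^bsub>V\<^esub> x \<in> ?N" using x a by blast
  qed blast
qed

lemma submodule_kernel:
  "vs V \<Longrightarrow> vs W \<Longrightarrow> lin V W f \<Longrightarrow> submodule {x \<in> carrier V. f x = \<zero>\<^bsub>W\<^esub>} K V"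
  using submodule_common_kernel[of V W "{f}"] by simp

lemma submodule_image:
  assumes V: "vs V" and W: "vs W" and f: "lin V W f"
  shows "submodule (f ` carrier V) K W"
proof -
  interpret V: module K V by fact
  show ?thesis
  proof (rule submoduleI[OF W])
    show "f ` carrier V \<subseteq> carrier W" using lin_closed[OF f] by blast
    show "\<zero>\<^bsub>W\<^esub> \<in> f ` carrier V" using lin_zero[OF V W f] by (intro image_eqI[of _ _ "\<zero>\<^bsub>V\<^esub>"]) auto
  next
    fix x y assume "x \<in> f ` carrier V" "y \<in> f ` carrier V"
    then obtain u v where "u \<in> carrier V" "v \<in> carrier V" "x = f u" "y = f v" by blast
    then show "x \<oplus>\<^bsub>W\<^esub> y \<in> f ` carrier V"
      using lin_add[OF f, of u v] by (intro image_eqI[of _ _ "u \<oplus>\<^bsub>V\<^esub> v"]) auto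
  next
    fix a x assume a: "a \<in> carrier K" and "x \<in> f ` carrier V"
    then obtain u where "u \<in> carrier V" "x = f u" by blast
    then show "a \<odot>\<^bsub>W\<^esub> x \<in> f ` carrier V"
      using lin_smult[OF f a, of u] a by (intro image_eqI[of _ _ "a \<odot>\<^bsub>V\<^esub> u"]) auto
  qed
qed

lemma submodule_hull_submodule:
  assumes "vs M" "A \<subseteq> carrier M"
  shows "submodule (submodule_hull K M A) K M"
proof -
  interpret M: module K M by fact
  let ?N = "{N. submodule N K M \<and> A \<subseteq> N}"
  have c: "carrier M \<in> ?N" using assms M.carrier_is_submodule by auto
  show ?thesis unfolding submodule_hull_def
  proof (rule submoduleI[OF assms(1)])
    show "\<Inter>?N \<subseteq> carrier M" using c by blast
    show "\<zero>\<^bsub>M\<^esub> \<in> \<Inter>?N" using submodule_zero[OF assms(1)] by blast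
  next
    fix a b assume "a \<in> \<Inter>?N" "b \<in> \<Inter>?N" then show "a \<oplus>\<^bsub>M\<^esub> b \<in> \<Inter>?N"
      using M.submoduleE(5) by blast
  next
    fix a b assume "a \<in> carrier K" "b \<in> \<Inter>?N" then show "a \<odot>\<^bsub>M\<^esub> b \<in> \<Inter>?N"
      using M.submoduleE(4) by blast
  qed
qed

lemma submodule_hull_le: "submodule N K M \<Longrightarrow> A \<subseteq> N \<Longrightarrow> submodule_hull K M A \<subseteq> N"
  by (auto simp: submodule_hull_def)

lemma submodule_hull_superset: "A \<subseteq> submodule_hull K M A"
  by (auto simp: submodule_hull_def)

lemma submodule_abelian_subgroup:
  assumes "vs M" "submodule N K M" shows "abelian_subgroup N M"
  using assms by (intro abelian_subgroupI3 additive_subgroupI)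
    (auto simp: module_def dest: submodule.axioms(1))

lemma quotient_simps:
  "carrier (quotient_module K M N) = a_rcosets\<^bsub>M\<^esub> N"
  "add (quotient_module K M N) = set_add M"
  "zero (quotient_module K M N) = N"
  by (auto simp: quotient_module_def)

context
  fixes M :: "('k, 'a, 'm) module_scheme" and N
  assumes M: "vs M" and N: "submodule N K M"
begin

interpretation M: module K M by (rule M)
interpretation N: abelian_subgroup N M by (rule submodule_abelian_subgroup[OF M N])

lemma coset_add: "x \<in> carrier M \<Longrightarrow> y \<in> carrier M \<Longrightarrow>
  add (quotient_module K M N) (N +>\<^bsub>M\<^esub> x) (N +>\<^bsub>M\<^esub> y) = N +>\<^bsub>M\<^esub> (x \<oplus>\<^bsub>M\<^esub> y)"
  by (simp add: quotient_simps N.a_rcos_sum)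

lemma coset_self: "x \<in> carrier M \<Longrightarrow> x \<in> N +>\<^bsub>M\<^esub> x"
  by (rule N.a_rcos_self)

lemma coset_memD:
  assumes "x \<in> carrier M" "y \<in> N +>\<^bsub>M\<^esub> x"
  shows "y \<in> carrier M" "y \<ominus>\<^bsub>M\<^esub> x \<in> N" "N +>\<^bsub>M\<^esub> y = N +>\<^bsub>M\<^esub> x"
proof -
  show y: "y \<in> carrier M" using assms N.a_subset M.a_r_coset_subset_G by blast
  show "y \<ominus>\<^bsub>M\<^esub> x \<in> N" using assms y N.a_rcos_module by (simp add: a_minus_def)
  show "N +>\<^bsub>M\<^esub> y = N +>\<^bsub>M\<^esub> x" by (rule N.a_repr_independence'[OF assms(2,1), symmetric])
qed

lemma coset_eqI: "x \<in> carrier M \<Longrightarrow> y \<in> carrier M \<Longrightarrow> x \<ominus>\<^bsub>M\<^esub> y \<in> N \<Longrightarrow> N +>\<^bsub>M\<^esub> x = N +>\<^bsub>M\<^esub> y"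
  by (rule N.a_repr_independence'[symmetric]) (simp_all add: N.a_rcos_module a_minus_def)

text \<open>The scalar action of the quotient is a union of cosets taken over all representatives.
  These cosets coincide, because representatives differ by an element of \<open>N\<close>, so the
  union is any one of them.\<close>

lemma coset_smult:
  assumes "a \<in> carrier K" "x \<in> carrier M"
  shows "smult (quotient_module K M N) a (N +>\<^bsub>M\<^esub> x) = N +>\<^bsub>M\<^esub> (a \<odot>\<^bsub>M\<^esub> x)"
proof -
  have "N +>\<^bsub>M\<^esub> (a \<odot>\<^bsub>M\<^esub> y) = N +>\<^bsub>M\<^esub> (a \<odot>\<^bsub>M\<^esub> x)" if "y \<in> N +>\<^bsub>M\<^esub> x" for y
  proof (rule coset_eqI)
    note y = coset_memD[OF assms(2) that]
    show "a \<odot>\<^bsub>M\<^esub> y \<in> carrier M" "a \<odot>\<^bsub>M\<^esub> x \<in> carrier M" using assms y by auto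
    have "a \<odot>\<^bsub>M\<^esub> y \<ominus>\<^bsub>M\<^esub> a \<odot>\<^bsub>M\<^esub> x = a \<odot>\<^bsub>M\<^esub> (y \<ominus>\<^bsub>M\<^esub> x)"
      using assms y by (simp add: a_minus_def M.smult_r_distr M.smult_r_minus)
    then show "a \<odot>\<^bsub>M\<^esub> y \<ominus>\<^bsub>M\<^esub> a \<odot>\<^bsub>M\<^esub> x \<in> N"
      using assms y M.submoduleE(4)[OF N] by simp
  qed
  then have "(\<Union>y\<in>N +>\<^bsub>M\<^esub> x. N +>\<^bsub>M\<^esub> (a \<odot>\<^bsub>M\<^esub> y)) = N +>\<^bsub>M\<^esub> (a \<odot>\<^bsub>M\<^esub> x)"
    using coset_self[OF assms(2)] by (intro UN_constant_eq ballI)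
  then show ?thesis by (simp add: quotient_module_def)
qed

lemma coset_closed: "x \<in> carrier M \<Longrightarrow> N +>\<^bsub>M\<^esub> x \<in> carrier (quotient_module K M N)"
  using N.a_subset by (simp add: quotient_simps M.a_rcosetsI)

lemma coset_cases:
  assumes "X \<in> carrier (quotient_module K M N)"
  obtains x where "x \<in> carrier M" "X = N +>\<^bsub>M\<^esub> x"
  using assms by (auto simp: quotient_simps A_RCOSETS_def')

lemma coset_zero: "N +>\<^bsub>M\<^esub> \<zero>\<^bsub>M\<^esub> = \<zero>\<^bsub>quotient_module K M N\<^esub>"
  using N.a_subset by (simp add: quotient_simps)

lemma quotient_vs: "vs (quotient_module K M N)"
proof (rule moduleI)
  let ?Q = "quotient_module K M N"
  show "cring K" by (rule is_cring)
  show "abelian_group ?Q"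
  proof (rule abelian_groupI)
    show "\<zero>\<^bsub>?Q\<^esub> \<in> carrier ?Q" using coset_closed[OF M.zero_closed] by (simp add: coset_zero)
  next
    fix X assume "X \<in> carrier ?Q"
    then obtain x where x: "x \<in> carrier M" "X = N +>\<^bsub>M\<^esub> x" by (rule coset_cases)
    then show "\<zero>\<^bsub>?Q\<^esub> \<oplus>\<^bsub>?Q\<^esub> X = X" by (simp add: coset_zero[symmetric] coset_add)
    show "\<exists>Y\<in>carrier ?Q. Y \<oplus>\<^bsub>?Q\<^esub> X = \<zero>\<^bsub>?Q\<^esub>"
      using x by (intro bexI[of _ "N +>\<^bsub>M\<^esub> (\<ominus>\<^bsub>M\<^esub> x)"])
        (auto simp: coset_zero[symmetric] coset_add coset_closed M.l_neg)
  qed (auto elim!: coset_cases simp: coset_add coset_closed M.a_ac)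
qed (auto elim!: coset_cases simp: coset_add coset_smult coset_closed M.smult_l_distr M.smult_r_distr M.smult_assoc1)

lemma coset_lin: "lin M (quotient_module K M N) (\<lambda>x. N +>\<^bsub>M\<^esub> x)"
  by (rule linI) (auto simp: coset_add coset_smult coset_closed)

end

subsection \<open>The tensor product\<close>

definition bilin where
  "bilin V W U \<beta> \<longleftrightarrow> (\<forall>v\<in>carrier V. lin W U (\<beta> v)) \<and> (\<forall>w\<in>carrier W. lin V U (\<lambda>v. \<beta> v w))"

lemma bilinI:
  assumes "\<And>v. v \<in> carrier V \<Longrightarrow> lin W U (\<lambda>w. \<beta> v w)" "\<And>w. w \<in> carrier W \<Longrightarrow> lin V U (\<lambda>v. \<beta> v w)"
  shows "bilin V W U \<beta>"
  using assms by (simp add: bilin_def)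

lemma bilin_lin1: "bilin V W U \<beta> \<Longrightarrow> w \<in> carrier W \<Longrightarrow> lin V U (\<lambda>v. \<beta> v w)"
  and bilin_lin2: "bilin V W U \<beta> \<Longrightarrow> v \<in> carrier V \<Longrightarrow> lin W U (\<lambda>w. \<beta> v w)"
  by (auto simp: bilin_def)

lemma bilin_closed: "bilin V W U \<beta> \<Longrightarrow> v \<in> carrier V \<Longrightarrow> w \<in> carrier W \<Longrightarrow> \<beta> v w \<in> carrier U"
  using bilin_lin1 lin_closed by fastforce

context
  fixes V :: "('k, 'a, 'm) module_scheme" and W :: "('k, 'b, 'n) module_scheme"
  assumes V: "vs V" and W: "vs W"
begin

interpretation V: module K V by (rule V)
interpretation W: module K W by (rule W)

abbreviation (input) "Fr \<equiv> free_module K (carrier V \<times> carrier W)"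

interpretation F: module K "Fr" by (rule free_module_vs)

lemma bilinear_relations_closed: "bilinear_relations K V W \<subseteq> carrier Fr"
  by (auto simp: bilinear_relations_def Let_def free_gen_closed)

lemma tensor_null_submodule: "submodule (tensor_null K V W) K Fr"
  unfolding tensor_null_def
  by (rule submodule_hull_submodule[OF free_module_vs bilinear_relations_closed])

lemma tensor_vs: "vs (tensor K V W)"
  unfolding tensor_def by (rule quotient_vs[OF free_module_vs tensor_null_submodule])

lemma tproj_lin: "lin Fr (tensor K V W) (\<lambda>f. tensor_null K V W +>\<^bsub>Fr\<^esub> f)"
  unfolding tensor_def by (rule coset_lin[OF free_module_vs tensor_null_submodule])

text \<open>The kernel of the linear extension is a submodule, so it is enough that it contains the
  generating relations, and each of those is one clause of the bilinearity of
  \<open>\<beta>\<close>.\<close>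

lemma free_ext_relations:
  assumes U: "vs U" and b: "bilin V W U \<beta>" and f: "f \<in> tensor_null K V W"
  shows "free_ext U (\<lambda>z. \<beta> (fst z) (snd z)) f = \<zero>\<^bsub>U\<^esub>"
proof -
  interpret U: module K U by (rule U)
  let ?e = "free_ext U (\<lambda>z. \<beta> (fst z) (snd z))"
  have l: "lin Fr U ?e" by (rule free_ext_lin[OF U]) (auto intro: bilin_closed[OF b])
  have g: "?e (free_gen K (v, w)) = \<beta> v w" if "v \<in> carrier V" "w \<in> carrier W" for v w
    using free_ext_gen[OF U, of "\<lambda>z. \<beta> (fst z) (snd z)" "(v, w)"] bilin_closed[OF b that] by simp
  have "bilinear_relations K V W \<subseteq> {f \<in> carrier Fr. ?e f = \<zero>\<^bsub>U\<^esub>}"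
  proof
    fix f assume f: "f \<in> bilinear_relations K V W"
    show "f \<in> {f \<in> carrier Fr. ?e f = \<zero>\<^bsub>U\<^esub>}"
    proof (intro CollectI conjI)
      show "f \<in> carrier Fr" using f bilinear_relations_closed by blast
      note lm = lin_minus[OF free_module_vs U l] lin_add[OF l] lin_smult[OF l]
      note cl = free_gen_closed[of _ "carrier V \<times> carrier W"]
      note bl = lin_add[OF bilin_lin1[OF b]] lin_add[OF bilin_lin2[OF b]]
        lin_smult[OF bilin_lin1[OF b]] lin_smult[OF bilin_lin2[OF b]]
      from f show "?e f = \<zero>\<^bsub>U\<^esub>"
        unfolding bilinear_relations_def Let_def
        by (elim UnE CollectE exE conjE)
          (simp_all add: lm g cl bl bilin_closed[OF b] U.r_neg a_minus_def[of U])
    qed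
  qed
  then have "tensor_null K V W \<subseteq> {f \<in> carrier Fr. ?e f = \<zero>\<^bsub>U\<^esub>}"
    unfolding tensor_null_def
    by (rule submodule_hull_le[OF submodule_kernel[OF free_module_vs U l]])
  then show ?thesis using f by blast
qed

text \<open>This gives the definite description in \<open>tsum\<close> its meaning: two
  representatives differ by an element that the extension kills, and the coset is nonempty, so
  exactly one value fits.\<close>

lemma tsum_coset:
  assumes U: "vs U" and b: "bilin V W U \<beta>" and f: "f \<in> carrier Fr"
  shows "tsum K U (tensor_null K V W +>\<^bsub>Fr\<^esub> f) \<beta> = free_ext U (\<lambda>z. \<beta> (fst z) (snd z)) f"
proof -
  interpret U: module K U by (rule U)
  let ?e = "free_ext U (\<lambda>z. \<beta> (fst z) (snd z))"
  have l: "lin Fr U ?e" by (rule free_ext_lin[OF U]) (auto intro: bilin_closed[OF b])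
  have "?e g = ?e f" if "g \<in> tensor_null K V W +>\<^bsub>Fr\<^esub> f" for g
  proof -
    note g = coset_memD[OF free_module_vs tensor_null_submodule f that]
    have "?e g \<ominus>\<^bsub>U\<^esub> ?e f = \<zero>\<^bsub>U\<^esub>"
      using free_ext_relations[OF U b g(2)] lin_minus[OF free_module_vs U l g(1) f] by simp
    moreover have "?e g \<in> carrier U" "?e f \<in> carrier U"
      using g(1) f by (auto intro: lin_closed[OF l])
    ultimately show ?thesis by (simp add: eq_of_minus_zero[OF U])
  qed
  then have *: "(\<Oplus>\<^bsub>U\<^esub>z\<in>supp g. g z \<odot>\<^bsub>U\<^esub> \<beta> (fst z) (snd z)) = ?e f"
    if "g \<in> tensor_null K V W +>\<^bsub>Fr\<^esub> f" for g
    using that by (simp only: free_ext_def)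
  show ?thesis unfolding tsum_def
  proof (rule the_equality)
    show "\<forall>g\<in>tensor_null K V W +>\<^bsub>Fr\<^esub> f. ?e f = (\<Oplus>\<^bsub>U\<^esub>z\<in>supp g. g z \<odot>\<^bsub>U\<^esub> \<beta> (fst z) (snd z))"
      using * by (intro ballI) (rule sym)
  next
    fix u assume "\<forall>g\<in>tensor_null K V W +>\<^bsub>Fr\<^esub> f. u = (\<Oplus>\<^bsub>U\<^esub>z\<in>supp g. g z \<odot>\<^bsub>U\<^esub> \<beta> (fst z) (snd z))"
    then have "u = (\<Oplus>\<^bsub>U\<^esub>z\<in>supp f. f z \<odot>\<^bsub>U\<^esub> \<beta> (fst z) (snd z))"
      using coset_self[OF free_module_vs tensor_null_submodule f] by (rule bspec)
    then show "u = ?e f" by (simp only: free_ext_def)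
  qed
qed

lemma tsum_lin:
  assumes U: "vs U" and b: "bilin V W U \<beta>"
  shows "lin (tensor K V W) U (\<lambda>t. tsum K U t \<beta>)"
proof -
  let ?e = "free_ext U (\<lambda>z. \<beta> (fst z) (snd z))"
  have l: "lin Fr U ?e" by (rule free_ext_lin[OF U]) (auto intro: bilin_closed[OF b])
  note N = free_module_vs tensor_null_submodule
  show ?thesis
    by (rule linI) (auto simp: tensor_def elim!: coset_cases[OF N] simp: tsum_coset[OF U b]
      coset_add[OF N] coset_smult[OF N] lin_closed[OF l] lin_add[OF l] lin_smult[OF l])
qed

lemma ptensor_closed:
  "v \<in> carrier V \<Longrightarrow> w \<in> carrier W \<Longrightarrow> ptensor K V W v w \<in> carrier (tensor K V W)"
  unfolding ptensor_def by (intro lin_closed[OF tproj_lin] free_gen_closed) auto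

lemma tsum_ptensor:
  assumes U: "vs U" and b: "bilin V W U \<beta>" and "v \<in> carrier V" "w \<in> carrier W"
  shows "tsum K U (ptensor K V W v w) \<beta> = \<beta> v w"
proof -
  have "free_gen K (v, w) \<in> carrier Fr" using assms by (auto intro: free_gen_closed)
  then show ?thesis using assms
    by (simp add: ptensor_def tsum_coset free_ext_gen bilin_closed)
qed

lemma relation_coset_eq:
  assumes "x \<in> carrier Fr" "y \<in> carrier Fr" "x \<ominus>\<^bsub>Fr\<^esub> y \<in> bilinear_relations K V W"
  shows "tensor_null K V W +>\<^bsub>Fr\<^esub> x = tensor_null K V W +>\<^bsub>Fr\<^esub> y"
proof -
  have "bilinear_relations K V W \<subseteq> tensor_null K V W"
    unfolding tensor_null_def by (rule submodule_hull_superset)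
  then show ?thesis
    using coset_eqI[OF free_module_vs tensor_null_submodule assms(1,2)] assms(3) by blast
qed

lemma relation_memI:
  "\<lbrakk>v \<in> carrier V; v' \<in> carrier V; w \<in> carrier W\<rbrakk> \<Longrightarrow>
    free_gen K (v \<oplus>\<^bsub>V\<^esub> v', w) \<ominus>\<^bsub>Fr\<^esub> (free_gen K (v, w) \<oplus>\<^bsub>Fr\<^esub> free_gen K (v', w)) \<in> bilinear_relations K V W"
  "\<lbrakk>v \<in> carrier V; w \<in> carrier W; w' \<in> carrier W\<rbrakk> \<Longrightarrow>
    free_gen K (v, w \<oplus>\<^bsub>W\<^esub> w') \<ominus>\<^bsub>Fr\<^esub> (free_gen K (v, w) \<oplus>\<^bsub>Fr\<^esub> free_gen K (v, w')) \<in> bilinear_relations K V W"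
  "\<lbrakk>a \<in> carrier K; v \<in> carrier V; w \<in> carrier W\<rbrakk> \<Longrightarrow>
    free_gen K (a \<odot>\<^bsub>V\<^esub> v, w) \<ominus>\<^bsub>Fr\<^esub> a \<odot>\<^bsub>Fr\<^esub> free_gen K (v, w) \<in> bilinear_relations K V W"
  "\<lbrakk>a \<in> carrier K; v \<in> carrier V; w \<in> carrier W\<rbrakk> \<Longrightarrow>
    free_gen K (v, a \<odot>\<^bsub>W\<^esub> w) \<ominus>\<^bsub>Fr\<^esub> a \<odot>\<^bsub>Fr\<^esub> free_gen K (v, w) \<in> bilinear_relations K V W"
  unfolding bilinear_relations_def Let_def by blast+

lemma ptensor_bilin: "bilin V W (tensor K V W) (ptensor K V W)"
proof -
  note N = free_module_vs tensor_null_submodule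
  note cl = free_gen_closed[of _ "carrier V \<times> carrier W"]
  note add = lin_add[OF tproj_lin, symmetric] and smult = lin_smult[OF tproj_lin, symmetric]
  show ?thesis
  proof (intro bilinI linI)
    fix v w w' assume a: "v \<in> carrier V" "w \<in> carrier W" "w' \<in> carrier W"
    then show "ptensor K V W v (w \<oplus>\<^bsub>W\<^esub> w') = ptensor K V W v w \<oplus>\<^bsub>tensor K V W\<^esub> ptensor K V W v w'"
      unfolding ptensor_def
      by (subst add; (intro relation_coset_eq)?) (simp_all add: cl relation_memI)
  next
    fix w v v' assume a: "w \<in> carrier W" "v \<in> carrier V" "v' \<in> carrier V"
    then show "ptensor K V W (v \<oplus>\<^bsub>V\<^esub> v') w = ptensor K V W v w \<oplus>\<^bsub>tensor K V W\<^esub> ptensor K V W v' w"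
      unfolding ptensor_def
      by (subst add; (intro relation_coset_eq)?) (simp_all add: cl relation_memI)
  next
    fix v a w assume a: "v \<in> carrier V" "a \<in> carrier K" "w \<in> carrier W"
    then show "ptensor K V W v (a \<odot>\<^bsub>W\<^esub> w) = a \<odot>\<^bsub>tensor K V W\<^esub> ptensor K V W v w"
      unfolding ptensor_def
      by (subst smult; (intro relation_coset_eq)?) (simp_all add: cl relation_memI)
  next
    fix w a v assume a: "w \<in> carrier W" "a \<in> carrier K" "v \<in> carrier V"
    then show "ptensor K V W (a \<odot>\<^bsub>V\<^esub> v) w = a \<odot>\<^bsub>tensor K V W\<^esub> ptensor K V W v w"
      unfolding ptensor_def
      by (subst smult; (intro relation_coset_eq)?) (simp_all add: cl relation_memI)
  qed (auto intro: ptensor_closed)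
qed

text \<open>The scalars of a formal sum are absorbed into the first tensor factor, so only pure
  tensors are ever added; the zero tensor is itself pure, which is why there is no separate base
  case for it.\<close>

lemma tensor_induct:
  assumes t: "t \<in> carrier (tensor K V W)"
    and pt: "\<And>v w. \<lbrakk>v \<in> carrier V; w \<in> carrier W\<rbrakk> \<Longrightarrow> P (ptensor K V W v w)"
    and add: "\<And>v w s. \<lbrakk>v \<in> carrier V; w \<in> carrier W; s \<in> carrier (tensor K V W); P s\<rbrakk> \<Longrightarrow>
      P (ptensor K V W v w \<oplus>\<^bsub>tensor K V W\<^esub> s)"
  shows "P t"
proof -
  note N = free_module_vs tensor_null_submodule
  obtain f where f: "f \<in> carrier Fr" "t = tensor_null K V W +>\<^bsub>Fr\<^esub> f"
    using t unfolding tensor_def by (rule coset_cases[OF N])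
  have "P (tensor_null K V W +>\<^bsub>Fr\<^esub> f)" using f(1)
  proof (rule free_induct[where P = "\<lambda>f. P (tensor_null K V W +>\<^bsub>Fr\<^esub> f)"])
    have "ptensor K V W \<zero>\<^bsub>V\<^esub> \<zero>\<^bsub>W\<^esub> = \<zero>\<^bsub>tensor K V W\<^esub>"
      by (rule lin_zero[OF W tensor_vs bilin_lin2[OF ptensor_bilin]]) simp
    then show "P (tensor_null K V W +>\<^bsub>Fr\<^esub> \<zero>\<^bsub>Fr\<^esub>)"
      using pt[of "\<zero>\<^bsub>V\<^esub>" "\<zero>\<^bsub>W\<^esub>"] by (simp add: lin_zero[OF free_module_vs tensor_vs tproj_lin])
  next
    fix a z g
    assume a: "a \<in> carrier K" and z: "z \<in> carrier V \<times> carrier W" and g: "g \<in> carrier Fr"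
      and Pg: "P (tensor_null K V W +>\<^bsub>Fr\<^esub> g)"
    have zc: "free_gen K z \<in> carrier Fr" using z by (rule free_gen_closed)
    obtain v w where vw: "z = (v, w)" "v \<in> carrier V" "w \<in> carrier W" using z by blast
    have "tensor_null K V W +>\<^bsub>Fr\<^esub> (a \<odot>\<^bsub>Fr\<^esub> free_gen K z) = ptensor K V W (a \<odot>\<^bsub>V\<^esub> v) w"
      using lin_smult[OF tproj_lin a zc] lin_smult[OF bilin_lin1[OF ptensor_bilin]] a vw
      by (simp add: ptensor_def)
    moreover have "tensor_null K V W +>\<^bsub>Fr\<^esub> (a \<odot>\<^bsub>Fr\<^esub> free_gen K z \<oplus>\<^bsub>Fr\<^esub> g) =
      (tensor_null K V W +>\<^bsub>Fr\<^esub> (a \<odot>\<^bsub>Fr\<^esub> free_gen K z)) \<oplus>\<^bsub>tensor K V W\<^esub> (tensor_null K V W +>\<^bsub>Fr\<^esub> g)"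
      using a zc g by (intro lin_add[OF tproj_lin]) auto
    ultimately show "P (tensor_null K V W +>\<^bsub>Fr\<^esub> (a \<odot>\<^bsub>Fr\<^esub> free_gen K z \<oplus>\<^bsub>Fr\<^esub> g))"
      using add[of "a \<odot>\<^bsub>V\<^esub> v" w] a vw Pg lin_closed[OF tproj_lin g] by simp
  qed
  then show ?thesis using f by simp
qed

lemma tensor_eqI:
  assumes U: "vs U" and F: "lin (tensor K V W) U F" and G: "lin (tensor K V W) U G"
    and eq: "\<And>v w. \<lbrakk>v \<in> carrier V; w \<in> carrier W\<rbrakk> \<Longrightarrow> F (ptensor K V W v w) = G (ptensor K V W v w)"
    and t: "t \<in> carrier (tensor K V W)"
  shows "F t = G t"
  using t by (rule tensor_induct)
    (auto simp: eq lin_add[OF F] lin_add[OF G] ptensor_closed)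

end

end

text \<open>Rules that read off linearity, bilinearity and membership in a carrier from the shape of
  a Sweedler expression. Every nested sum below owes its well-definedness to them.\<close>

named_theorems lins

section \<open>The field as a module, multilinearity of Sweedler sums, tensor products of
  maps\<close>

context vector_spaces
begin

text \<open>The field as a module over itself, so that functionals are linear maps. Its product is
  kept, so that the dual of a coalgebra becomes an instance of convolution with values in an
  algebra.\<close>

definition scalars :: "('k, 'k) module" where
  "scalars = \<lparr>carrier = carrier K, mult = mult K, one = one K, zero = zero K, add = add K, smult = mult K\<rparr>"

lemma scalars_simps [simp]:
  "carrier scalars = carrier K" "mult scalars = mult K" "one scalars = one K"
  "zero scalars = zero K" "add scalars = add K" "smult scalars = mult K"
  by (simp_all add: scalars_def)

lemma scalars_vs [simp, lins]: "vs scalars"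
  by (intro moduleI abelian_groupI is_cring)
    (auto simp: l_distr r_distr m_assoc a_ac intro: bexI[of _ "\<ominus> _"] l_neg)

lemma lin_id [lins]: "lin V V (\<lambda>x. x)"
  by (auto intro: linI)

lemma lin_comp: "lin V W f \<Longrightarrow> lin W U g \<Longrightarrow> lin V U (\<lambda>x. g (f x))"
  by (rule linI) (simp_all add: lin_add[of V W f] lin_add[of W U g] lin_smult[of V W f]
    lin_smult[of W U g] lin_closed[of V W f] lin_closed[of W U g])

lemma lin_add_fun [lins]:
  assumes "lin V U f" "lin V U g" "vs U"
  shows "lin V U (\<lambda>x. f x \<oplus>\<^bsub>U\<^esub> g x)"
proof -
  interpret U: module K U by fact
  note c = lin_closed[OF assms(1)] lin_closed[OF assms(2)]
  show ?thesis
    by (rule linI) (simp_all add: c lin_add[OF assms(1)] lin_add[OF assms(2)] lin_smult[OF assms(1)]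
        lin_smult[OF assms(2)] U.smult_r_distr U.a_ac)
qed

lemma lin_smult_fun [lins]:
  assumes "lin V U f" "a \<in> carrier K" "vs U"
  shows "lin V U (\<lambda>x. a \<odot>\<^bsub>U\<^esub> f x)"
proof -
  interpret U: module K U by fact
  note c = lin_closed[OF assms(1)]
  show ?thesis using assms(2)
    by (intro linI) (simp_all add: c lin_add[OF assms(1)] lin_smult[OF assms(1)]
        U.smult_r_distr U.smult_assoc1[symmetric] m_comm)
qed

lemma lin_minus_fun:
  assumes "lin V U f" "lin V U g" "vs U"
  shows "lin V U (\<lambda>x. f x \<ominus>\<^bsub>U\<^esub> g x)"
proof -
  interpret U: module K U by fact
  note c = lin_closed[OF assms(1)] lin_closed[OF assms(2)]
  show ?thesis unfolding a_minus_def
    by (rule linI) (simp_all add: c lin_add[OF assms(1)] lin_add[OF assms(2)] lin_smult[OF assms(1)]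
        lin_smult[OF assms(2)] U.smult_r_distr U.a_ac U.smult_r_minus U.minus_add)
qed

lemma lin_smult_left [lins]:
  assumes "lin V scalars f" "u \<in> carrier U" "vs U"
  shows "lin V U (\<lambda>x. f x \<odot>\<^bsub>U\<^esub> u)"
proof -
  interpret U: module K U by fact
  note c = lin_closed[OF assms(1), simplified]
  show ?thesis using assms(2)
    by (intro linI) (simp_all add: c lin_add[OF assms(1)] lin_smult[OF assms(1)]
        U.smult_l_distr U.smult_assoc1)
qed

lemma bilin_comp:
  "bilin V W U \<beta> \<Longrightarrow> lin U U' g \<Longrightarrow> bilin V W U' (\<lambda>v w. g (\<beta> v w))"
  by (intro bilinI) (auto intro: lin_comp dest: bilin_lin1 bilin_lin2)

lemma bilin_precomp:
  assumes "bilin V' W' U \<beta>" "lin V V' f" "lin W W' g"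
  shows "bilin V W U (\<lambda>v w. \<beta> (f v) (g w))"
proof (rule bilinI)
  fix v assume "v \<in> carrier V"
  then show "lin W U (\<lambda>w. \<beta> (f v) (g w))"
    by (rule lin_comp[OF assms(3) bilin_lin2[OF assms(1) lin_closed[OF assms(2)]]])
next
  fix w assume "w \<in> carrier W"
  then show "lin V U (\<lambda>v. \<beta> (f v) (g w))"
    by (rule lin_comp[OF assms(2) bilin_lin1[OF assms(1) lin_closed[OF assms(3)]]])
qed

lemma tensor_vs' [lins]: "vs V \<Longrightarrow> vs W \<Longrightarrow> vs (tensor K V W)"
  by (rule tensor_vs)

lemma ptensor_closed' [lins]:
  "v \<in> carrier V \<Longrightarrow> w \<in> carrier W \<Longrightarrow> vs V \<Longrightarrow> vs W \<Longrightarrow> ptensor K V W v w \<in> carrier (tensor K V W)"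
  by (rule ptensor_closed)

lemma smult_closed' [lins]: "a \<in> carrier K \<Longrightarrow> v \<in> carrier V \<Longrightarrow> vs V \<Longrightarrow> a \<odot>\<^bsub>V\<^esub> v \<in> carrier V"
  by (rule module.smult_closed)

lemma lin_ptensor1 [lins]:
  "lin X V f \<Longrightarrow> w \<in> carrier W \<Longrightarrow> vs V \<Longrightarrow> vs W \<Longrightarrow> lin X (tensor K V W) (\<lambda>x. ptensor K V W (f x) w)"
  by (rule lin_comp[OF _ bilin_lin1[OF ptensor_bilin]])

lemma lin_ptensor2 [lins]:
  "lin X W f \<Longrightarrow> v \<in> carrier V \<Longrightarrow> vs V \<Longrightarrow> vs W \<Longrightarrow> lin X (tensor K V W) (\<lambda>x. ptensor K V W v (f x))"
  by (rule lin_comp[OF _ bilin_lin2[OF ptensor_bilin]])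

lemma lin_tsum [lins]:
  "lin X (tensor K V W) T \<Longrightarrow> bilin V W U \<beta> \<Longrightarrow> vs V \<Longrightarrow> vs W \<Longrightarrow> vs U \<Longrightarrow>
    lin X U (\<lambda>x. tsum K U (T x) \<beta>)"
  by (rule lin_comp[OF _ tsum_lin])

lemma tsum_closed [lins]:
  "t \<in> carrier (tensor K V W) \<Longrightarrow> bilin V W U \<beta> \<Longrightarrow> vs V \<Longrightarrow> vs W \<Longrightarrow> vs U \<Longrightarrow>
    tsum K U t \<beta> \<in> carrier U"
  by (rule lin_closed[OF tsum_lin])

lemma lin_tsum_param [lins]:
  assumes t: "t \<in> carrier (tensor K V W)"
    and l: "\<And>v w. v \<in> carrier V \<Longrightarrow> w \<in> carrier W \<Longrightarrow> lin X U (\<lambda>x. \<beta> x v w)"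
    and b: "\<And>x. x \<in> carrier X \<Longrightarrow> bilin V W U (\<beta> x)"
    and vs: "vs V" "vs W" "vs U" "vs X"
  shows "lin X U (\<lambda>x. tsum K U t (\<beta> x))"
proof -
  interpret X: module K X by fact
  note tl = tsum_lin[OF vs(1,2,3) b]
  note tp = tsum_ptensor[OF vs(1,2,3) b]
  show ?thesis
  proof (rule linI)
    fix x assume "x \<in> carrier X"
    then show "tsum K U t (\<beta> x) \<in> carrier U" using lin_closed[OF tl t] by blast
  next
    fix x y assume x: "x \<in> carrier X" and y: "y \<in> carrier X"
    then have xy: "x \<oplus>\<^bsub>X\<^esub> y \<in> carrier X" by simp
    show "tsum K U t (\<beta> (x \<oplus>\<^bsub>X\<^esub> y)) = tsum K U t (\<beta> x) \<oplus>\<^bsub>U\<^esub> tsum K U t (\<beta> y)"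
      by (rule tensor_eqI[OF vs(1,2,3) tl[OF xy] lin_add_fun[OF tl[OF x] tl[OF y] vs(3)] _ t])
        (simp add: tp x y xy lin_add[OF l])
  next
    fix a x assume a: "a \<in> carrier K" and x: "x \<in> carrier X"
    then have ax: "a \<odot>\<^bsub>X\<^esub> x \<in> carrier X" by simp
    show "tsum K U t (\<beta> (a \<odot>\<^bsub>X\<^esub> x)) = a \<odot>\<^bsub>U\<^esub> tsum K U t (\<beta> x)"
      by (rule tensor_eqI[OF vs(1,2,3) tl[OF ax] lin_smult_fun[OF tl[OF x] a vs(3)] _ t])
        (simp add: tp a x ax lin_smult[OF l])
  qed
qed

lemma bilinI' [lins]:
  assumes "\<And>v. v \<in> carrier V \<Longrightarrow> lin W U (\<lambda>w. \<beta> v w)" "\<And>w. w \<in> carrier W \<Longrightarrow> lin V U (\<lambda>v. \<beta> v w)"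
  shows "bilin V W U \<beta>"
  using assms by (rule bilinI)

lemma tsum_hom:
  assumes t: "t \<in> carrier (tensor K V W)" and g: "lin U U' g" and b: "bilin V W U \<beta>"
    and vs: "vs V" "vs W" "vs U" "vs U'"
  shows "g (tsum K U t \<beta>) = tsum K U' t (\<lambda>v w. g (\<beta> v w))"
  by (rule tensor_eqI[OF vs(1,2,4) lin_comp[OF tsum_lin[OF vs(1,2,3) b] g]
        tsum_lin[OF vs(1,2,4) bilin_comp[OF b g]] _ t])
    (simp add: tsum_ptensor[OF vs(1,2,3) b] tsum_ptensor[OF vs(1,2,4) bilin_comp[OF b g]])

text \<open>Bilinearity has to be known for one of the two summands; the other inherits it, since
  they agree on the carriers.\<close>

lemma tsum_cong:
  assumes t: "t \<in> carrier (tensor K V W)" and b: "bilin V W U \<beta>"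
    and eq: "\<And>v w. v \<in> carrier V \<Longrightarrow> w \<in> carrier W \<Longrightarrow> \<beta> v w = \<beta>' v w"
    and vs: "vs V" "vs W" "vs U"
  shows "tsum K U t \<beta> = tsum K U t \<beta>'"
proof -
  have b': "bilin V W U \<beta>'"
  proof (rule bilinI)
    fix v assume "v \<in> carrier V"
    with b eq vs show "lin W U (\<lambda>w. \<beta>' v w)" by (auto intro: lin_cong[OF bilin_lin2[OF b]])
  next
    fix w assume "w \<in> carrier W"
    with b eq vs show "lin V U (\<lambda>v. \<beta>' v w)" by (auto intro: lin_cong[OF bilin_lin1[OF b]])
  qed
  show ?thesis
    by (rule tensor_eqI[OF vs tsum_lin[OF vs b] tsum_lin[OF vs b'] _ t])
      (simp add: tsum_ptensor[OF vs b] tsum_ptensor[OF vs b'] eq)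
qed

lemma tsum_id:
  assumes t: "t \<in> carrier (tensor K V W)" and vs: "vs V" "vs W"
  shows "tsum K (tensor K V W) t (ptensor K V W) = t"
  by (rule tensor_eqI[OF vs tensor_vs[OF vs] tsum_lin[OF vs tensor_vs[OF vs] ptensor_bilin[OF vs]] lin_id _ t])
    (simp add: tsum_ptensor[OF vs tensor_vs[OF vs] ptensor_bilin[OF vs]])

text \<open>The map \<open>f \<otimes> g\<close>. The target modules are parameters because
  \<open>f\<close> and \<open>g\<close>, as bare functions, do not determine them.\<close>

definition tmap where
  "tmap V' W' f g t = tsum K (tensor K V' W') t (\<lambda>v w. ptensor K V' W' (f v) (g w))"

context
  fixes V :: "('k, 'a, 'm1) module_scheme" and W :: "('k, 'b, 'm2) module_scheme"
    and V' :: "('k, 'c, 'm3) module_scheme" and W' :: "('k, 'd, 'm4) module_scheme" and f g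
  assumes vs: "vs V" "vs W" "vs V'" "vs W'" and f: "lin V V' f" and g: "lin W W' g"
begin

lemma tmap_bilin: "bilin V W (tensor K V' W') (\<lambda>v w. ptensor K V' W' (f v) (g w))"
  by (rule bilin_precomp[OF ptensor_bilin[OF vs(3,4)] f g])

lemma tmap_lin: "lin (tensor K V W) (tensor K V' W') (tmap V' W' f g)"
  unfolding tmap_def by (rule tsum_lin[OF vs(1,2) tensor_vs[OF vs(3,4)] tmap_bilin])

lemma tmap_ptensor:
  "v \<in> carrier V \<Longrightarrow> w \<in> carrier W \<Longrightarrow> tmap V' W' f g (ptensor K V W v w) = ptensor K V' W' (f v) (g w)"
  unfolding tmap_def by (rule tsum_ptensor[OF vs(1,2) tensor_vs[OF vs(3,4)] tmap_bilin])

lemma tsum_tmap: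
  assumes b: "bilin V' W' U \<beta>" and U: "vs U" and t: "t \<in> carrier (tensor K V W)"
  shows "tsum K U (tmap V' W' f g t) \<beta> = tsum K U t (\<lambda>v w. \<beta> (f v) (g w))"
  by (rule tensor_eqI[OF vs(1,2) U lin_comp[OF tmap_lin tsum_lin[OF vs(3,4) U b]]
     tsum_lin[OF vs(1,2) U bilin_precomp[OF b f g]] _ t])
    (simp add: tmap_ptensor tsum_ptensor[OF vs(1,2) U bilin_precomp[OF b f g]]
       tsum_ptensor[OF vs(3,4) U b] lin_closed[OF f] lin_closed[OF g])

end

subsection \<open>Complements and functionals\<close>

text \<open>Zorn's lemma yields \<open>M\<close> maximal among the submodules meeting
  \<open>N\<close> trivially. Adjoin a vector \<open>v\<close> to \<open>M\<close>: if the
  intersection with \<open>N\<close> stays trivial, maximality puts \<open>v\<close> into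
  \<open>M\<close>; otherwise some \<open>m + a v\<close> with nonzero \<open>a\<close> lies in
  \<open>N\<close>, and since \<open>K\<close> is a field this can be solved for
  \<open>v\<close>.\<close>

lemma complement_exists:
  assumes V: "vs V" and N: "submodule N K V"
  obtains M where "submodule M K V" "M \<inter> N \<subseteq> {\<zero>\<^bsub>V\<^esub>}"
    "\<And>v. v \<in> carrier V \<Longrightarrow> \<exists>m\<in>M. \<exists>n\<in>N. v = m \<oplus>\<^bsub>V\<^esub> n"
proof -
  interpret V: module K V by (rule V)
  let ?A = "{M. submodule M K V \<and> M \<inter> N \<subseteq> {\<zero>\<^bsub>V\<^esub>}}"
  have "\<exists>M\<in>?A. \<forall>X\<in>?A. M \<subseteq> X \<longrightarrow> X = M"
  proof (rule subset_Zorn_nonempty)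
    show "?A \<noteq> {}" using submodule_triv[OF V] by blast
  next
    fix \<C> assume ne: "\<C> \<noteq> {}" and ch: "subset.chain ?A \<C>"
    have sub: "\<And>X. X \<in> \<C> \<Longrightarrow> submodule X K V" and tot: "\<And>X Y. X \<in> \<C> \<Longrightarrow> Y \<in> \<C> \<Longrightarrow> X \<subseteq> Y \<or> Y \<subseteq> X"
      using ch unfolding subset.chain_def by blast+
    have "submodule (\<Union>\<C>) K V"
    proof (rule submoduleI[OF V])
      show "\<Union>\<C> \<subseteq> carrier V" using sub V.submoduleE(1) by blast
      show "\<zero>\<^bsub>V\<^esub> \<in> \<Union>\<C>" using ne submodule_zero[OF V] sub by blast
    next
      fix a b assume "a \<in> carrier K" "b \<in> \<Union>\<C>" then show "a \<odot>\<^bsub>V\<^esub> b \<in> \<Union>\<C>" using V.submoduleE(4)[OF sub] by blast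
    next
      fix a b assume "a \<in> \<Union>\<C>" "b \<in> \<Union>\<C>"
      then obtain X where "X \<in> \<C>" "a \<in> X" "b \<in> X" using tot by blast
      then show "a \<oplus>\<^bsub>V\<^esub> b \<in> \<Union>\<C>" using V.submoduleE(5)[OF sub] by blast
    qed
    moreover have "\<And>X. X \<in> \<C> \<Longrightarrow> X \<inter> N \<subseteq> {\<zero>\<^bsub>V\<^esub>}" using ch by (auto simp: subset.chain_def)
    ultimately show "\<Union>\<C> \<in> ?A" by blast
  qed
  then obtain M where M: "submodule M K V" "M \<inter> N \<subseteq> {\<zero>\<^bsub>V\<^esub>}"
    and max: "\<And>X. \<lbrakk>submodule X K V; X \<inter> N \<subseteq> {\<zero>\<^bsub>V\<^esub>}; M \<subseteq> X\<rbrakk> \<Longrightarrow> X = M" by auto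
  note Mc = V.submoduleE[OF M(1)] and Nc = V.submoduleE[OF N]
  note M0 = submodule_zero[OF V M(1)] and N0 = submodule_zero[OF V N]
  have "\<exists>m\<in>M. \<exists>n\<in>N. v = m \<oplus>\<^bsub>V\<^esub> n" if v: "v \<in> carrier V" for v
  proof -
    let ?X = "{m \<oplus>\<^bsub>V\<^esub> a \<odot>\<^bsub>V\<^esub> v | m a. m \<in> M \<and> a \<in> carrier K}"
    have X: "submodule ?X K V"
    proof (rule submoduleI[OF V])
      show "?X \<subseteq> carrier V" using Mc(1) v by auto
      show "\<zero>\<^bsub>V\<^esub> \<in> ?X" using M0 v by (intro CollectI exI[of _ "\<zero>\<^bsub>V\<^esub>"] exI[of _ \<zero>]) auto
    next
      fix x y assume "x \<in> ?X" "y \<in> ?X"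
      then obtain m a n b where xy: "x = m \<oplus>\<^bsub>V\<^esub> a \<odot>\<^bsub>V\<^esub> v" "m \<in> M" "a \<in> carrier K"
        "y = n \<oplus>\<^bsub>V\<^esub> b \<odot>\<^bsub>V\<^esub> v" "n \<in> M" "b \<in> carrier K" by blast
      moreover have "m \<in> carrier V" "n \<in> carrier V" using xy Mc(1) by auto
      ultimately have "x \<oplus>\<^bsub>V\<^esub> y = (m \<oplus>\<^bsub>V\<^esub> n) \<oplus>\<^bsub>V\<^esub> (a \<oplus> b) \<odot>\<^bsub>V\<^esub> v" using v
        by (simp add: V.smult_l_distr V.a_ac)
      then show "x \<oplus>\<^bsub>V\<^esub> y \<in> ?X" using xy Mc(5) by blast
    next
      fix c x assume c: "c \<in> carrier K" and "x \<in> ?X"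
      then obtain m a where x: "x = m \<oplus>\<^bsub>V\<^esub> a \<odot>\<^bsub>V\<^esub> v" "m \<in> M" "a \<in> carrier K" by blast
      then have "c \<odot>\<^bsub>V\<^esub> x = c \<odot>\<^bsub>V\<^esub> m \<oplus>\<^bsub>V\<^esub> (c \<otimes> a) \<odot>\<^bsub>V\<^esub> v" using Mc(1) v c
        by (auto simp: V.smult_r_distr V.smult_assoc1)
      then show "c \<odot>\<^bsub>V\<^esub> x \<in> ?X" using x c Mc(4) by auto
    qed
    have MX: "M \<subseteq> ?X"
    proof
      fix m assume m: "m \<in> M"
      then show "m \<in> ?X" using Mc(1) v by (intro CollectI exI[of _ m] exI[of _ \<zero>]) auto
    qed
    show ?thesis
    proof (cases "?X \<inter> N \<subseteq> {\<zero>\<^bsub>V\<^esub>}")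
      case True
      then have "?X = M" using max[OF X True MX] MX by blast
      moreover have "v \<in> ?X" using M0 v by (intro CollectI exI[of _ "\<zero>\<^bsub>V\<^esub>"] exI[of _ \<one>]) auto
      ultimately have "v \<in> M" by blast
      then show ?thesis using N0 v by (intro bexI[of _ v] bexI[of _ "\<zero>\<^bsub>V\<^esub>"]) auto
    next
      case False
      then obtain m a where n: "m \<oplus>\<^bsub>V\<^esub> a \<odot>\<^bsub>V\<^esub> v \<in> N" "m \<in> M" "a \<in> carrier K" "m \<oplus>\<^bsub>V\<^esub> a \<odot>\<^bsub>V\<^esub> v \<noteq> \<zero>\<^bsub>V\<^esub>"
        by blast
      have mc: "m \<in> carrier V" using n Mc(1) by auto
      have a: "a \<noteq> \<zero>"
      proof
        assume "a = \<zero>"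
        then have "m \<in> N" "m \<noteq> \<zero>\<^bsub>V\<^esub>" using n v mc by auto
        then show False using n M(2) by blast
      qed
      then have ai: "inv a \<in> carrier K" "inv a \<otimes> a = \<one>" using n field_Units by auto
      have "v = inv a \<odot>\<^bsub>V\<^esub> (a \<odot>\<^bsub>V\<^esub> v)" using ai n v by (simp add: V.smult_assoc1[symmetric])
      also have "\<dots> = inv a \<odot>\<^bsub>V\<^esub> (\<ominus>\<^bsub>V\<^esub> m \<oplus>\<^bsub>V\<^esub> (m \<oplus>\<^bsub>V\<^esub> a \<odot>\<^bsub>V\<^esub> v))"
        using n v mc by (simp add: V.r_neg1)
      also have "\<dots> = inv a \<odot>\<^bsub>V\<^esub> (\<ominus>\<^bsub>V\<^esub> m) \<oplus>\<^bsub>V\<^esub> inv a \<odot>\<^bsub>V\<^esub> (m \<oplus>\<^bsub>V\<^esub> a \<odot>\<^bsub>V\<^esub> v)"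
        using n v mc ai by (intro V.smult_r_distr) auto
      finally show ?thesis using ai n Mc(3,4) Nc(4) by blast
    qed
  qed
  then show ?thesis using M that by blast
qed

text \<open>The component in \<open>N\<close> along a complement, unique because the two submodules
  meet in zero. Such projections yield functionals, quotients by coideals and retractions onto
  subcoalgebras below.\<close>

lemma projection_exists:
  assumes V: "vs V" and N: "submodule N K V"
  obtains r where "lin V V r" "\<And>v. v \<in> carrier V \<Longrightarrow> r v \<in> N" "\<And>x. x \<in> N \<Longrightarrow> r x = x"
proof -
  interpret V: module K V by (rule V)
  obtain M where M: "submodule M K V" "M \<inter> N \<subseteq> {\<zero>\<^bsub>V\<^esub>}"
    and ex: "\<And>v. v \<in> carrier V \<Longrightarrow> \<exists>m\<in>M. \<exists>n\<in>N. v = m \<oplus>\<^bsub>V\<^esub> n"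
    by (rule complement_exists[OF assms], rule that)
  note Mc = V.submoduleE[OF M(1)] and Nc = V.submoduleE[OF N]
  note M0 = submodule_zero[OF V M(1)] and N0 = submodule_zero[OF V N]
  define r where "r v = (THE n. n \<in> N \<and> (\<exists>m\<in>M. v = m \<oplus>\<^bsub>V\<^esub> n))" for v
  have r_eq: "r (m \<oplus>\<^bsub>V\<^esub> n) = n" if "m \<in> M" "n \<in> N" for m n
    unfolding r_def
  proof (rule the_equality)
    show "n \<in> N \<and> (\<exists>m'\<in>M. m \<oplus>\<^bsub>V\<^esub> n = m' \<oplus>\<^bsub>V\<^esub> n)" using that by blast
  next
    fix n' assume "n' \<in> N \<and> (\<exists>m'\<in>M. m \<oplus>\<^bsub>V\<^esub> n = m' \<oplus>\<^bsub>V\<^esub> n')"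
    then obtain m' where n': "n' \<in> N" "m' \<in> M" "m \<oplus>\<^bsub>V\<^esub> n = m' \<oplus>\<^bsub>V\<^esub> n'" by blast
    have c: "m \<in> carrier V" "m' \<in> carrier V" "n \<in> carrier V" "n' \<in> carrier V"
      using that n' Mc(1) Nc(1) by auto
    have "\<ominus>\<^bsub>V\<^esub> m' \<oplus>\<^bsub>V\<^esub> m = (\<ominus>\<^bsub>V\<^esub> m' \<oplus>\<^bsub>V\<^esub> (m \<oplus>\<^bsub>V\<^esub> n)) \<oplus>\<^bsub>V\<^esub> \<ominus>\<^bsub>V\<^esub> n"
      using c by (simp add: V.a_assoc V.r_neg)
    also have "\<dots> = n' \<oplus>\<^bsub>V\<^esub> \<ominus>\<^bsub>V\<^esub> n" using c by (simp add: n'(3) V.r_neg1)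
    finally have e: "\<ominus>\<^bsub>V\<^esub> m' \<oplus>\<^bsub>V\<^esub> m = n' \<ominus>\<^bsub>V\<^esub> n" by (simp add: a_minus_def)
    have "\<ominus>\<^bsub>V\<^esub> m' \<oplus>\<^bsub>V\<^esub> m \<in> M" using that n' Mc by blast
    moreover have "n' \<ominus>\<^bsub>V\<^esub> n \<in> N" using that n' Nc by (simp add: a_minus_def)
    ultimately have "n' \<ominus>\<^bsub>V\<^esub> n = \<zero>\<^bsub>V\<^esub>" using M(2) e by auto
    then show "n' = n" using eq_of_minus_zero[OF V] c by blast
  qed
  have "lin V V r"
  proof (rule linI)
    fix v assume "v \<in> carrier V"
    then obtain m n where "m \<in> M" "n \<in> N" "v = m \<oplus>\<^bsub>V\<^esub> n" using ex by blast
    then show "r v \<in> carrier V" using r_eq Nc(1) by auto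
  next
    fix v v' assume v: "v \<in> carrier V" "v' \<in> carrier V"
    obtain m n where 1: "m \<in> M" "n \<in> N" "v = m \<oplus>\<^bsub>V\<^esub> n" using ex v by blast
    obtain m' n' where 2: "m' \<in> M" "n' \<in> N" "v' = m' \<oplus>\<^bsub>V\<^esub> n'" using ex v by blast
    have c: "m \<in> carrier V" "m' \<in> carrier V" "n \<in> carrier V" "n' \<in> carrier V"
      using 1 2 Mc(1) Nc(1) by auto
    have "v \<oplus>\<^bsub>V\<^esub> v' = (m \<oplus>\<^bsub>V\<^esub> m') \<oplus>\<^bsub>V\<^esub> (n \<oplus>\<^bsub>V\<^esub> n')" using 1 2 c by (simp add: V.a_ac)
    then show "r (v \<oplus>\<^bsub>V\<^esub> v') = r v \<oplus>\<^bsub>V\<^esub> r v'" using 1 2 r_eq Mc(5) Nc(5) by simp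
  next
    fix a v assume a: "a \<in> carrier K" and v: "v \<in> carrier V"
    obtain m n where 1: "m \<in> M" "n \<in> N" "v = m \<oplus>\<^bsub>V\<^esub> n" using ex v by blast
    have c: "m \<in> carrier V" "n \<in> carrier V" using 1 Mc(1) Nc(1) by auto
    have "a \<odot>\<^bsub>V\<^esub> v = a \<odot>\<^bsub>V\<^esub> m \<oplus>\<^bsub>V\<^esub> a \<odot>\<^bsub>V\<^esub> n" using 1 c a by (simp add: V.smult_r_distr)
    then show "r (a \<odot>\<^bsub>V\<^esub> v) = a \<odot>\<^bsub>V\<^esub> r v" using 1 a r_eq Mc(4) Nc(4) by simp
  qed
  moreover have "r v \<in> N" if "v \<in> carrier V" for v using ex[OF that] r_eq by auto
  moreover have "r x = x" if "x \<in> N" for x using r_eq[OF M0 that] that Nc(1) by auto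
  ultimately show ?thesis using that by blast
qed

text \<open>Project onto the line spanned by \<open>w\<close> and read off the coefficient, which is
  unique because \<open>w\<close> is nonzero and nonzero scalars are invertible.\<close>

lemma functional_exists:
  assumes V: "vs V" and w: "w \<in> carrier V" "w \<noteq> \<zero>\<^bsub>V\<^esub>"
  obtains f where "lin V scalars f" "f w = \<one>"
proof -
  interpret V: module K V by (rule V)
  let ?L = "(\<lambda>a. a \<odot>\<^bsub>V\<^esub> w) ` carrier K"
  have L: "submodule ?L K V"
    using submodule_image[OF scalars_vs V lin_smult_left[OF lin_id w(1) V]] by simp
  have scale: "a = \<zero>" if "a \<in> carrier K" "a \<odot>\<^bsub>V\<^esub> w = \<zero>\<^bsub>V\<^esub>" for a
  proof (rule ccontr)
    assume "a \<noteq> \<zero>"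
    then have ai: "inv a \<in> carrier K" "inv a \<otimes> a = \<one>" using that field_Units by auto
    have "w = inv a \<odot>\<^bsub>V\<^esub> (a \<odot>\<^bsub>V\<^esub> w)" using ai(2) that(1) ai(1) w(1) by (simp add: V.smult_assoc1[symmetric])
    then show False using that(2) ai(1) w by simp
  qed
  obtain r where r: "lin V V r" "\<And>v. v \<in> carrier V \<Longrightarrow> r v \<in> ?L" "\<And>x. x \<in> ?L \<Longrightarrow> r x = x"
    by (rule projection_exists[OF V L], rule that)
  define f where "f v = (THE a. a \<in> carrier K \<and> r v = a \<odot>\<^bsub>V\<^esub> w)" for v
  have f_eq: "f v = a" if "a \<in> carrier K" "r v = a \<odot>\<^bsub>V\<^esub> w" for a v
    unfolding f_def
  proof (rule the_equality)
    show "a \<in> carrier K \<and> r v = a \<odot>\<^bsub>V\<^esub> w" using that by blast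
  next
    fix b assume b: "b \<in> carrier K \<and> r v = b \<odot>\<^bsub>V\<^esub> w"
    then have "(b \<ominus> a) \<odot>\<^bsub>V\<^esub> w = b \<odot>\<^bsub>V\<^esub> w \<ominus>\<^bsub>V\<^esub> a \<odot>\<^bsub>V\<^esub> w"
      using that w by (simp add: a_minus_def V.smult_l_distr V.smult_l_minus)
    also have "\<dots> = \<zero>\<^bsub>V\<^esub>" using b that w by (simp add: a_minus_def V.r_neg)
    finally have "b \<ominus> a = \<zero>" using scale[of "b \<ominus> a"] b that by simp
    moreover have "b = (b \<ominus> a) \<oplus> a" using b that by (simp add: a_minus_def a_assoc l_neg)
    ultimately show "b = a" using that by simp
  qed
  have f: "f v \<in> carrier K \<and> r v = f v \<odot>\<^bsub>V\<^esub> w" if "v \<in> carrier V" for v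
    using r(2)[OF that] f_eq by auto
  have "lin V scalars f"
  proof (rule linI)
    fix x y assume xy: "x \<in> carrier V" "y \<in> carrier V"
    then have "r (x \<oplus>\<^bsub>V\<^esub> y) = (f x \<oplus> f y) \<odot>\<^bsub>V\<^esub> w"
      using f[OF xy(1)] f[OF xy(2)] w by (simp add: lin_add[OF r(1)] V.smult_l_distr)
    then show "f (x \<oplus>\<^bsub>V\<^esub> y) = f x \<oplus>\<^bsub>scalars\<^esub> f y"
      using f[OF xy(1)] f[OF xy(2)] by (simp add: f_eq)
  next
    fix a x assume a: "a \<in> carrier K" and x: "x \<in> carrier V"
    then have "r (a \<odot>\<^bsub>V\<^esub> x) = (a \<otimes> f x) \<odot>\<^bsub>V\<^esub> w"
      using f[OF x] w by (simp add: lin_smult[OF r(1)] V.smult_assoc1)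
    then show "f (a \<odot>\<^bsub>V\<^esub> x) = a \<odot>\<^bsub>scalars\<^esub> f x"
      using f[OF x] a by (simp add: f_eq)
  qed (simp add: f)
  moreover have "w \<in> ?L" using w by (intro image_eqI[of _ _ \<one>]) auto
  then have "f w = \<one>" using w r(3)[of w] by (intro f_eq) auto
  ultimately show ?thesis using that by blast
qed

definition separating where
  "separating W \<A> \<longleftrightarrow> (\<forall>\<alpha>\<in>\<A>. lin W scalars \<alpha>) \<and>
     (\<forall>w\<in>carrier W. (\<forall>\<alpha>\<in>\<A>. \<alpha> w = \<zero>) \<longrightarrow> w = \<zero>\<^bsub>W\<^esub>)"

lemma separatingD:
  "separating W \<A> \<Longrightarrow> \<alpha> \<in> \<A> \<Longrightarrow> lin W scalars \<alpha>"
  "separating W \<A> \<Longrightarrow> w \<in> carrier W \<Longrightarrow> (\<And>\<alpha>. \<alpha> \<in> \<A> \<Longrightarrow> \<alpha> w = \<zero>) \<Longrightarrow> w = \<zero>\<^bsub>W\<^esub>"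
  by (auto simp: separating_def)

lemma separating_all:
  assumes V: "vs V" shows "separating V {f. lin V scalars f}"
proof -
  interpret V: module K V by (rule V)
  have "w = \<zero>\<^bsub>V\<^esub>" if w: "w \<in> carrier V" and f: "\<And>f. lin V scalars f \<Longrightarrow> f w = \<zero>" for w
  proof (rule ccontr)
    assume "w \<noteq> \<zero>\<^bsub>V\<^esub>"
    then obtain f where "lin V scalars f" "f w = \<one>"
      using functional_exists[OF V w] by blast
    then show False using f by fastforce
  qed
  then show ?thesis by (auto simp: separating_def)
qed

context
  fixes V :: "('k, 'a, 'm) module_scheme" and W :: "('k, 'b, 'n) module_scheme"
  assumes V: "vs V" and W: "vs W"
begin

interpretation V: module K V by (rule V)
interpretation W: module K W by (rule W)
interpretation VW: module K "tensor K V W" by (rule tensor_vs[OF V W])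

lemma functional_slice_bilin:
  assumes f: "lin V scalars f" shows "bilin V W W (\<lambda>v w. f v \<odot>\<^bsub>W\<^esub> w)"
  using f by (intro bilinI lin_smult_left lin_smult_fun lin_id W) (auto dest: lin_closed)

lemma functional_slice_bilin':
  assumes g: "lin W scalars g" shows "bilin V W V (\<lambda>v w. g w \<odot>\<^bsub>V\<^esub> v)"
  using g by (intro bilinI lin_smult_left lin_smult_fun lin_id V) (auto dest: lin_closed)

text \<open>The induction is over the number of summands of \<open>t\<close>; the endomorphism \<open>q\<close> is generalised because
  the step composes it with \<open>x \<mapsto> x - g x \<cdot> q v\<close>, which annihilates the leading summand \<open>v \<otimes> w\<close>.\<close>

lemma tensor_slices_zero:
  assumes t: "t \<in> carrier (tensor K V W)" and q: "lin V V q"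
    and z: "\<And>f. lin V scalars f \<Longrightarrow> tsum K W t (\<lambda>v w. f (q v) \<odot>\<^bsub>W\<^esub> w) = \<zero>\<^bsub>W\<^esub>"
  shows "tmap V W q (\<lambda>w. w) t = \<zero>\<^bsub>tensor K V W\<^esub>"
proof -
  note pl = bilin_lin1[OF ptensor_bilin[OF V W]] and pc = ptensor_closed[OF V W]
  have p0: "ptensor K V W \<zero>\<^bsub>V\<^esub> w = \<zero>\<^bsub>tensor K V W\<^esub>" if "w \<in> carrier W" for w
    by (rule lin_zero[OF V tensor_vs[OF V W] pl[OF that]])
  have p0': "ptensor K V W v \<zero>\<^bsub>W\<^esub> = \<zero>\<^bsub>tensor K V W\<^esub>" if "v \<in> carrier V" for v
    by (rule lin_zero[OF W tensor_vs[OF V W] bilin_lin2[OF ptensor_bilin[OF V W] that]])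
  have qb: "bilin V W W (\<lambda>v w. f (q v) \<odot>\<^bsub>W\<^esub> w)" if "lin V scalars f" "lin V V q" for f q
    by (rule functional_slice_bilin[OF lin_comp[OF that(2,1)]])
  note sl = tsum_lin[OF V W W qb] and sp = tsum_ptensor[OF V W W qb]
  note ml = tmap_lin[OF V W V W _ lin_id] and mp = tmap_ptensor[OF V W V W _ lin_id]
  let ?P = "\<lambda>t. \<forall>q. lin V V q \<longrightarrow> (\<forall>f. lin V scalars f \<longrightarrow> tsum K W t (\<lambda>v w. f (q v) \<odot>\<^bsub>W\<^esub> w) = \<zero>\<^bsub>W\<^esub>) \<longrightarrow>
    tmap V W q (\<lambda>w. w) t = \<zero>\<^bsub>tensor K V W\<^esub>"
  have step: "tmap V W q (\<lambda>w. w) t = \<zero>\<^bsub>tensor K V W\<^esub>"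
    if q: "lin V V q" and v: "v \<in> carrier V" and t: "t \<in> carrier (tensor K V W)"
      and z: "\<And>f. lin V scalars f \<Longrightarrow> tsum K W t (\<lambda>v w. f (q v) \<odot>\<^bsub>W\<^esub> w) = \<zero>\<^bsub>W\<^esub>"
      and IH: "\<And>q1. \<lbrakk>lin V V q1; q1 v = \<zero>\<^bsub>V\<^esub>;
        \<And>f. lin V scalars f \<Longrightarrow> tsum K W t (\<lambda>v w. f (q1 v) \<odot>\<^bsub>W\<^esub> w) = \<zero>\<^bsub>W\<^esub>\<rbrakk> \<Longrightarrow>
        tmap V W q1 (\<lambda>w. w) t = \<zero>\<^bsub>tensor K V W\<^esub>" for q v t
  proof (cases "q v = \<zero>\<^bsub>V\<^esub>")
    case True
    then show ?thesis using IH q z by blast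
  next
    case False
    have qv: "q v \<in> carrier V" by (rule lin_closed[OF q v])
    obtain g where g: "lin V scalars g" "g (q v) = \<one>" using functional_exists[OF V qv False] by blast
    have gq: "g (q u) \<in> carrier K" if "u \<in> carrier V" for u using lin_closed[OF g(1) lin_closed[OF q that]] by simp
    define q1 where "q1 u = q u \<ominus>\<^bsub>V\<^esub> g (q u) \<odot>\<^bsub>V\<^esub> q v" for u
    have gl: "lin V V (\<lambda>u. g (q u) \<odot>\<^bsub>V\<^esub> q v)" by (rule lin_smult_left[OF lin_comp[OF q g(1)] qv V])
    have q1: "lin V V q1" unfolding q1_def by (rule lin_minus_fun[OF q gl V])
    have "q1 v = \<zero>\<^bsub>V\<^esub>" using qv by (simp add: q1_def g a_minus_def[of V] V.r_neg)
    moreover have "tsum K W t (\<lambda>v w. f (q1 v) \<odot>\<^bsub>W\<^esub> w) = \<zero>\<^bsub>W\<^esub>" if f: "lin V scalars f" for f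
    proof -
      have eq: "lin V scalars (\<lambda>u. f (u \<ominus>\<^bsub>V\<^esub> g u \<odot>\<^bsub>V\<^esub> q v))"
        by (rule lin_comp[OF lin_minus_fun[OF lin_id lin_smult_left[OF g(1) qv V] V] f])
      show ?thesis unfolding q1_def using z[OF eq] .
    qed
    ultimately have 0: "tmap V W q1 (\<lambda>w. w) t = \<zero>\<^bsub>tensor K V W\<^esub>" using IH q1 by blast
    interpret VW: module K "tensor K V W" by (rule tensor_vs[OF V W])
    \<comment> \<open>Here \<open>q\<close> is split into \<open>q1\<close> and its component along
      \<open>q v\<close>. The second part contributes \<open>q v\<close> tensored with the slice of
      \<open>t\<close> by \<open>g\<close>, and that slice vanishes by \<open>z\<close>.\<close>
    have "tmap V W q (\<lambda>w. w) t = tmap V W q1 (\<lambda>w. w) t \<oplus>\<^bsub>tensor K V W\<^esub>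
        ptensor K V W (q v) (tsum K W t (\<lambda>v w. g (q v) \<odot>\<^bsub>W\<^esub> w))"
    proof (rule tensor_eqI[OF V W tensor_vs[OF V W] ml[OF q] lin_add_fun[OF ml[OF q1]
          lin_comp[OF sl[OF g(1) q] bilin_lin2[OF ptensor_bilin[OF V W] qv]] tensor_vs[OF V W]] _ t])
      fix u w assume uw: "u \<in> carrier V" "w \<in> carrier W"
      have "q u = q1 u \<oplus>\<^bsub>V\<^esub> g (q u) \<odot>\<^bsub>V\<^esub> q v"
        using lin_closed[OF q uw(1)] gq[OF uw(1)] qv by (simp add: q1_def a_minus_def V.a_assoc V.l_neg)
      then have "ptensor K V W (q u) w = ptensor K V W (q1 u) w \<oplus>\<^bsub>tensor K V W\<^esub>
          g (q u) \<odot>\<^bsub>tensor K V W\<^esub> ptensor K V W (q v) w"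
        using lin_add[OF pl[OF uw(2)], of "q1 u" "g (q u) \<odot>\<^bsub>V\<^esub> q v"] lin_closed[OF q1 uw(1)] gq[OF uw(1)] qv
          lin_smult[OF pl[OF uw(2)] gq[OF uw(1)] qv] by simp
      then show "tmap V W q (\<lambda>w. w) (ptensor K V W u w) = tmap V W q1 (\<lambda>w. w) (ptensor K V W u w) \<oplus>\<^bsub>tensor K V W\<^esub>
        ptensor K V W (q v) (tsum K W (ptensor K V W u w) (\<lambda>v w. g (q v) \<odot>\<^bsub>W\<^esub> w))"
        using uw by (simp add: mp q q1 sp g(1)
          lin_smult[OF bilin_lin2[OF ptensor_bilin[OF V W] qv] gq[OF uw(1)]])
    qed
    then show ?thesis using 0 z[OF g(1)] qv by (simp add: p0')
  qed
  have "?P t" using t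
  proof (rule tensor_induct[OF V W])
    fix v w assume vw: "v \<in> carrier V" "w \<in> carrier W"
    show "?P (ptensor K V W v w)"
    proof (intro allI impI, rule step[OF _ vw(1) pc[OF vw]])
      fix q q1 assume "lin V V q1" "q1 v = \<zero>\<^bsub>V\<^esub>"
      then show "tmap V W q1 (\<lambda>w. w) (ptensor K V W v w) = \<zero>\<^bsub>tensor K V W\<^esub>"
        using vw by (simp add: mp p0)
    qed blast+
  next
    fix v w s assume vw: "v \<in> carrier V" "w \<in> carrier W" and s: "s \<in> carrier (tensor K V W)" and IH: "?P s"
    interpret VW: module K "tensor K V W" by (rule tensor_vs[OF V W])
    have c: "ptensor K V W v w \<oplus>\<^bsub>tensor K V W\<^esub> s \<in> carrier (tensor K V W)" using pc[OF vw] s by simp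
    show "?P (ptensor K V W v w \<oplus>\<^bsub>tensor K V W\<^esub> s)"
    proof (intro allI impI, rule step[OF _ vw(1) c])
      fix q q1 assume q1: "lin V V q1" "q1 v = \<zero>\<^bsub>V\<^esub>"
        and z: "\<And>f. lin V scalars f \<Longrightarrow>
          tsum K W (ptensor K V W v w \<oplus>\<^bsub>tensor K V W\<^esub> s) (\<lambda>v w. f (q1 v) \<odot>\<^bsub>W\<^esub> w) = \<zero>\<^bsub>W\<^esub>"
      have "tsum K W s (\<lambda>v w. f (q1 v) \<odot>\<^bsub>W\<^esub> w) = \<zero>\<^bsub>W\<^esub>" if f: "lin V scalars f" for f
        using z[OF f] q1 vw s lin_closed[OF sl[OF f q1(1)] s]
        by (simp add: lin_add[OF sl[OF f q1(1)] pc[OF vw] s] sp f lin_zero[OF V scalars_vs f])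
      then have "tmap V W q1 (\<lambda>w. w) s = \<zero>\<^bsub>tensor K V W\<^esub>" using IH q1(1) by blast
      then show "tmap V W q1 (\<lambda>w. w) (ptensor K V W v w \<oplus>\<^bsub>tensor K V W\<^esub> s) = \<zero>\<^bsub>tensor K V W\<^esub>"
        using q1 vw s by (simp add: lin_add[OF ml[OF q1(1)] pc[OF vw] s] mp p0)
    qed blast+
  qed
  then show ?thesis using q z by blast
qed

text \<open>Contracting the left factor with \<open>f\<close> and the right factor with
  \<open>\<alpha>\<close> can be done in either order. Hence, if the contractions with a separating
  family on the right vanish, so do those with every functional on the left, and the latter detect
  tensors by \<open>tensor_slices_zero\<close>.\<close>

lemma tensor_eq_zeroI:
  assumes sep: "separating W \<A>" and t: "t \<in> carrier (tensor K V W)"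
    and z: "\<And>\<alpha>. \<alpha> \<in> \<A> \<Longrightarrow> tsum K V t (\<lambda>v w. \<alpha> w \<odot>\<^bsub>V\<^esub> v) = \<zero>\<^bsub>V\<^esub>"
  shows "t = \<zero>\<^bsub>tensor K V W\<^esub>"
proof -
  have "tsum K W t (\<lambda>v w. f v \<odot>\<^bsub>W\<^esub> w) = \<zero>\<^bsub>W\<^esub>" if f: "lin V scalars f" for f
  proof (rule separatingD(2)[OF sep])
    note b = functional_slice_bilin[OF f]
    show "tsum K W t (\<lambda>v w. f v \<odot>\<^bsub>W\<^esub> w) \<in> carrier W" by (rule lin_closed[OF tsum_lin[OF V W W b] t])
    fix \<alpha> assume \<alpha>: "\<alpha> \<in> \<A>"
    note al = separatingD(1)[OF sep \<alpha>]
    have ac: "\<alpha> w \<in> carrier K" if "w \<in> carrier W" for w using lin_closed[OF al that] by simp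
    have fc: "f v \<in> carrier K" if "v \<in> carrier V" for v using lin_closed[OF f that] by simp
    have "\<alpha> (tsum K W t (\<lambda>v w. f v \<odot>\<^bsub>W\<^esub> w)) = tsum K scalars t (\<lambda>v w. \<alpha> (f v \<odot>\<^bsub>W\<^esub> w))"
      by (rule tsum_hom[OF t al b V W W scalars_vs])
    also have "\<dots> = tsum K scalars t (\<lambda>v w. f (\<alpha> w \<odot>\<^bsub>V\<^esub> v))"
      by (rule tsum_cong[OF t bilin_comp[OF b al] _ V W scalars_vs])
        (simp add: lin_smult[OF al] lin_smult[OF f] ac fc m_comm)
    also have "\<dots> = f (tsum K V t (\<lambda>v w. \<alpha> w \<odot>\<^bsub>V\<^esub> v))"
      by (rule tsum_hom[OF t f functional_slice_bilin'[OF al] V W V scalars_vs, symmetric])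
    also have "\<dots> = \<zero>" using z[OF \<alpha>] lin_zero[OF V scalars_vs f] by simp
    finally show "\<alpha> (tsum K W t (\<lambda>v w. f v \<odot>\<^bsub>W\<^esub> w)) = \<zero>" .
  qed
  from tensor_slices_zero[OF t lin_id this] show ?thesis
    using tsum_id[OF t V W] by (simp add: tmap_def)
qed

lemma tensor_eqI_separating:
  assumes sep: "separating W \<A>" and t: "t \<in> carrier (tensor K V W)" and s: "s \<in> carrier (tensor K V W)"
    and eq: "\<And>\<alpha>. \<alpha> \<in> \<A> \<Longrightarrow> tsum K V t (\<lambda>v w. \<alpha> w \<odot>\<^bsub>V\<^esub> v) = tsum K V s (\<lambda>v w. \<alpha> w \<odot>\<^bsub>V\<^esub> v)"
  shows "t = s"
proof (rule eq_of_minus_zero[OF tensor_vs[OF V W] _ t s], rule tensor_eq_zeroI[OF sep])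
  show "t \<ominus>\<^bsub>tensor K V W\<^esub> s \<in> carrier (tensor K V W)" using t s by simp
next
  fix \<alpha> assume \<alpha>: "\<alpha> \<in> \<A>"
  note al = separatingD(1)[OF sep \<alpha>]
  have ac: "\<alpha> w \<in> carrier K" if "w \<in> carrier W" for w using lin_closed[OF al that] by simp
  have b: "bilin V W V (\<lambda>v w. \<alpha> w \<odot>\<^bsub>V\<^esub> v)"
    using al by (intro bilinI lin_smult_left lin_smult_fun lin_id V) (auto simp: ac)
  note l = tsum_lin[OF V W V b]
  show "tsum K V (t \<ominus>\<^bsub>tensor K V W\<^esub> s) (\<lambda>v w. \<alpha> w \<odot>\<^bsub>V\<^esub> v) = \<zero>\<^bsub>V\<^esub>"
    using eq[OF \<alpha>] lin_closed[OF l s]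
    by (simp add: lin_minus[OF tensor_vs[OF V W] V l t s] V.r_neg a_minus_def[of V])
qed

text \<open>Two contractions in succession: the right factor is tested with \<open>\<B>\<close>, and
  the vector of \<open>V\<close> that remains is tested with \<open>\<A>\<close>.\<close>

lemma separating_tensor:
  assumes \<A>: "separating V \<A>" and \<B>: "separating W \<B>"
  shows "separating (tensor K V W) {\<lambda>s. tsum K scalars s (\<lambda>v w. \<alpha> v \<otimes> \<beta> w) | \<alpha> \<beta>. \<alpha> \<in> \<A> \<and> \<beta> \<in> \<B>}"
    (is "separating _ ?\<Theta>")
proof -
  note l = separatingD(1)[OF \<A>] separatingD(1)[OF \<B>]
  have b: "bilin V W scalars (\<lambda>v w. \<alpha> v \<otimes> \<beta> w)" if "\<alpha> \<in> \<A>" "\<beta> \<in> \<B>" for \<alpha> \<beta>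
    using lin_smult_left[OF l(1)[OF that(1)] _ scalars_vs] lin_smult_fun[OF l(2)[OF that(2)] _ scalars_vs]
      lin_closed[OF l(1)[OF that(1)]] lin_closed[OF l(2)[OF that(2)]] by (intro bilinI) simp_all
  show ?thesis
    unfolding separating_def
  proof (intro conjI ballI impI)
    fix f assume "f \<in> ?\<Theta>"
    then show "lin (tensor K V W) scalars f" using tsum_lin[OF V W scalars_vs b] by blast
  next
    fix s assume s: "s \<in> carrier (tensor K V W)" and z: "\<forall>f\<in>?\<Theta>. f s = \<zero>"
    show "s = \<zero>\<^bsub>tensor K V W\<^esub>"
    proof (rule tensor_eq_zeroI[OF \<B> s], rule separatingD(2)[OF \<A>])
      fix \<beta> assume \<beta>: "\<beta> \<in> \<B>"
      note b' = functional_slice_bilin'[OF l(2)[OF \<beta>]]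
      show "tsum K V s (\<lambda>v w. \<beta> w \<odot>\<^bsub>V\<^esub> v) \<in> carrier V" by (rule lin_closed[OF tsum_lin[OF V W V b'] s])
      fix \<alpha> assume \<alpha>: "\<alpha> \<in> \<A>"
      note al = l(1)[OF \<alpha>]
      have "\<alpha> (tsum K V s (\<lambda>v w. \<beta> w \<odot>\<^bsub>V\<^esub> v)) = tsum K scalars s (\<lambda>v w. \<alpha> (\<beta> w \<odot>\<^bsub>V\<^esub> v))"
        by (rule tsum_hom[OF s al b' V W V scalars_vs])
      also have "\<dots> = tsum K scalars s (\<lambda>v w. \<alpha> v \<otimes> \<beta> w)"
        using lin_closed[OF al] lin_closed[OF l(2)[OF \<beta>]]
        by (intro tsum_cong[OF s bilin_comp[OF b' al] _ V W scalars_vs]) (simp add: lin_smult[OF al] m_comm)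
      also have "\<dots> = \<zero>"
      proof -
        have "(\<lambda>s. tsum K scalars s (\<lambda>v w. \<alpha> v \<otimes> \<beta> w)) \<in> ?\<Theta>" using \<alpha> \<beta> by blast
        from bspec[OF z this] show ?thesis .
      qed
      finally show "\<alpha> (tsum K V s (\<lambda>v w. \<beta> w \<odot>\<^bsub>V\<^esub> v)) = \<zero>" .
    qed
  qed
qed

end

end

section \<open>Sweedler sums in a coalgebra\<close>

context vector_spaces
begin

lemma lin_app: "lin W U g \<Longrightarrow> lin V W f \<Longrightarrow> lin V U (\<lambda>x. g (f x))"
  by (rule lin_comp)

lemma coalgebra_vs [lins]: "coalgebra K C \<Longrightarrow> vs C"
  by (simp add: coalgebra_def)

lemma lin_comult [lins]:
  "lin X C f \<Longrightarrow> coalgebra K C \<Longrightarrow> lin X (tensor K C C) (\<lambda>x. comult C (f x))"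
  by (rule lin_app[OF coalgebra.comult_linear])

lemma comult_closed [lins]:
  "x \<in> carrier C \<Longrightarrow> coalgebra K C \<Longrightarrow> comult C x \<in> carrier (tensor K C C)"
  by (rule lin_closed[OF coalgebra.comult_linear])

lemma counit_lin: "coalgebra K C \<Longrightarrow> lin C scalars (counit C)"
  by (rule linI) (simp_all add: coalgebra.counit_closed coalgebra.counit_add coalgebra.counit_smult)

lemma lin_counit [lins]:
  "lin X C f \<Longrightarrow> coalgebra K C \<Longrightarrow> lin X scalars (\<lambda>x. counit C (f x))"
  by (rule lin_app[OF counit_lin])

lemma counit_closed' [lins]: "x \<in> carrier C \<Longrightarrow> coalgebra K C \<Longrightarrow> counit C x \<in> carrier K"
  by (rule coalgebra.counit_closed)

text \<open>The coassociativity axiom is the universal case, with the triple tensor as summand;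
  applying the linear map \<open>g\<close> induced by the trilinear \<open>\<beta>\<close> gives
  every other case.\<close>

lemma coassoc_tsum:
  assumes C: "coalgebra K C" and U: "vs U" and c: "c \<in> carrier C"
    and b: "\<And>a. a \<in> carrier C \<Longrightarrow> bilin C C U (\<beta> a)"
    and l: "\<And>a b. a \<in> carrier C \<Longrightarrow> b \<in> carrier C \<Longrightarrow> lin C U (\<lambda>x. \<beta> x a b)"
  shows "tsum K U (comult C c) (\<lambda>c1 c'. tsum K U (comult C c') (\<lambda>c2 c3. \<beta> c1 c2 c3)) =
    tsum K U (comult C c) (\<lambda>c' c3. tsum K U (comult C c') (\<lambda>c1 c2. \<beta> c1 c2 c3))"
proof -
  let ?T = "tensor3 K C C C"
  have V: "vs C" by (rule coalgebra_vs[OF C])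
  have VV: "vs (tensor K C C)" by (rule tensor_vs[OF V V])
  have VT: "vs ?T" by (rule tensor_vs[OF V VV])
  define g where "g t = tsum K U t (\<lambda>a s. tsum K U s (\<beta> a))" for t
  have bg: "bilin C (tensor K C C) U (\<lambda>a s. tsum K U s (\<beta> a))"
    by (assumption | rule V VV U b l lins)+
  have g: "lin ?T U g" unfolding g_def by (assumption | rule V VV U b l lins bg)+
  have g3: "g (ptensor3 K C C C x y z) = \<beta> x y z" if "x \<in> carrier C" "y \<in> carrier C" "z \<in> carrier C" for x y z
    unfolding g_def using that by (simp add: tsum_ptensor[OF V VV U bg] tsum_ptensor[OF V V U b] ptensor_closed[OF V V])
  have b1: "bilin C C ?T (\<lambda>c2 c3. ptensor3 K C C C c1 c2 c3)" if "c1 \<in> carrier C" for c1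
    using that by - (assumption | rule V VV U lins)+
  have b2: "bilin C C ?T (\<lambda>c1 c2. ptensor3 K C C C c1 c2 c3)" if "c3 \<in> carrier C" for c3
    using that by - (assumption | rule V VV U lins)+
  have B1: "bilin C C ?T (\<lambda>c1 c'. tsum K ?T (comult C c') (\<lambda>c2 c3. ptensor3 K C C C c1 c2 c3))"
    by (assumption | rule V VV U C lins)+
  have B2: "bilin C C ?T (\<lambda>c' c3. tsum K ?T (comult C c') (\<lambda>c1 c2. ptensor3 K C C C c1 c2 c3))"
    by (assumption | rule V VV U C lins)+
  have B3: "bilin C C U (\<lambda>c1 c'. tsum K U (comult C c') (\<lambda>c2 c3. \<beta> c1 c2 c3))"
    by (assumption | rule V VV U C b l lins)+
  have bl1: "lin C U (\<beta> x y)" if "x \<in> carrier C" "y \<in> carrier C" for x y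
    using bilin_lin2[OF b] that by blast
  have bl2: "lin C U (\<lambda>y. \<beta> x y z)" if "x \<in> carrier C" "z \<in> carrier C" for x z
    using bilin_lin1[OF b] that by blast
  have B4: "bilin C C U (\<lambda>c' c3. tsum K U (comult C c') (\<lambda>c1 c2. \<beta> c1 c2 c3))"
    by (assumption | rule V VV U C bl1 bl2 l lins)+
  note cc = comult_closed[OF _ C]
  have "g (tsum K ?T (comult C c) (\<lambda>c1 c'. tsum K ?T (comult C c') (\<lambda>c2 c3. ptensor3 K C C C c1 c2 c3)))
    = tsum K U (comult C c) (\<lambda>c1 c'. g (tsum K ?T (comult C c') (\<lambda>c2 c3. ptensor3 K C C C c1 c2 c3)))"
    by (rule tsum_hom[OF cc[OF c] g B1 V V VT U])
  also have "\<dots> = tsum K U (comult C c) (\<lambda>c1 c'. tsum K U (comult C c') (\<lambda>c2 c3. \<beta> c1 c2 c3))"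
    by (rule tsum_cong[OF cc[OF c] bilin_comp[OF B1 g] _ V V U], subst tsum_hom[OF cc g b1 V V VT U],
      assumption+, rule tsum_cong[OF cc bilin_comp[OF b1 g] _ V V U], assumption+, rule g3)
  finally have 1: "g (tsum K ?T (comult C c) (\<lambda>c1 c'. tsum K ?T (comult C c') (\<lambda>c2 c3. ptensor3 K C C C c1 c2 c3)))
    = \<dots>" .
  have "g (tsum K ?T (comult C c) (\<lambda>c' c3. tsum K ?T (comult C c') (\<lambda>c1 c2. ptensor3 K C C C c1 c2 c3)))
    = tsum K U (comult C c) (\<lambda>c' c3. g (tsum K ?T (comult C c') (\<lambda>c1 c2. ptensor3 K C C C c1 c2 c3)))"
    by (rule tsum_hom[OF cc[OF c] g B2 V V VT U])
  also have "\<dots> = tsum K U (comult C c) (\<lambda>c' c3. tsum K U (comult C c') (\<lambda>c1 c2. \<beta> c1 c2 c3))"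
    by (rule tsum_cong[OF cc[OF c] bilin_comp[OF B2 g] _ V V U], subst tsum_hom[OF cc g b2 V V VT U],
      assumption+, rule tsum_cong[OF cc bilin_comp[OF b2 g] _ V V U], assumption+, rule g3)
  finally show ?thesis using 1 coalgebra.coassoc[OF C c] by simp
qed

subsection \<open>Convolution\<close>

definition alg where
  "alg B \<longleftrightarrow> vs B \<and> ring B \<and>
    (\<forall>a\<in>carrier K. \<forall>g\<in>carrier B. \<forall>h\<in>carrier B.
      (a \<odot>\<^bsub>B\<^esub> g) \<otimes>\<^bsub>B\<^esub> h = a \<odot>\<^bsub>B\<^esub> (g \<otimes>\<^bsub>B\<^esub> h) \<and> g \<otimes>\<^bsub>B\<^esub> (a \<odot>\<^bsub>B\<^esub> h) = a \<odot>\<^bsub>B\<^esub> (g \<otimes>\<^bsub>B\<^esub> h))"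

lemma alg_vs [lins]: "alg B \<Longrightarrow> vs B" and alg_ring: "alg B \<Longrightarrow> ring B"
  by (simp_all add: alg_def)

lemma alg_smult1: "alg B \<Longrightarrow> a \<in> carrier K \<Longrightarrow> g \<in> carrier B \<Longrightarrow> h \<in> carrier B \<Longrightarrow>
    (a \<odot>\<^bsub>B\<^esub> g) \<otimes>\<^bsub>B\<^esub> h = a \<odot>\<^bsub>B\<^esub> (g \<otimes>\<^bsub>B\<^esub> h)"
  and alg_smult2: "alg B \<Longrightarrow> a \<in> carrier K \<Longrightarrow> g \<in> carrier B \<Longrightarrow> h \<in> carrier B \<Longrightarrow>
    g \<otimes>\<^bsub>B\<^esub> (a \<odot>\<^bsub>B\<^esub> h) = a \<odot>\<^bsub>B\<^esub> (g \<otimes>\<^bsub>B\<^esub> h)"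
  by (simp_all add: alg_def)

lemma mult_closed' [lins]:
  "g \<in> carrier B \<Longrightarrow> h \<in> carrier B \<Longrightarrow> alg B \<Longrightarrow> g \<otimes>\<^bsub>B\<^esub> h \<in> carrier B"
  by (meson alg_ring ring.ring_simprules(5))

lemma one_closed' [lins]: "alg B \<Longrightarrow> \<one>\<^bsub>B\<^esub> \<in> carrier B"
  by (meson alg_ring ring.ring_simprules(6))

lemma mult_bilin: assumes B: "alg B" shows "bilin B B B (\<lambda>g h. g \<otimes>\<^bsub>B\<^esub> h)"
proof -
  interpret ring B by (rule alg_ring[OF B])
  show ?thesis
    by (intro bilinI linI) (simp_all add: l_distr r_distr alg_smult1[OF B] alg_smult2[OF B])
qed

lemma lin_mult1 [lins]:
  "lin X B f \<Longrightarrow> h \<in> carrier B \<Longrightarrow> alg B \<Longrightarrow> lin X B (\<lambda>x. f x \<otimes>\<^bsub>B\<^esub> h)"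
  by (rule lin_comp[OF _ bilin_lin1[OF mult_bilin]])

lemma lin_mult2 [lins]:
  "lin X B f \<Longrightarrow> h \<in> carrier B \<Longrightarrow> alg B \<Longrightarrow> lin X B (\<lambda>x. h \<otimes>\<^bsub>B\<^esub> f x)"
  by (rule lin_comp[OF _ bilin_lin2[OF mult_bilin]])

lemma scalars_alg: "alg scalars"
proof -
  have "ring scalars"
    using scalars_vs by (intro ringI) (auto simp: module_def l_distr r_distr m_assoc intro!: monoidI)
  then show ?thesis by (auto simp: alg_def m_assoc m_lcomm scalars_vs)
qed

text \<open>Elements are extensional on the carrier, so that two linear maps agreeing on
  \<open>D\<close> are equal as functions and the calculation can be carried out with monoid
  equations.\<close>

definition conv_monoid where
  "conv_monoid D B = \<lparr>carrier = {\<phi> \<in> extensional (carrier D). lin D B \<phi>},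
    mult = (\<lambda>\<phi> \<psi>. \<lambda>x\<in>carrier D. tsum K B (comult D x) (\<lambda>a b. \<phi> a \<otimes>\<^bsub>B\<^esub> \<psi> b)),
    one = (\<lambda>x\<in>carrier D. counit D x \<odot>\<^bsub>B\<^esub> \<one>\<^bsub>B\<^esub>)\<rparr>"

abbreviation "conv D B \<equiv> mult (conv_monoid D B)"

lemma conv_carrierD: "\<phi> \<in> carrier (conv_monoid D B) \<Longrightarrow> lin D B \<phi>"
  by (simp add: conv_monoid_def)

lemma lin_restrict: "vs D \<Longrightarrow> lin D B f \<Longrightarrow> lin D B (restrict f (carrier D))"
  by (rule lin_cong) auto

lemma conv_carrierI: "vs D \<Longrightarrow> lin D B \<phi> \<Longrightarrow> restrict \<phi> (carrier D) \<in> carrier (conv_monoid D B)"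
  by (simp add: conv_monoid_def lin_restrict)

lemma conv_apply: "x \<in> carrier D \<Longrightarrow>
    conv D B \<phi> \<psi> x = tsum K B (comult D x) (\<lambda>a b. \<phi> a \<otimes>\<^bsub>B\<^esub> \<psi> b)"
  by (simp add: conv_monoid_def)

lemma conv_one_apply: "x \<in> carrier D \<Longrightarrow> \<one>\<^bsub>conv_monoid D B\<^esub> x = counit D x \<odot>\<^bsub>B\<^esub> \<one>\<^bsub>B\<^esub>"
  by (simp add: conv_monoid_def)

lemma conv_eqI:
  assumes "\<phi> \<in> carrier (conv_monoid D B)" "\<psi> \<in> carrier (conv_monoid D B)"
    "\<And>x. x \<in> carrier D \<Longrightarrow> \<phi> x = \<psi> x"
  shows "\<phi> = \<psi>"
  using assms by (auto simp: conv_monoid_def intro: extensionalityI)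

context
  fixes D :: "('k, 'd, 'm) coalgebra_scheme" and B :: "('k, 'b, 'n) module_scheme"
  assumes D: "coalgebra K D" and B: "alg B"
begin

interpretation B: ring B by (rule alg_ring[OF B])

lemma conv_bilin:
  "lin D B \<phi> \<Longrightarrow> lin D B \<psi> \<Longrightarrow> bilin D D B (\<lambda>a b. \<phi> a \<otimes>\<^bsub>B\<^esub> \<psi> b)"
  by (rule bilin_precomp[OF mult_bilin[OF B]])

lemma conv_lin: "lin D B \<phi> \<Longrightarrow> lin D B \<psi> \<Longrightarrow> lin D B (conv D B \<phi> \<psi>)"
  unfolding conv_monoid_def monoid.simps
  by (rule lin_restrict) (assumption | rule D B conv_bilin lins)+

lemma conv_cong:
  assumes "lin D B \<phi>" "lin D B \<psi>" "\<And>x. x \<in> carrier D \<Longrightarrow> \<phi> x = \<phi>' x" "\<And>x. x \<in> carrier D \<Longrightarrow> \<psi> x = \<psi>' x"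
  shows "conv D B \<phi> \<psi> = conv D B \<phi>' \<psi>'"
  unfolding conv_monoid_def monoid.simps
  by (intro restrict_ext tsum_cong[OF _ conv_bilin[OF assms(1,2)]])
    (auto simp: assms comult_closed[OF _ D] coalgebra_vs[OF D] alg_vs[OF B])

text \<open>Associativity combines coassociativity of \<open>D\<close> with associativity of
  \<open>B\<close>; the unit laws are the counit laws, once the scalar is moved inside the linear
  map.\<close>

lemma conv_monoid: "monoid (conv_monoid D B)"
proof (rule monoidI)
  note V = coalgebra_vs[OF D] and W = alg_vs[OF B]
  let ?M = "conv_monoid D B"
  show "\<one>\<^bsub>?M\<^esub> \<in> carrier ?M"
    unfolding conv_monoid_def monoid.simps partial_object.simps
    by (simp, rule lin_restrict[OF V]) (assumption | rule D B lins)+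
next
  fix \<phi> \<psi> assume "\<phi> \<in> carrier (conv_monoid D B)" "\<psi> \<in> carrier (conv_monoid D B)"
  then show "conv D B \<phi> \<psi> \<in> carrier (conv_monoid D B)"
    using conv_lin[of \<phi> \<psi>] by (simp add: conv_monoid_def)
next
  note V = coalgebra_vs[OF D] and W = alg_vs[OF B] and cc = comult_closed[OF _ D]
  fix \<phi> \<psi> \<chi>
  assume "\<phi> \<in> carrier (conv_monoid D B)" "\<psi> \<in> carrier (conv_monoid D B)" "\<chi> \<in> carrier (conv_monoid D B)"
  then have l: "lin D B \<phi>" "lin D B \<psi>" "lin D B \<chi>" by (simp_all add: conv_carrierD)
  note c = lin_closed[OF l(1)] lin_closed[OF l(2)] lin_closed[OF l(3)]
  have "conv D B (conv D B \<phi> \<psi>) \<chi> x = conv D B \<phi> (conv D B \<psi> \<chi>) x" if x: "x \<in> carrier D" for x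
  proof -
    have "conv D B (conv D B \<phi> \<psi>) \<chi> x = tsum K B (comult D x) (\<lambda>c' c3. conv D B \<phi> \<psi> c' \<otimes>\<^bsub>B\<^esub> \<chi> c3)"
      by (rule conv_apply[OF x])
    also have "\<dots> = tsum K B (comult D x) (\<lambda>c' c3. tsum K B (comult D c') (\<lambda>c1 c2. \<phi> c1 \<otimes>\<^bsub>B\<^esub> (\<psi> c2 \<otimes>\<^bsub>B\<^esub> \<chi> c3)))"
    proof (rule tsum_cong[OF cc[OF x] conv_bilin[OF conv_lin[OF l(1,2)] l(3)] _ V V W])
      fix c' c3 assume h: "c' \<in> carrier D" "c3 \<in> carrier D"
      have "conv D B \<phi> \<psi> c' \<otimes>\<^bsub>B\<^esub> \<chi> c3 = tsum K B (comult D c') (\<lambda>c1 c2. (\<phi> c1 \<otimes>\<^bsub>B\<^esub> \<psi> c2) \<otimes>\<^bsub>B\<^esub> \<chi> c3)"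
        unfolding conv_apply[OF h(1)]
        by (rule tsum_hom[OF cc[OF h(1)] _ conv_bilin[OF l(1,2)] V V W W])
          (assumption | rule h c B lins)+
      also have "\<dots> = tsum K B (comult D c') (\<lambda>c1 c2. \<phi> c1 \<otimes>\<^bsub>B\<^esub> (\<psi> c2 \<otimes>\<^bsub>B\<^esub> \<chi> c3))"
        by (rule tsum_cong[OF cc[OF h(1)] _ _ V V W], (assumption | rule h c B lins lin_app[OF l(1)] lin_app[OF l(2)])+)
          (simp add: B.m_assoc c h)
      finally show "conv D B \<phi> \<psi> c' \<otimes>\<^bsub>B\<^esub> \<chi> c3 = \<dots>" .
    qed
    also have "\<dots> = tsum K B (comult D x) (\<lambda>c1 c'. tsum K B (comult D c') (\<lambda>c2 c3. \<phi> c1 \<otimes>\<^bsub>B\<^esub> (\<psi> c2 \<otimes>\<^bsub>B\<^esub> \<chi> c3)))"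
      by (rule coassoc_tsum[OF D W x, symmetric])
       (assumption | rule c B lin_app[OF l(1)] lin_app[OF l(2)] lin_app[OF l(3)] lins)+
    also have "\<dots> = tsum K B (comult D x) (\<lambda>c1 c'. \<phi> c1 \<otimes>\<^bsub>B\<^esub> conv D B \<psi> \<chi> c')"
    proof (rule tsum_cong[OF cc[OF x] conv_bilin[OF l(1) conv_lin[OF l(2,3)]] _ V V W, symmetric])
      fix c1 c' assume h: "c1 \<in> carrier D" "c' \<in> carrier D"
      show "\<phi> c1 \<otimes>\<^bsub>B\<^esub> conv D B \<psi> \<chi> c' = tsum K B (comult D c') (\<lambda>c2 c3. \<phi> c1 \<otimes>\<^bsub>B\<^esub> (\<psi> c2 \<otimes>\<^bsub>B\<^esub> \<chi> c3))"
        unfolding conv_apply[OF h(2)]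
        by (rule tsum_hom[OF cc[OF h(2)] _ conv_bilin[OF l(2,3)] V V W W])
          (assumption | rule h c B lins)+
    qed
    also have "\<dots> = conv D B \<phi> (conv D B \<psi> \<chi>) x"
      by (rule conv_apply[OF x, symmetric])
    finally show ?thesis .
  qed
  then show "conv D B (conv D B \<phi> \<psi>) \<chi> = conv D B \<phi> (conv D B \<psi> \<chi>)"
    by (intro extensionalityI[of _ "carrier D"]) (auto simp: conv_monoid_def)
next
  note V = coalgebra_vs[OF D] and W = alg_vs[OF B] and cc = comult_closed[OF _ D]
  interpret BM: module K B by (rule W)
  fix \<phi> assume p: "\<phi> \<in> carrier (conv_monoid D B)"
  note l = conv_carrierD[OF p]
  note c = lin_closed[OF l]
  have ul: "lin D B \<one>\<^bsub>conv_monoid D B\<^esub>"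
    unfolding conv_monoid_def monoid.simps
    by (rule lin_restrict[OF V]) (assumption | rule D B lins)+
  have "conv D B \<one>\<^bsub>conv_monoid D B\<^esub> \<phi> x = \<phi> x" if x: "x \<in> carrier D" for x
  proof -
    have "conv D B \<one>\<^bsub>conv_monoid D B\<^esub> \<phi> x = tsum K B (comult D x) (\<lambda>a b. \<phi> (counit D a \<odot>\<^bsub>D\<^esub> b))"
      unfolding conv_apply[OF x]
      by (rule tsum_cong[OF cc[OF x] conv_bilin[OF ul l] _ V V W])
       (simp add: conv_one_apply lin_smult[OF l] alg_smult1[OF B] coalgebra.counit_closed[OF D] c)
    also have "\<dots> = \<phi> (tsum K D (comult D x) (\<lambda>a b. counit D a \<odot>\<^bsub>D\<^esub> b))"
      by (rule tsum_hom[OF cc[OF x] l _ V V V W, symmetric])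
        (assumption | rule D V lins)+
    finally show ?thesis by (simp add: coalgebra.counit_left[OF D x])
  qed
  then show "conv D B \<one>\<^bsub>conv_monoid D B\<^esub> \<phi> = \<phi>"
    using p by (intro extensionalityI[of _ "carrier D"]) (auto simp: conv_monoid_def)
  have "conv D B \<phi> \<one>\<^bsub>conv_monoid D B\<^esub> x = \<phi> x" if x: "x \<in> carrier D" for x
  proof -
    have "conv D B \<phi> \<one>\<^bsub>conv_monoid D B\<^esub> x = tsum K B (comult D x) (\<lambda>a b. \<phi> (counit D b \<odot>\<^bsub>D\<^esub> a))"
      unfolding conv_apply[OF x]
      by (rule tsum_cong[OF cc[OF x] conv_bilin[OF l ul] _ V V W])
       (simp add: conv_one_apply lin_smult[OF l] alg_smult2[OF B] coalgebra.counit_closed[OF D] c)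
    also have "\<dots> = \<phi> (tsum K D (comult D x) (\<lambda>a b. counit D b \<odot>\<^bsub>D\<^esub> a))"
      by (rule tsum_hom[OF cc[OF x] l _ V V V W, symmetric])
        (assumption | rule D V lins)+
    finally show ?thesis by (simp add: coalgebra.counit_right[OF D x])
  qed
  then show "conv D B \<phi> \<one>\<^bsub>conv_monoid D B\<^esub> = \<phi>"
    using p by (intro extensionalityI[of _ "carrier D"]) (auto simp: conv_monoid_def)
qed

end

end

section \<open>Algebra homomorphisms and convolution\<close>

context vector_spaces
begin

definition alg_hom where
  "alg_hom B B' g \<longleftrightarrow> lin B B' g \<and> (\<forall>h\<in>carrier B. \<forall>k\<in>carrier B. g (h \<otimes>\<^bsub>B\<^esub> k) = g h \<otimes>\<^bsub>B'\<^esub> g k) \<and> g \<one>\<^bsub>B\<^esub> = \<one>\<^bsub>B'\<^esub>"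

lemma alg_homD:
  "alg_hom B B' g \<Longrightarrow> lin B B' g"
  "alg_hom B B' g \<Longrightarrow> h \<in> carrier B \<Longrightarrow> k \<in> carrier B \<Longrightarrow> g (h \<otimes>\<^bsub>B\<^esub> k) = g h \<otimes>\<^bsub>B'\<^esub> g k"
  "alg_hom B B' g \<Longrightarrow> g \<one>\<^bsub>B\<^esub> = \<one>\<^bsub>B'\<^esub>"
  by (simp_all add: alg_hom_def)

lemma compose_closed:
  assumes D: "coalgebra K D" and g: "lin B B' g" and \<phi>: "lin D B \<phi>"
  shows "compose (carrier D) g \<phi> \<in> carrier (conv_monoid D B')"
  unfolding compose_def by (rule conv_carrierI[OF coalgebra_vs[OF D] lin_comp[OF \<phi> g]])

lemma compose_apply: "x \<in> A \<Longrightarrow> compose A g f x = g (f x)"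
  by (simp add: compose_def)

lemma compose_cong:
  "(\<And>x. x \<in> A \<Longrightarrow> f x = f' x) \<Longrightarrow> (\<And>x. x \<in> A \<Longrightarrow> g (f' x) = g' (f' x)) \<Longrightarrow> compose A g f = compose A g' f'"
  by (auto simp: compose_def)

text \<open>Transports identities between \<open>H\<close>-valued maps to maps with values in
  \<open>H \<otimes> H\<close> or \<open>K\<close>, along the two embeddings, the comultiplication
  and the counit.\<close>

lemma compose_conv:
  assumes D: "coalgebra K D" and B: "alg B" and B': "alg B'" and g: "alg_hom B B' g"
    and l: "lin D B \<phi>" "lin D B \<psi>"
  shows "compose (carrier D) g (conv D B \<phi> \<psi>) = conv D B' (compose (carrier D) g \<phi>) (compose (carrier D) g \<psi>)"
proof (rule conv_eqI[of _ D B'])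
  note gl = alg_homD(1)[OF g] and V = coalgebra_vs[OF D]
  have c: "lin D B' (compose (carrier D) g \<phi>)" "lin D B' (compose (carrier D) g \<psi>)"
    by (intro conv_carrierD compose_closed[OF D gl] l)+
  show "compose (carrier D) g (conv D B \<phi> \<psi>) \<in> carrier (conv_monoid D B')"
    by (intro compose_closed[OF D gl] conv_lin[OF D B] l)
  show "conv D B' (compose (carrier D) g \<phi>) (compose (carrier D) g \<psi>) \<in> carrier (conv_monoid D B')"
    using conv_lin[OF D B' c] by (simp add: conv_monoid_def)
  fix x assume x: "x \<in> carrier D"
  note cx = comult_closed[OF x D] and W = alg_vs[OF B] and W' = alg_vs[OF B']
  note lc = lin_closed[OF l(1)] lin_closed[OF l(2)]
  have "compose (carrier D) g (conv D B \<phi> \<psi>) x = tsum K B' (comult D x) (\<lambda>a b. g (\<phi> a \<otimes>\<^bsub>B\<^esub> \<psi> b))"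
    using x by (simp add: compose_apply conv_apply tsum_hom[OF cx gl conv_bilin[OF D B l] V V W W'])
  also have "\<dots> = tsum K B' (comult D x) (\<lambda>a b. compose (carrier D) g \<phi> a \<otimes>\<^bsub>B'\<^esub> compose (carrier D) g \<psi> b)"
    by (rule tsum_cong[OF cx bilin_comp[OF conv_bilin[OF D B l] gl] _ V V W'])
      (simp add: compose_apply alg_homD(2)[OF g] lc)
  finally show "compose (carrier D) g (conv D B \<phi> \<psi>) x = conv D B' (compose (carrier D) g \<phi>) (compose (carrier D) g \<psi>) x"
    using x by (simp add: conv_apply)
qed

lemma compose_conv_one:
  assumes B: "alg B" and D: "coalgebra K D" and g: "alg_hom B B' g"
  shows "compose (carrier D) g \<one>\<^bsub>conv_monoid D B\<^esub> = \<one>\<^bsub>conv_monoid D B'\<^esub>"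
proof -
  interpret B: module K B by (rule alg_vs[OF B])
  show ?thesis
    unfolding compose_def using B D
    by (auto simp: conv_monoid_def alg_homD(3)[OF g] lin_smult[OF alg_homD(1)[OF g]]
      coalgebra.counit_closed one_closed')
qed

subsection \<open>Tensor products of algebras\<close>

definition tensor_alg where
  "tensor_alg A B = (tensor K A B)\<lparr>mult := \<lambda>s t. tsum K (tensor K A B) s (\<lambda>a b.
      tsum K (tensor K A B) t (\<lambda>c d. ptensor K A B (a \<otimes>\<^bsub>A\<^esub> c) (b \<otimes>\<^bsub>B\<^esub> d))),
    one := ptensor K A B \<one>\<^bsub>A\<^esub> \<one>\<^bsub>B\<^esub>\<rparr>"

lemma tensor_alg_simps [simp]:
  "carrier (tensor_alg A B) = carrier (tensor K A B)"
  "add (tensor_alg A B) = add (tensor K A B)"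
  "zero (tensor_alg A B) = zero (tensor K A B)"
  "smult (tensor_alg A B) = smult (tensor K A B)"
  "one (tensor_alg A B) = ptensor K A B \<one>\<^bsub>A\<^esub> \<one>\<^bsub>B\<^esub>"
  by (simp_all add: tensor_alg_def)

lemma lin_tensor_alg [simp]: "lin V (tensor_alg A B) f = lin V (tensor K A B) f"
  by (simp add: linear_map_def)

lemma lin_tensor_alg' [simp]: "lin (tensor_alg A B) V f = lin (tensor K A B) V f"
  by (simp add: linear_map_def)

lemma tsum_tensor_alg [simp]: "tsum K (tensor_alg A B) = tsum K (tensor K A B)"
  by (intro ext) (simp add: tsum_def finsum_def)

context
  fixes A :: "('k, 'a, 'm) module_scheme" and B :: "('k, 'b, 'n) module_scheme"
  assumes A: "alg A" and B: "alg B"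
begin

interpretation A: ring A by (rule alg_ring[OF A])
interpretation B: ring B by (rule alg_ring[OF B])

abbreviation (input) "T \<equiv> tensor K A B"
abbreviation (input) "tm \<equiv> mult (tensor_alg A B)"


lemma tensor_T_vs: "vs T" by (rule tensor_vs[OF alg_vs[OF A] alg_vs[OF B]])

lemma tensor_mult_inner_bilin:
  "a \<in> carrier A \<Longrightarrow> b \<in> carrier B \<Longrightarrow> bilin A B T (\<lambda>c d. ptensor K A B (a \<otimes>\<^bsub>A\<^esub> c) (b \<otimes>\<^bsub>B\<^esub> d))"
  by (assumption | rule A B lins)+

lemma tensor_mult_outer_bilin:
  "t \<in> carrier T \<Longrightarrow> bilin A B T (\<lambda>a b. tsum K T t (\<lambda>c d. ptensor K A B (a \<otimes>\<^bsub>A\<^esub> c) (b \<otimes>\<^bsub>B\<^esub> d)))"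
  by (assumption | rule A B lins)+

lemma tensor_mult_bilin: "bilin T T T tm"
  unfolding tensor_alg_def by (simp, (assumption | rule A B lins)+)

lemma tensor_mult_ptensor1:
  "\<lbrakk>a \<in> carrier A; b \<in> carrier B; t \<in> carrier T\<rbrakk> \<Longrightarrow> tm (ptensor K A B a b) t =
    tsum K T t (\<lambda>c d. ptensor K A B (a \<otimes>\<^bsub>A\<^esub> c) (b \<otimes>\<^bsub>B\<^esub> d))"
  unfolding tensor_alg_def
  by (simp add: tsum_ptensor[OF alg_vs[OF A] alg_vs[OF B] tensor_T_vs tensor_mult_outer_bilin])

lemma tensor_mult_ptensor:
  "\<lbrakk>a \<in> carrier A; b \<in> carrier B; c \<in> carrier A; d \<in> carrier B\<rbrakk> \<Longrightarrow>
    tm (ptensor K A B a b) (ptensor K A B c d) = ptensor K A B (a \<otimes>\<^bsub>A\<^esub> c) (b \<otimes>\<^bsub>B\<^esub> d)"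
  by (simp add: tensor_mult_ptensor1 ptensor_closed[OF alg_vs[OF A] alg_vs[OF B]]
      tsum_ptensor[OF alg_vs[OF A] alg_vs[OF B] tensor_T_vs tensor_mult_inner_bilin])

lemma tensor_mult_ptensor2:
  assumes "c \<in> carrier A" "d \<in> carrier B" "t \<in> carrier T"
  shows "tm t (ptensor K A B c d) = tsum K T t (\<lambda>a b. ptensor K A B (a \<otimes>\<^bsub>A\<^esub> c) (b \<otimes>\<^bsub>B\<^esub> d))"
proof -
  note V = alg_vs[OF A] alg_vs[OF B]
  have b: "bilin A B T (\<lambda>a b. ptensor K A B (a \<otimes>\<^bsub>A\<^esub> c) (b \<otimes>\<^bsub>B\<^esub> d))"
    using assms(1,2) by - (assumption | rule A B lins)+
  show ?thesis
    by (rule tensor_eqI[OF V tensor_T_vs bilin_lin1[OF tensor_mult_bilin ptensor_closed[OF V]]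
      tsum_lin[OF V tensor_T_vs b] _ assms(3)])
      (simp_all add: assms tensor_mult_ptensor tsum_ptensor[OF V tensor_T_vs b])
qed

text \<open>The product is bilinear, so associativity and the unit laws may be checked on pure
  tensors, one argument at a time.\<close>

lemma tensor_alg: "alg (tensor_alg A B)"
proof -
  note V = alg_vs[OF A] alg_vs[OF B]
  interpret T: module K T by (rule tensor_T_vs)
  note mb = tensor_mult_bilin
  note mc = bilin_closed[OF mb] and pc = ptensor_closed[OF V]
  note l1 = bilin_lin1[OF mb] and l2 = bilin_lin2[OF mb]
  have vs: "vs (tensor_alg A B)"
    using tensor_T_vs by (simp add: module_def module_axioms_def abelian_group_def abelian_group_axioms_def
      abelian_monoid_def comm_group_def)
  have assoc: "tm (tm s t) u = tm s (tm t u)" if s: "s \<in> carrier T" and t: "t \<in> carrier T" and u: "u \<in> carrier T" for s t u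
  proof (rule tensor_eqI[OF V tensor_T_vs lin_comp[OF l1[OF t] l1[OF u]] l1[OF mc[OF t u]] _ s])
    fix a b assume ab: "a \<in> carrier A" "b \<in> carrier B"
    note p1 = pc[OF ab]
    show "tm (tm (ptensor K A B a b) t) u = tm (ptensor K A B a b) (tm t u)"
    proof (rule tensor_eqI[OF V tensor_T_vs lin_comp[OF l2[OF p1] l1[OF u]] lin_comp[OF l1[OF u] l2[OF p1]] _ t])
      fix c d assume cd: "c \<in> carrier A" "d \<in> carrier B"
      note p2 = pc[OF cd]
      show "tm (tm (ptensor K A B a b) (ptensor K A B c d)) u = tm (ptensor K A B a b) (tm (ptensor K A B c d) u)"
        by (rule tensor_eqI[OF V tensor_T_vs l2[OF mc[OF p1 p2]] lin_comp[OF l2[OF p2] l2[OF p1]] _ u])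
          (simp add: tensor_mult_ptensor ab cd A.m_assoc B.m_assoc)
    qed
  qed
  have oneT: "ptensor K A B \<one>\<^bsub>A\<^esub> \<one>\<^bsub>B\<^esub> \<in> carrier T" by (rule pc) auto
  have left: "tm (ptensor K A B \<one>\<^bsub>A\<^esub> \<one>\<^bsub>B\<^esub>) t = t" if "t \<in> carrier T" for t
    by (rule tensor_eqI[OF V tensor_T_vs l2[OF oneT] lin_id _ that]) (simp add: tensor_mult_ptensor)
  have right: "tm t (ptensor K A B \<one>\<^bsub>A\<^esub> \<one>\<^bsub>B\<^esub>) = t" if "t \<in> carrier T" for t
    by (rule tensor_eqI[OF V tensor_T_vs l1[OF oneT] lin_id _ that]) (simp add: tensor_mult_ptensor)
  have "ring (tensor_alg A B)"
  proof (rule ringI)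
    show "abelian_group (tensor_alg A B)" using vs by (simp add: module_def)
    show "monoid (tensor_alg A B)"
      by (rule monoidI) (simp_all add: assoc oneT left right mc)
  qed (simp_all add: lin_add[OF l1] lin_add[OF l2])
  then show ?thesis
    unfolding alg_def by (simp add: vs lin_smult[OF l1] lin_smult[OF l2])
qed

end

end

section \<open>Hopf algebras and partial corepresentations\<close>

locale hopf = vector_spaces K for K :: "('k, 'r) ring_scheme" (structure) +
  fixes H :: "('k, 'h, 'm) hopf_algebra_scheme"
  assumes hopf: "hopf_algebra K H"
begin

abbreviation "S \<equiv> antipode H"

lemma H_coalgebra: "coalgebra K H"
  using hopf by (simp add: hopf_algebra_def)

lemma H_vs: "vs H" by (rule coalgebra_vs[OF H_coalgebra])

lemma H_alg: "alg H"
  using hopf H_vs by (auto simp: alg_def hopf_algebra_def hopf_algebra_axioms_def)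

lemma S_lin: "lin H H S"
  by (rule hopf_algebra.antipode_linear[OF hopf])

sublocale H: ring H by (rule alg_ring[OF H_alg])
sublocale Hm: module K H by (rule H_vs)

definition "HH = tensor_alg H H"

lemma HH_alg: "alg HH" unfolding HH_def by (rule tensor_alg[OF H_alg H_alg])

sublocale HH: ring HH by (rule alg_ring[OF HH_alg])

lemma HH_simps [simp]:
  "carrier HH = carrier (tensor K H H)" "\<one>\<^bsub>HH\<^esub> = ptensor K H H \<one>\<^bsub>H\<^esub> \<one>\<^bsub>H\<^esub>"
  "tsum K HH = tsum K (tensor K H H)"
  by (simp_all add: HH_def)

lemma HH_lin [simp]: "lin V HH f = lin V (tensor K H H) f"
  by (simp add: HH_def)

lemma HH_lin' [simp]: "lin HH V f = lin (tensor K H H) V f"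
  by (simp add: HH_def)

lemma HT_vs: "vs (tensor K H H)" by (rule tensor_vs[OF H_vs H_vs])

text \<open>The two embeddings of \<open>H\<close> into the algebra \<open>H \<otimes> H\<close>.
  Since \<open>h \<otimes> k\<close> is \<open>i1 h\<close> times \<open>i2 k\<close>, a Sweedler
  identity with two legs becomes an equation between products in one convolution monoid.\<close>

definition "i1 h = ptensor K H H h \<one>\<^bsub>H\<^esub>"
definition "i2 h = ptensor K H H \<one>\<^bsub>H\<^esub> h"

lemma i1_hom: "alg_hom H HH i1"
proof -
  have "lin H (tensor K H H) i1"
    unfolding i1_def by (assumption | rule H_vs H_alg lins H.one_closed)+
  then show ?thesis
    by (simp add: alg_hom_def i1_def HH_def tensor_mult_ptensor[OF H_alg H_alg])
qed

lemma i2_hom: "alg_hom H HH i2"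
proof -
  have "lin H (tensor K H H) i2"
    unfolding i2_def by (assumption | rule H_vs H_alg lins H.one_closed)+
  then show ?thesis
    by (simp add: alg_hom_def i2_def HH_def tensor_mult_ptensor[OF H_alg H_alg])
qed

lemma comult_hom: "alg_hom H HH (comult H)"
  unfolding alg_hom_def HH_simps HH_lin
  using coalgebra.comult_linear[OF H_coalgebra] hopf_algebra.comult_mult[OF hopf] hopf_algebra.comult_one[OF hopf]
  by (simp add: HH_def tensor_alg_def)

lemma counit_hom: "alg_hom H scalars (counit H)"
  unfolding alg_hom_def
  using counit_lin[OF H_coalgebra] hopf_algebra.counit_mult[OF hopf] hopf_algebra.counit_one[OF hopf] by simp

lemma id_hom: "alg_hom H H (\<lambda>x. x)"
  by (simp add: alg_hom_def lin_id)

lemmas i1_lin = alg_homD(1)[OF i1_hom, unfolded HH_lin]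
lemmas i2_lin = alg_homD(1)[OF i2_hom, unfolded HH_lin]
lemmas comult_lin = alg_homD(1)[OF comult_hom, unfolded HH_lin]

lemma i1_i2: "h \<in> carrier H \<Longrightarrow> k \<in> carrier H \<Longrightarrow> i1 h \<otimes>\<^bsub>HH\<^esub> i2 k = ptensor K H H h k"
  by (simp add: i1_def i2_def HH_def tensor_mult_ptensor[OF H_alg H_alg])

lemma mult_i1: "t \<in> carrier HH \<Longrightarrow> k \<in> carrier H \<Longrightarrow>
    t \<otimes>\<^bsub>HH\<^esub> i1 k = tsum K (tensor K H H) t (\<lambda>a b. ptensor K H H (a \<otimes>\<^bsub>H\<^esub> k) b)"
proof -
  assume t: "t \<in> carrier HH" and k: "k \<in> carrier H"
  have "bilin H H (tensor K H H) (\<lambda>a b. ptensor K H H (a \<otimes>\<^bsub>H\<^esub> k) b)"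
    using k by - (assumption | rule H_vs H_alg lins)+
  then show ?thesis using t k unfolding i1_def HH_def
    by (subst tensor_mult_ptensor2[OF H_alg H_alg]) (simp_all, rule tsum_cong[OF _ _ _ H_vs H_vs HT_vs, symmetric], simp_all)
qed

lemma mult_i2: "t \<in> carrier HH \<Longrightarrow> k \<in> carrier H \<Longrightarrow>
    t \<otimes>\<^bsub>HH\<^esub> i2 k = tsum K (tensor K H H) t (\<lambda>a b. ptensor K H H a (b \<otimes>\<^bsub>H\<^esub> k))"
proof -
  assume t: "t \<in> carrier HH" and k: "k \<in> carrier H"
  have "bilin H H (tensor K H H) (\<lambda>a b. ptensor K H H a (b \<otimes>\<^bsub>H\<^esub> k))"
    using k by - (assumption | rule H_vs H_alg lins)+
  then show ?thesis using t k unfolding i2_def HH_def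
    by (subst tensor_mult_ptensor2[OF H_alg H_alg]) (simp_all, rule tsum_cong[OF _ _ _ H_vs H_vs HT_vs, symmetric], simp_all)
qed

lemma i1_mult: "t \<in> carrier HH \<Longrightarrow> k \<in> carrier H \<Longrightarrow>
    i1 k \<otimes>\<^bsub>HH\<^esub> t = tsum K (tensor K H H) t (\<lambda>a b. ptensor K H H (k \<otimes>\<^bsub>H\<^esub> a) b)"
proof -
  assume t: "t \<in> carrier HH" and k: "k \<in> carrier H"
  have "bilin H H (tensor K H H) (\<lambda>a b. ptensor K H H (k \<otimes>\<^bsub>H\<^esub> a) b)"
    using k by - (assumption | rule H_vs H_alg lins)+
  then show ?thesis using t k unfolding i1_def HH_def
    by (subst tensor_mult_ptensor1[OF H_alg H_alg]) (simp_all, rule tsum_cong[OF _ _ _ H_vs H_vs HT_vs, symmetric], simp_all)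
qed

subsection \<open>The antipode\<close>

abbreviation "homHH \<equiv> conv_monoid H HH"

interpretation HHm: monoid homHH by (rule conv_monoid[OF H_coalgebra HH_alg])

lemma antipode_conv:
  "conv H H S (\<lambda>x. x) = \<one>\<^bsub>conv_monoid H H\<^esub>" "conv H H (\<lambda>x. x) S = \<one>\<^bsub>conv_monoid H H\<^esub>"
  by (simp_all add: conv_monoid_def hopf_algebra.antipode_left[OF hopf] hopf_algebra.antipode_right[OF hopf]
      cong: restrict_cong)

text \<open>The antipode axioms say that \<open>S\<close> is the convolution inverse of the
  identity; pushing this forward along \<open>g\<close> makes \<open>g \<circ> S\<close> the inverse
  of \<open>g\<close>.\<close>

lemma antipode_conv_hom:
  assumes B: "alg B" and g: "alg_hom H B g"
  shows "conv H B (compose (carrier H) g S) (restrict g (carrier H)) = \<one>\<^bsub>conv_monoid H B\<^esub>"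
    "conv H B (restrict g (carrier H)) (compose (carrier H) g S) = \<one>\<^bsub>conv_monoid H B\<^esub>"
proof -
  have r: "restrict g (carrier H) = compose (carrier H) g (\<lambda>x. x)" by (simp add: compose_def)
  show "conv H B (compose (carrier H) g S) (restrict g (carrier H)) = \<one>\<^bsub>conv_monoid H B\<^esub>"
    unfolding r compose_conv[OF H_coalgebra H_alg B g S_lin lin_id, symmetric] antipode_conv
    by (rule compose_conv_one[OF H_alg H_coalgebra g])
  show "conv H B (restrict g (carrier H)) (compose (carrier H) g S) = \<one>\<^bsub>conv_monoid H B\<^esub>"
    unfolding r compose_conv[OF H_coalgebra H_alg B g lin_id S_lin, symmetric] antipode_conv
    by (rule compose_conv_one[OF H_alg H_coalgebra g])
qed

text \<open>\<open>h1 \<otimes> h2\<close> is the product of \<open>h1 \<otimes> 1\<close> and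
  \<open>1 \<otimes> h2\<close>. With this factorisation of \<open>\<Delta>\<close>, facts about the
  antipode become cancellations in a monoid.\<close>

lemma comult_conv: "restrict (comult H) (carrier H) = conv H HH (restrict i1 (carrier H)) (restrict i2 (carrier H))"
proof (rule conv_eqI[of _ H HH])
  show "restrict (comult H) (carrier H) \<in> carrier homHH"
    by (rule conv_carrierI[OF H_vs]) (simp add: comult_lin)
  have "restrict i1 (carrier H) \<in> carrier homHH" "restrict i2 (carrier H) \<in> carrier homHH"
    by (rule conv_carrierI[OF H_vs]; simp add: i1_lin i2_lin)+
  then show "conv H HH (restrict i1 (carrier H)) (restrict i2 (carrier H)) \<in> carrier homHH" by simp
  fix x assume x: "x \<in> carrier H"
  have "conv H HH (restrict i1 (carrier H)) (restrict i2 (carrier H)) x =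
    tsum K (tensor K H H) (comult H x) (\<lambda>a b. restrict i1 (carrier H) a \<otimes>\<^bsub>HH\<^esub> restrict i2 (carrier H) b)"
    using x by (simp add: conv_apply)
  also have "\<dots> = tsum K (tensor K H H) (comult H x) (ptensor K H H)"
    by (rule sym, rule tsum_cong[OF comult_closed[OF x H_coalgebra] ptensor_bilin[OF H_vs H_vs] _ H_vs H_vs HT_vs])
      (simp add: i1_i2)
  also have "\<dots> = comult H x" by (rule tsum_id[OF comult_closed[OF x H_coalgebra] H_vs H_vs])
  finally show "restrict (comult H) (carrier H) x = conv H HH (restrict i1 (carrier H)) (restrict i2 (carrier H)) x"
    using x by simp
qed

lemma HHc:
  assumes "lin H (tensor K H H) g"
  shows "restrict g (carrier H) \<in> carrier homHH" "compose (carrier H) g S \<in> carrier homHH"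
  using assms by (auto intro!: conv_carrierI[OF H_vs] compose_closed[OF H_coalgebra _ S_lin])

text \<open>\<open>\<Delta> \<circ> S\<close> is the inverse of \<open>\<Delta> = i1 * i2\<close>;
  multiplying by \<open>i1\<close> and cancelling \<open>i2\<close> against its inverse leaves
  \<open>i2 \<circ> S\<close>.\<close>

lemma comult_antipode_mult:
  "conv H HH (compose (carrier H) (comult H) S) (restrict i1 (carrier H)) = compose (carrier H) i2 S"
proof -
  note c = HHc[OF i1_lin] HHc[OF i2_lin] HHc[OF comult_lin]
  let ?DS = "compose (carrier H) (comult H) S" and ?i1 = "restrict i1 (carrier H)"
    and ?i2 = "restrict i2 (carrier H)" and ?i2S = "compose (carrier H) i2 S"
  have "conv H HH (conv H HH ?DS ?i1) ?i2 = \<one>\<^bsub>homHH\<^esub>"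
    using antipode_conv_hom(1)[OF HH_alg comult_hom] c by (simp add: comult_conv HHm.m_assoc)
  then have "conv H HH (conv H HH (conv H HH ?DS ?i1) ?i2) ?i2S = ?i2S" using c by simp
  moreover have "conv H HH (conv H HH (conv H HH ?DS ?i1) ?i2) ?i2S = conv H HH ?DS ?i1"
    using c antipode_conv_hom(2)[OF HH_alg i2_hom] by (simp add: HHm.m_assoc)
  ultimately show ?thesis by simp
qed

text \<open>The antipode reverses the comultiplication: the right side sends \<open>h\<close> to
  \<open>S(h2) \<otimes> S(h1)\<close>. It follows from the previous identity by cancelling
  \<open>i1\<close> against \<open>i1 \<circ> S\<close>.\<close>

lemma comult_antipode:
  "compose (carrier H) (comult H) S = conv H HH (compose (carrier H) i2 S) (compose (carrier H) i1 S)"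
proof -
  note c = HHc[OF i1_lin] HHc[OF i2_lin] HHc[OF comult_lin]
  have "conv H HH (compose (carrier H) i2 S) (compose (carrier H) i1 S) =
    conv H HH (conv H HH (compose (carrier H) (comult H) S) (restrict i1 (carrier H))) (compose (carrier H) i1 S)"
    by (simp add: comult_antipode_mult)
  also have "\<dots> = compose (carrier H) (comult H) S"
    using c antipode_conv_hom(2)[OF HH_alg i1_hom] by (simp add: HHm.m_assoc)
  finally show ?thesis by simp
qed

text \<open>The counit is the unit of the \<open>K\<close>-valued convolution monoid, and
  \<open>counit \<circ> S\<close> is its inverse, hence also the unit.\<close>

lemma counit_antipode:
  assumes h: "h \<in> carrier H" shows "counit H (S h) = counit H h"
proof -
  interpret M: monoid "conv_monoid H scalars" by (rule conv_monoid[OF H_coalgebra scalars_alg])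
  have one: "restrict (counit H) (carrier H) = \<one>\<^bsub>conv_monoid H scalars\<^esub>"
    by (auto simp: conv_monoid_def coalgebra.counit_closed[OF H_coalgebra])
  have "compose (carrier H) (counit H) S \<in> carrier (conv_monoid H scalars)"
    by (rule compose_closed[OF H_coalgebra counit_lin[OF H_coalgebra] S_lin])
  then have "compose (carrier H) (counit H) S = restrict (counit H) (carrier H)"
    using antipode_conv_hom(1)[OF scalars_alg counit_hom] by (simp add: one)
  then show ?thesis using h by (metis compose_apply restrict_apply')
qed

end

section \<open>Triple convolutions and maps compatible with one factor\<close>

context vector_spaces
begin

context
  fixes D :: "('k, 'd, 'm) coalgebra_scheme" and B :: "('k, 'b, 'n) module_scheme"
  assumes D: "coalgebra K D" and B: "alg B"
begin

text \<open>Bridges the right-nested Sweedler sums, in which the corepresentation axioms and the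
  coaction are written, and threefold products in the convolution monoid.\<close>

lemma conv3_apply:
  assumes l: "lin D B \<phi>" "lin D B \<psi>" "lin D B \<chi>" and x: "x \<in> carrier D"
  shows "conv D B \<phi> (conv D B \<psi> \<chi>) x =
    tsum K B (comult D x) (\<lambda>c1 c'. tsum K B (comult D c') (\<lambda>c2 c3. \<phi> c1 \<otimes>\<^bsub>B\<^esub> (\<psi> c2 \<otimes>\<^bsub>B\<^esub> \<chi> c3)))"
  unfolding conv_apply[OF x]
proof (rule tsum_cong[OF comult_closed[OF x D] conv_bilin[OF D B l(1) conv_lin[OF D B l(2,3)]]])
  note V = coalgebra_vs[OF D] and W = alg_vs[OF B]
  show "vs D" "vs D" "vs B" by (rule V W)+
  fix c1 c' assume h: "c1 \<in> carrier D" "c' \<in> carrier D"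
  show "\<phi> c1 \<otimes>\<^bsub>B\<^esub> conv D B \<psi> \<chi> c' = tsum K B (comult D c') (\<lambda>c2 c3. \<phi> c1 \<otimes>\<^bsub>B\<^esub> (\<psi> c2 \<otimes>\<^bsub>B\<^esub> \<chi> c3))"
    unfolding conv_apply[OF h(2)]
    by (rule tsum_hom[OF comult_closed[OF h(2) D] _ conv_bilin[OF D B l(2,3)] V V W W])
      (assumption | rule h lin_closed[OF l(1)] B lins)+
qed

lemma conv3_inner_bilin:
  assumes l: "lin D B \<phi>" "lin D B \<psi>" "lin D B \<chi>" and x: "x \<in> carrier D"
  shows "bilin D D B (\<lambda>c2 c3. \<phi> x \<otimes>\<^bsub>B\<^esub> (\<psi> c2 \<otimes>\<^bsub>B\<^esub> \<chi> c3))"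
  by (rule bilin_comp[OF conv_bilin[OF D B l(2,3)] bilin_lin2[OF mult_bilin[OF B] lin_closed[OF l(1) x]]])

lemma conv3_bilin:
  assumes l: "lin D B \<phi>" "lin D B \<psi>" "lin D B \<chi>"
  shows "bilin D D B (\<lambda>c1 c'. tsum K B (comult D c') (\<lambda>c2 c3. \<phi> c1 \<otimes>\<^bsub>B\<^esub> (\<psi> c2 \<otimes>\<^bsub>B\<^esub> \<chi> c3)))"
proof -
  note c = lin_closed[OF l(1)] lin_closed[OF l(2)] lin_closed[OF l(3)]
  show ?thesis
    by (assumption | rule D B c lin_app[OF l(1)] conv3_inner_bilin[OF l] lins)+
qed

end

context
  fixes D :: "('k, 'd, 'm) coalgebra_scheme" and B :: "('k, 'b, 'n) module_scheme"
    and B' :: "('k, 'e, 'o) module_scheme"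
  assumes D: "coalgebra K D" and B: "alg B" and B': "alg B'"
begin

text \<open>Replaces multiplicativity of \<open>g\<close> by compatibility with left multiplication
  by the values of one factor. Slices in the second tensor leg respect multiplication by
  \<open>i1 y\<close> in this way without being algebra maps.\<close>

lemma compose_conv_left:
  assumes g: "lin B B' g" and l: "lin D B \<phi>" "lin D B' \<phi>'" "lin D B \<psi>"
    and eq: "\<And>x t. x \<in> carrier D \<Longrightarrow> t \<in> carrier B \<Longrightarrow> g (\<phi> x \<otimes>\<^bsub>B\<^esub> t) = \<phi>' x \<otimes>\<^bsub>B'\<^esub> g t"
  shows "compose (carrier D) g (conv D B \<phi> \<psi>) = conv D B' \<phi>' (compose (carrier D) g \<psi>)"
proof (rule extensionalityI[of _ "carrier D"])
  note V = coalgebra_vs[OF D] and W = alg_vs[OF B] and W' = alg_vs[OF B']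
  fix x assume x: "x \<in> carrier D"
  have "compose (carrier D) g (conv D B \<phi> \<psi>) x = tsum K B' (comult D x) (\<lambda>a b. g (\<phi> a \<otimes>\<^bsub>B\<^esub> \<psi> b))"
    using x by (simp add: compose_apply conv_apply
      tsum_hom[OF comult_closed[OF x D] g conv_bilin[OF D B l(1,3)] V V W W'])
  also have "\<dots> = conv D B' \<phi>' (compose (carrier D) g \<psi>) x"
    unfolding conv_apply[OF x]
    by (rule tsum_cong[OF comult_closed[OF x D] bilin_comp[OF conv_bilin[OF D B l(1,3)] g] _ V V W'])
      (simp add: eq lin_closed[OF l(3)] compose_apply)
  finally show "compose (carrier D) g (conv D B \<phi> \<psi>) x = conv D B' \<phi>' (compose (carrier D) g \<psi>) x" .
qed (auto simp: compose_def conv_monoid_def)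

lemma compose_conv_right:
  assumes g: "lin B B' g" and l: "lin D B \<phi>" "lin D B' \<phi>'" "lin D B \<psi>"
    and eq: "\<And>x t. x \<in> carrier D \<Longrightarrow> t \<in> carrier B \<Longrightarrow> g (t \<otimes>\<^bsub>B\<^esub> \<phi> x) = g t \<otimes>\<^bsub>B'\<^esub> \<phi>' x"
  shows "compose (carrier D) g (conv D B \<psi> \<phi>) = conv D B' (compose (carrier D) g \<psi>) \<phi>'"
proof (rule extensionalityI[of _ "carrier D"])
  note V = coalgebra_vs[OF D] and W = alg_vs[OF B] and W' = alg_vs[OF B']
  fix x assume x: "x \<in> carrier D"
  have "compose (carrier D) g (conv D B \<psi> \<phi>) x = tsum K B' (comult D x) (\<lambda>a b. g (\<psi> a \<otimes>\<^bsub>B\<^esub> \<phi> b))"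
    using x by (simp add: compose_apply conv_apply
      tsum_hom[OF comult_closed[OF x D] g conv_bilin[OF D B l(3,1)] V V W W'])
  also have "\<dots> = conv D B' (compose (carrier D) g \<psi>) \<phi>' x"
    unfolding conv_apply[OF x]
    by (rule tsum_cong[OF comult_closed[OF x D] bilin_comp[OF conv_bilin[OF D B l(3,1)] g] _ V V W'])
      (simp add: eq lin_closed[OF l(3)] compose_apply)
  finally show "compose (carrier D) g (conv D B \<psi> \<phi>) x = conv D B' (compose (carrier D) g \<psi>) \<phi>' x" .
qed (auto simp: compose_def conv_monoid_def)

end

lemma scalar_unit_hom: assumes B: "alg B" shows "alg_hom scalars B (\<lambda>k. k \<odot>\<^bsub>B\<^esub> \<one>\<^bsub>B\<^esub>)"
proof -
  interpret B: ring B by (rule alg_ring[OF B])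
  interpret Bm: module K B by (rule alg_vs[OF B])
  have "lin scalars B (\<lambda>k. k \<odot>\<^bsub>B\<^esub> \<one>\<^bsub>B\<^esub>)" by (assumption | rule B lins)+
  then show ?thesis by (simp add: alg_hom_def alg_smult1[OF B] Bm.smult_assoc1)
qed

end

context hopf
begin

subsection \<open>Slices by functionals\<close>

text \<open>\<open>slice f\<close> is \<open>id \<otimes> f\<close>, and \<open>rslice f\<close> is
  the action of a functional on \<open>H\<close> by \<open>h \<mapsto> f(h2) h1\<close>;
  \<open>slice2 f\<close> applies this action to the second leg.\<close>

definition "slice f t = tsum K H t (\<lambda>a b. f b \<odot>\<^bsub>H\<^esub> a)"
definition "rslice f h = slice f (comult H h)"
definition "slice2 f t = tsum K (tensor K H H) t (\<lambda>a b. ptensor K H H a (rslice f b))"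

context
  fixes f assumes f: "lin H scalars f"
begin

lemma f_closed: "h \<in> carrier H \<Longrightarrow> f h \<in> carrier K" using lin_closed[OF f] by simp

lemma slice_bilin: "bilin H H H (\<lambda>a b. f b \<odot>\<^bsub>H\<^esub> a)"
  by (assumption | rule H_vs f f_closed lin_app[OF f] lins)+

lemma slice_lin: "lin (tensor K H H) H (slice f)"
  unfolding slice_def by (rule tsum_lin[OF H_vs H_vs H_vs slice_bilin])

lemma slice_ptensor: "a \<in> carrier H \<Longrightarrow> b \<in> carrier H \<Longrightarrow> slice f (ptensor K H H a b) = f b \<odot>\<^bsub>H\<^esub> a"
  unfolding slice_def by (rule tsum_ptensor[OF H_vs H_vs H_vs slice_bilin])

lemma rslice_lin: "lin H H (rslice f)"
  unfolding rslice_def by (rule lin_comp[OF comult_lin slice_lin])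

lemma slice2_bilin: "bilin H H (tensor K H H) (\<lambda>a b. ptensor K H H a (rslice f b))"
  by (rule bilin_precomp[OF ptensor_bilin[OF H_vs H_vs] lin_id rslice_lin])

lemma slice2_lin: "lin (tensor K H H) (tensor K H H) (slice2 f)"
  unfolding slice2_def by (rule tsum_lin[OF H_vs H_vs HT_vs slice2_bilin])

lemma slice2_ptensor: "a \<in> carrier H \<Longrightarrow> b \<in> carrier H \<Longrightarrow>
    slice2 f (ptensor K H H a b) = ptensor K H H a (rslice f b)"
  unfolding slice2_def by (rule tsum_ptensor[OF H_vs H_vs HT_vs slice2_bilin])

lemma i_ptensor:
  assumes "y \<in> carrier H" "a \<in> carrier H" "b \<in> carrier H"
  shows "i1 y \<otimes>\<^bsub>HH\<^esub> ptensor K H H a b = ptensor K H H (y \<otimes>\<^bsub>H\<^esub> a) b"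
    "ptensor K H H a b \<otimes>\<^bsub>HH\<^esub> i1 y = ptensor K H H (a \<otimes>\<^bsub>H\<^esub> y) b"
  using assms by (simp_all add: i1_def HH_def tensor_mult_ptensor[OF H_alg H_alg])

lemma HH_mult_lin:
  "s \<in> carrier (tensor K H H) \<Longrightarrow> lin (tensor K H H) (tensor K H H) (\<lambda>t. s \<otimes>\<^bsub>HH\<^esub> t)"
  "s \<in> carrier (tensor K H H) \<Longrightarrow> lin (tensor K H H) (tensor K H H) (\<lambda>t. t \<otimes>\<^bsub>HH\<^esub> s)"
  using bilin_lin1[OF mult_bilin[OF HH_alg]] bilin_lin2[OF mult_bilin[OF HH_alg]] by simp_all

lemma slice_i1:
  assumes y: "y \<in> carrier H" and t: "t \<in> carrier (tensor K H H)"
  shows "slice f (i1 y \<otimes>\<^bsub>HH\<^esub> t) = y \<otimes>\<^bsub>H\<^esub> slice f t" "slice f (t \<otimes>\<^bsub>HH\<^esub> i1 y) = slice f t \<otimes>\<^bsub>H\<^esub> y"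
proof -
  note i = lin_closed[OF i1_lin y]
  show "slice f (i1 y \<otimes>\<^bsub>HH\<^esub> t) = y \<otimes>\<^bsub>H\<^esub> slice f t"
    by (rule tensor_eqI[OF H_vs H_vs H_vs lin_comp[OF HH_mult_lin(1)[OF i] slice_lin]
      lin_comp[OF slice_lin bilin_lin2[OF mult_bilin[OF H_alg] y]] _ t])
     (simp add: i_ptensor slice_ptensor y alg_smult2[OF H_alg] f_closed)
  show "slice f (t \<otimes>\<^bsub>HH\<^esub> i1 y) = slice f t \<otimes>\<^bsub>H\<^esub> y"
    by (rule tensor_eqI[OF H_vs H_vs H_vs lin_comp[OF HH_mult_lin(2)[OF i] slice_lin]
      lin_comp[OF slice_lin bilin_lin1[OF mult_bilin[OF H_alg] y]] _ t])
     (simp add: i_ptensor slice_ptensor y alg_smult1[OF H_alg] f_closed)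
qed

lemma slice2_i1:
  assumes y: "y \<in> carrier H" and t: "t \<in> carrier (tensor K H H)"
  shows "slice2 f (i1 y \<otimes>\<^bsub>HH\<^esub> t) = i1 y \<otimes>\<^bsub>HH\<^esub> slice2 f t" "slice2 f (t \<otimes>\<^bsub>HH\<^esub> i1 y) = slice2 f t \<otimes>\<^bsub>HH\<^esub> i1 y"
proof -
  note i = lin_closed[OF i1_lin y]
  show "slice2 f (i1 y \<otimes>\<^bsub>HH\<^esub> t) = i1 y \<otimes>\<^bsub>HH\<^esub> slice2 f t"
    by (rule tensor_eqI[OF H_vs H_vs HT_vs lin_comp[OF HH_mult_lin(1)[OF i] slice2_lin]
      lin_comp[OF slice2_lin HH_mult_lin(1)[OF i]] _ t])
     (simp add: i_ptensor slice2_ptensor y lin_closed[OF rslice_lin])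
  show "slice2 f (t \<otimes>\<^bsub>HH\<^esub> i1 y) = slice2 f t \<otimes>\<^bsub>HH\<^esub> i1 y"
    by (rule tensor_eqI[OF H_vs H_vs HT_vs lin_comp[OF HH_mult_lin(2)[OF i] slice2_lin]
      lin_comp[OF slice2_lin HH_mult_lin(2)[OF i]] _ t])
     (simp add: i_ptensor slice2_ptensor y lin_closed[OF rslice_lin])
qed

lemma slice_i2: "z \<in> carrier H \<Longrightarrow> slice f (i2 z) = f z \<odot>\<^bsub>H\<^esub> \<one>\<^bsub>H\<^esub>"
  by (simp add: i2_def slice_ptensor)

lemma slice2_i2: "z \<in> carrier H \<Longrightarrow> slice2 f (i2 z) = i2 (rslice f z)"
  by (simp add: i2_def slice2_ptensor)

text \<open>Coassociativity: both sides are \<open>h1 \<otimes> h2\<close> weighted by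
  \<open>f(h3)\<close>. In other words, the action of functionals on the right leg commutes with
  splitting off a left leg.\<close>

lemma slice2_comult:
  assumes h: "h \<in> carrier H" shows "slice2 f (comult H h) = comult H (rslice f h)"
proof -
  note cc = comult_closed[OF _ H_coalgebra] and V = H_vs H_vs HT_vs
  have "slice2 f (comult H h) = tsum K (tensor K H H) (comult H h) (\<lambda>a b. ptensor K H H a (rslice f b))"
    by (simp add: slice2_def)
  also have "\<dots> = tsum K (tensor K H H) (comult H h) (\<lambda>a b'. tsum K (tensor K H H) (comult H b')
      (\<lambda>b c. f c \<odot>\<^bsub>tensor K H H\<^esub> ptensor K H H a b))"
  proof (rule tsum_cong[OF cc[OF h] slice2_bilin _ V])
    fix a b' assume ab: "a \<in> carrier H" "b' \<in> carrier H"
    have "ptensor K H H a (rslice f b') = tsum K (tensor K H H) (comult H b') (\<lambda>b c. ptensor K H H a (f c \<odot>\<^bsub>H\<^esub> b))"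
      unfolding rslice_def slice_def
      by (rule tsum_hom[OF cc[OF ab(2)] bilin_lin2[OF ptensor_bilin[OF H_vs H_vs] ab(1)] slice_bilin H_vs H_vs H_vs HT_vs])
    also have "\<dots> = tsum K (tensor K H H) (comult H b') (\<lambda>b c. f c \<odot>\<^bsub>tensor K H H\<^esub> ptensor K H H a b)"
      by (rule tsum_cong[OF cc[OF ab(2)] bilin_comp[OF slice_bilin bilin_lin2[OF ptensor_bilin[OF H_vs H_vs] ab(1)]] _ V])
        (simp add: ab f_closed lin_smult[OF bilin_lin2[OF ptensor_bilin[OF H_vs H_vs]]])
    finally show "ptensor K H H a (rslice f b') = \<dots>" .
  qed
  also have "\<dots> = tsum K (tensor K H H) (comult H h) (\<lambda>b' c. tsum K (tensor K H H) (comult H b')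
      (\<lambda>a b. f c \<odot>\<^bsub>tensor K H H\<^esub> ptensor K H H a b))"
    by (rule coassoc_tsum[OF H_coalgebra HT_vs h])
      (assumption | rule H_vs f f_closed lin_app[OF f] lins)+
  also have "\<dots> = tsum K (tensor K H H) (comult H h) (\<lambda>b' c. comult H (f c \<odot>\<^bsub>H\<^esub> b'))"
  proof (rule tsum_cong[OF cc[OF h] bilin_comp[OF slice_bilin comult_lin] _ V, symmetric])
    fix b' c assume bc: "b' \<in> carrier H" "c \<in> carrier H"
    have sl: "lin (tensor K H H) (tensor K H H) (\<lambda>t. f c \<odot>\<^bsub>tensor K H H\<^esub> t)"
      using f_closed[OF bc(2)] by (intro lin_smult_fun lin_id HT_vs)
    show "comult H (f c \<odot>\<^bsub>H\<^esub> b') = tsum K (tensor K H H) (comult H b')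
      (\<lambda>a b. f c \<odot>\<^bsub>tensor K H H\<^esub> ptensor K H H a b)"
      by (simp add: tsum_hom[OF cc[OF bc(1)] sl ptensor_bilin[OF H_vs H_vs] H_vs H_vs HT_vs HT_vs, symmetric]
        tsum_id[OF cc[OF bc(1)] H_vs H_vs] lin_smult[OF comult_lin f_closed[OF bc(2)] bc(1)])
  qed
  also have "\<dots> = comult H (rslice f h)"
    unfolding rslice_def slice_def
    by (rule tsum_hom[OF cc[OF h] comult_lin slice_bilin H_vs H_vs H_vs HT_vs, symmetric])
  finally show ?thesis .
qed

end

end

section \<open>Convolution identities of a partial corepresentation\<close>

locale corep = hopf K H for K :: "('k, 'r) ring_scheme" (structure) and H :: "('k, 'h, 'm) hopf_algebra_scheme" +
  fixes D :: "('k, 'd) coalgebra" and w :: "'d \<Rightarrow> 'h"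
  assumes D: "coalgebra K D" and partial_corep: "partial_corep K H D w"
begin

abbreviation "up \<equiv> compose (carrier D)"
abbreviation star (infixl "\<star>" 70) where "\<phi> \<star> \<psi> \<equiv> conv D H \<phi> \<psi>"
abbreviation dia (infixl "\<diamondop>" 70) where "\<phi> \<diamondop> \<psi> \<equiv> conv D HH \<phi> \<psi>"

sublocale M: monoid "conv_monoid D H" by (rule conv_monoid[OF D H_alg])
sublocale MM: monoid "conv_monoid D HH" by (rule conv_monoid[OF D HH_alg])

text \<open>\<open>W\<close> is \<open>w\<close> made extensional, as membership in the convolution
  monoid demands. In general \<open>W'\<close> is not a convolution inverse of \<open>W\<close>, and
  \<open>E\<close> measures the failure.\<close>

definition "W = restrict w (carrier D)"
definition "W' = up S W"
definition "E = W \<star> W'"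

lemma D_vs: "vs D" by (rule coalgebra_vs[OF D])

lemma w_lin: "lin D H w" using partial_corep by (simp add: partial_corep_def)

lemma W_closed [simp]: "W \<in> carrier (conv_monoid D H)"
  unfolding W_def by (rule conv_carrierI[OF D_vs w_lin])

lemma W_lin: "lin D H W" by (rule conv_carrierD[OF W_closed])

lemma W'_closed [simp]: "W' \<in> carrier (conv_monoid D H)"
  unfolding W'_def by (rule compose_closed[OF D S_lin W_lin])

lemma W'_lin: "lin D H W'" by (rule conv_carrierD[OF W'_closed])

lemma E_closed [simp]: "E \<in> carrier (conv_monoid D H)" by (simp add: E_def)

lemma up_closed [simp]:
  "\<phi> \<in> carrier (conv_monoid D H) \<Longrightarrow> up i1 \<phi> \<in> carrier (conv_monoid D HH)"
  "\<phi> \<in> carrier (conv_monoid D H) \<Longrightarrow> up i2 \<phi> \<in> carrier (conv_monoid D HH)"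
  "\<phi> \<in> carrier (conv_monoid D H) \<Longrightarrow> up (comult H) \<phi> \<in> carrier (conv_monoid D HH)"
  by (intro compose_closed[OF D _ conv_carrierD]; simp add: i1_lin i2_lin comult_lin)+

lemma up_conv:
  assumes "\<phi> \<in> carrier (conv_monoid D H)" "\<psi> \<in> carrier (conv_monoid D H)"
  shows "up i1 (\<phi> \<star> \<psi>) = up i1 \<phi> \<diamondop> up i1 \<psi>" "up i2 (\<phi> \<star> \<psi>) = up i2 \<phi> \<diamondop> up i2 \<psi>"
    "up (comult H) (\<phi> \<star> \<psi>) = up (comult H) \<phi> \<diamondop> up (comult H) \<psi>"
  by (intro compose_conv[OF D H_alg HH_alg] i1_hom i2_hom comult_hom conv_carrierD assms)+

lemma w_closed: "x \<in> carrier D \<Longrightarrow> w x \<in> carrier H" by (rule lin_closed[OF w_lin])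

lemma S_closed: "x \<in> carrier H \<Longrightarrow> S x \<in> carrier H" by (rule lin_closed[OF S_lin])

lemma W_apply: "x \<in> carrier D \<Longrightarrow> W x = w x" "x \<in> carrier D \<Longrightarrow> W' x = S (w x)"
  by (simp_all add: W_def W'_def compose_apply)

text \<open>The first corepresentation axiom, with the factor in the second leg rewritten as right
  multiplication by a value of \<open>i2\<close>.\<close>

lemma corep_left: "up (comult H) W \<diamondop> up i2 W' = up i1 W \<diamondop> (up i2 W \<diamondop> up i2 W')"
proof (rule conv_eqI[of _ D HH])
  fix c assume c: "c \<in> carrier D"
  note V = D_vs D_vs HT_vs and cc = comult_closed[OF _ D]
  have l: "lin D HH (up i1 W)" "lin D HH (up i2 W)" "lin D HH (up i2 W')" "lin D HH (up (comult H) W)"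
    by (rule conv_carrierD; simp)+
  note b = conv3_inner_bilin[OF D HH_alg l(1,2,3)] and B = conv3_bilin[OF D HH_alg l(1,2,3)]
  have "(up (comult H) W \<diamondop> up i2 W') c =
    tsum K HH (comult D c) (\<lambda>c1 c2. up (comult H) W c1 \<otimes>\<^bsub>HH\<^esub> up i2 W' c2)"
    using c by (simp add: conv_apply)
  also have "\<dots> = tsum K HH (comult D c) (\<lambda>c1 c2.
        tsum K (tensor K H H) (comult H (w c1)) (\<lambda>a b. ptensor K H H a (b \<otimes>\<^bsub>H\<^esub> S (w c2))))"
    by (rule tsum_cong[OF cc[OF c] conv_bilin[OF D HH_alg l(4,3)] _ D_vs D_vs alg_vs[OF HH_alg]])
     (simp add: compose_apply W_apply mult_i2 lin_closed[OF comult_lin] w_closed S_closed)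
  also have "\<dots> = tsum K HH (comult D c) (\<lambda>c1 c'.
        tsum K HH (comult D c') (\<lambda>c2 c3.
          ptensor K H H (w c1) (w c2 \<otimes>\<^bsub>H\<^esub> S (w c3))))"
    using partial_corep c by (simp add: partial_corep_def)
  also have "\<dots> = tsum K HH (comult D c) (\<lambda>c1 c'. tsum K HH (comult D c') (\<lambda>c2 c3.
    up i1 W c1 \<otimes>\<^bsub>HH\<^esub> (up i2 W c2 \<otimes>\<^bsub>HH\<^esub> up i2 W' c3)))"
    by (rule tsum_cong[OF cc[OF c] B _ D_vs D_vs alg_vs[OF HH_alg], symmetric],
        rule tsum_cong[OF cc b _ D_vs D_vs alg_vs[OF HH_alg]], assumption+)
      (simp add: compose_apply W_apply i1_i2 alg_homD(2)[OF i2_hom, symmetric] w_closed S_closed)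
  also have "\<dots> = (up i1 W \<diamondop> (up i2 W \<diamondop> up i2 W')) c"
    by (rule conv3_apply[OF D HH_alg l(1,2,3) c, symmetric])
  finally show "(up (comult H) W \<diamondop> up i2 W') c = (up i1 W \<diamondop> (up i2 W \<diamondop> up i2 W')) c" .
qed simp_all

lemma corep_right:
  assumes B: "alg B" and al: "alg_hom H B al" and be: "lin H B be"
  shows "conv D B (up al W) (up (conv H B (compose (carrier H) al S) be) W) =
    conv D B (up al W) (conv D B (up al W') (up be W))"
proof (rule conv_eqI[of _ D B])
  interpret MB: monoid "conv_monoid D B" by (rule conv_monoid[OF D B])
  note all = alg_homD(1)[OF al]
  note BV = alg_vs[OF B]
  let ?aS = "compose (carrier H) al S"
  have aS: "lin H B ?aS" by (rule conv_carrierD[OF compose_closed[OF H_coalgebra all S_lin]])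
  have cv: "lin H B (conv H B ?aS be)" by (rule conv_lin[OF H_coalgebra B aS be])
  have c1: "up al W \<in> carrier (conv_monoid D B)" "up al W' \<in> carrier (conv_monoid D B)"
    "up be W \<in> carrier (conv_monoid D B)" "up (conv H B ?aS be) W \<in> carrier (conv_monoid D B)"
    by (rule compose_closed[OF D all W_lin] compose_closed[OF D all W'_lin] compose_closed[OF D be W_lin]
      compose_closed[OF D cv W_lin])+
  then show "conv D B (up al W) (up (conv H B ?aS be) W) \<in> carrier (conv_monoid D B)"
    "conv D B (up al W) (conv D B (up al W') (up be W)) \<in> carrier (conv_monoid D B)" by simp_all
  have l: "lin D B (up al W)" "lin D B (up al W')" "lin D B (up be W)" "lin D B (up (conv H B ?aS be) W)"
    using c1 by (auto intro: conv_carrierD)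
  note b = conv3_inner_bilin[OF D B l(1,2,3)] and BB = conv3_bilin[OF D B l(1,2,3)]
  note cc = comult_closed[OF _ D] and ccH = comult_closed[OF _ H_coalgebra]
  \<comment> \<open>\<open>G\<close> carries the tensor identity of the axiom into \<open>B\<close>.
    Multiplicativity of \<open>al\<close> separates \<open>w c1\<close> from the antipode factor,
    which then pairs with \<open>be\<close> to form a convolution on \<open>H\<close>.\<close>
  define G where "G t = tsum K B t (\<lambda>s t. al s \<otimes>\<^bsub>B\<^esub> be t)" for t
  have gb: "bilin H H B (\<lambda>s t. al s \<otimes>\<^bsub>B\<^esub> be t)"
    by (rule bilin_precomp[OF mult_bilin[OF B] all be])
  have G: "lin (tensor K H H) B G" unfolding G_def by (rule tsum_lin[OF H_vs H_vs BV gb])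
  have Gp: "G (ptensor K H H s t) = al s \<otimes>\<^bsub>B\<^esub> be t" if "s \<in> carrier H" "t \<in> carrier H" for s t
    unfolding G_def by (rule tsum_ptensor[OF H_vs H_vs BV gb that])
  note Sl = lin_app[OF S_lin] and wl = lin_app[OF w_lin]
  have ib1: "bilin H H (tensor K H H) (\<lambda>a b. ptensor K H H (x \<otimes>\<^bsub>H\<^esub> S a) b)" if "x \<in> carrier H" for x
    using that by - (assumption | rule H_vs H_alg S_closed Sl lins)+
  have B1: "bilin D D (tensor K H H) (\<lambda>c1 c2. tsum K (tensor K H H) (comult H (w c2)) (\<lambda>a b.
          ptensor K H H (w c1 \<otimes>\<^bsub>H\<^esub> S a) b))"
    by (assumption | rule D_vs H_vs H_alg H_coalgebra S_closed w_closed Sl wl ib1 lins)+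
  have ib2: "bilin D D (tensor K H H) (\<lambda>c2 c3. ptensor K H H (x \<otimes>\<^bsub>H\<^esub> S (w c2)) (w c3))" if "x \<in> carrier H" for x
    using that by - (assumption | rule D_vs H_vs H_alg S_closed w_closed Sl wl lins)+
  have B2: "bilin D D (tensor K H H) (\<lambda>c1 c'. tsum K (tensor K H H) (comult D c') (\<lambda>c2 c3.
          ptensor K H H (w c1 \<otimes>\<^bsub>H\<^esub> S (w c2)) (w c3)))"
    by (assumption | rule D D_vs H_vs H_alg H_coalgebra S_closed w_closed ib2 Sl wl lins)+
  fix c assume c: "c \<in> carrier D"
  have "conv D B (up al W) (up (conv H B ?aS be) W) c =
    tsum K B (comult D c) (\<lambda>c1 c2. up al W c1 \<otimes>\<^bsub>B\<^esub> up (conv H B ?aS be) W c2)"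
    by (rule conv_apply[OF c])
  also have "\<dots> = tsum K B (comult D c) (\<lambda>c1 c2. G (tsum K (tensor K H H) (comult H (w c2)) (\<lambda>a b.
          ptensor K H H (w c1 \<otimes>\<^bsub>H\<^esub> S a) b)))"
  proof (rule tsum_cong[OF cc[OF c] conv_bilin[OF D B l(1,4)] _ D_vs D_vs BV])
    fix c1 c2 assume h: "c1 \<in> carrier D" "c2 \<in> carrier D"
    note wh = w_closed[OF h(1)] w_closed[OF h(2)]
    have alc: "al (w c1) \<in> carrier B" by (rule lin_closed[OF all wh(1)])
    have "up al W c1 \<otimes>\<^bsub>B\<^esub> up (conv H B ?aS be) W c2 =
      al (w c1) \<otimes>\<^bsub>B\<^esub> tsum K B (comult H (w c2)) (\<lambda>a b. ?aS a \<otimes>\<^bsub>B\<^esub> be b)"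
      using h wh by (simp add: compose_apply W_apply conv_apply)
    also have "\<dots> = tsum K B (comult H (w c2)) (\<lambda>a b. al (w c1) \<otimes>\<^bsub>B\<^esub> (?aS a \<otimes>\<^bsub>B\<^esub> be b))"
      by (rule tsum_hom[OF ccH[OF wh(2)] bilin_lin2[OF mult_bilin[OF B] alc] conv_bilin[OF H_coalgebra B aS be] H_vs H_vs BV BV])
    also have "\<dots> = tsum K B (comult H (w c2)) (\<lambda>a b. G (ptensor K H H (w c1 \<otimes>\<^bsub>H\<^esub> S a) b))"
    proof (rule tsum_cong[OF ccH[OF wh(2)] bilin_comp[OF conv_bilin[OF H_coalgebra B aS be] bilin_lin2[OF mult_bilin[OF B] alc]] _ H_vs H_vs BV])
      interpret B: ring B by (rule alg_ring[OF B])
      fix a b assume ab: "a \<in> carrier H" "b \<in> carrier H"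
      then show "al (w c1) \<otimes>\<^bsub>B\<^esub> (?aS a \<otimes>\<^bsub>B\<^esub> be b) = G (ptensor K H H (w c1 \<otimes>\<^bsub>H\<^esub> S a) b)"
        using wh by (simp add: Gp S_closed compose_apply alg_homD(2)[OF al] B.m_assoc lin_closed[OF all] lin_closed[OF be])
    qed
    also have "\<dots> = G (tsum K (tensor K H H) (comult H (w c2)) (\<lambda>a b. ptensor K H H (w c1 \<otimes>\<^bsub>H\<^esub> S a) b))"
      by (rule tsum_hom[OF ccH[OF wh(2)] G ib1[OF wh(1)] H_vs H_vs HT_vs BV, symmetric])
    finally show "up al W c1 \<otimes>\<^bsub>B\<^esub> up (conv H B ?aS be) W c2 = \<dots>" .
  qed
  also have "\<dots> = G (tsum K (tensor K H H) (comult D c) (\<lambda>c1 c2. tsum K (tensor K H H) (comult H (w c2)) (\<lambda>a b.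
          ptensor K H H (w c1 \<otimes>\<^bsub>H\<^esub> S a) b)))"
    by (rule tsum_hom[OF cc[OF c] G B1 D_vs D_vs HT_vs BV, symmetric])
  also have "\<dots> = G (tsum K (tensor K H H) (comult D c) (\<lambda>c1 c'. tsum K (tensor K H H) (comult D c') (\<lambda>c2 c3.
          ptensor K H H (w c1 \<otimes>\<^bsub>H\<^esub> S (w c2)) (w c3))))"
    using partial_corep c by (simp add: partial_corep_def)
  also have "\<dots> = tsum K B (comult D c) (\<lambda>c1 c'. G (tsum K (tensor K H H) (comult D c') (\<lambda>c2 c3.
          ptensor K H H (w c1 \<otimes>\<^bsub>H\<^esub> S (w c2)) (w c3))))"
    by (rule tsum_hom[OF cc[OF c] G B2 D_vs D_vs HT_vs BV])
  also have "\<dots> = tsum K B (comult D c) (\<lambda>c1 c'. tsum K B (comult D c') (\<lambda>c2 c3.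
          up al W c1 \<otimes>\<^bsub>B\<^esub> (up al W' c2 \<otimes>\<^bsub>B\<^esub> up be W c3)))"
  proof (rule tsum_cong[OF cc[OF c] bilin_comp[OF B2 G] _ D_vs D_vs BV])
    fix c1 c' assume h: "c1 \<in> carrier D" "c' \<in> carrier D"
    note wh = w_closed[OF h(1)]
    interpret B: ring B by (rule alg_ring[OF B])
    have "G (tsum K (tensor K H H) (comult D c') (\<lambda>c2 c3. ptensor K H H (w c1 \<otimes>\<^bsub>H\<^esub> S (w c2)) (w c3))) =
      tsum K B (comult D c') (\<lambda>c2 c3. G (ptensor K H H (w c1 \<otimes>\<^bsub>H\<^esub> S (w c2)) (w c3)))"
      by (rule tsum_hom[OF cc[OF h(2)] G ib2[OF wh] D_vs D_vs HT_vs BV])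
    also have "\<dots> = tsum K B (comult D c') (\<lambda>c2 c3.
          up al W c1 \<otimes>\<^bsub>B\<^esub> (up al W' c2 \<otimes>\<^bsub>B\<^esub> up be W c3))"
      by (rule tsum_cong[OF cc[OF h(2)] bilin_comp[OF ib2[OF wh] G] _ D_vs D_vs BV])
        (simp add: Gp S_closed w_closed h compose_apply W_apply alg_homD(2)[OF al] B.m_assoc lin_closed[OF all] lin_closed[OF be])
    finally show "G (tsum K (tensor K H H) (comult D c') (\<lambda>c2 c3. ptensor K H H (w c1 \<otimes>\<^bsub>H\<^esub> S (w c2)) (w c3))) = \<dots>" .
  qed
  also have "\<dots> = conv D B (up al W) (conv D B (up al W') (up be W)) c"
    by (rule conv3_apply[OF D B l(1,2,3) c, symmetric])
  finally show "conv D B (up al W) (up (conv H B ?aS be) W) c =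
    conv D B (up al W) (conv D B (up al W') (up be W)) c" .
qed

lemma up_restrict: "up (restrict g (carrier H)) W = up g W"
  by (rule compose_cong) (simp_all add: W_apply w_closed)

lemma up_compose: "up (compose (carrier H) g S) W = up g W'"
  by (auto simp: compose_def W_def W'_def w_closed)

lemma up_id: "\<phi> \<in> carrier (conv_monoid D B) \<Longrightarrow> up (\<lambda>x. x) \<phi> = \<phi>"
  by (simp add: compose_def conv_monoid_def extensional_restrict)

text \<open>For \<open>al\<close> and \<open>be\<close> the identity, the convolution on
  \<open>H\<close> collapses to the unit by the antipode axiom; since \<open>w\<close> preserves the
  counit, the left side of \<open>corep_right\<close> is just \<open>W\<close>.\<close>

lemma E_W: "E \<star> W = W"
proof -
  let ?i = "\<lambda>x. x"
  have r: "lin H H (restrict ?i (carrier H))" by (rule lin_restrict[OF H_vs lin_id])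
  have "up (conv H H (compose (carrier H) ?i S) (restrict ?i (carrier H))) W = \<one>\<^bsub>conv_monoid D H\<^esub>"
    using partial_corep unfolding antipode_conv_hom(1)[OF H_alg id_hom]
    by (auto simp: compose_def conv_monoid_def W_apply w_closed partial_corep_def)
  then show ?thesis
    using corep_right[OF H_alg id_hom r] by (simp add: up_id[OF W_closed] up_id[OF W'_closed] up_restrict E_def M.m_assoc)
qed

text \<open>Both sides equal \<open>up (comult H) W \<diamondop> up i2 W'\<close>. The right side is
  the first axiom; for the left side the second axiom is used with \<open>\<Delta>\<close> and
  \<open>i1\<close>, where \<open>comult_antipode_mult\<close> produces the factor
  \<open>i2 \<circ> S\<close>.\<close>

lemma E_comm: "up (comult H) E \<diamondop> up i1 W = up i1 W \<diamondop> up i2 E"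
proof -
  have r: "lin H HH (restrict i1 (carrier H))" using lin_restrict[OF H_vs i1_lin] by simp
  have "up (comult H) W \<diamondop> up i2 W' = up (comult H) W \<diamondop> (up (comult H) W' \<diamondop> up i1 W)"
    using corep_right[OF HH_alg comult_hom r] by (simp add: comult_antipode_mult up_compose up_restrict)
  then show ?thesis by (simp add: E_def up_conv corep_left MM.m_assoc)
qed

text \<open>Both products are brought to the common form
  \<open>up i1 W \<diamondop> up i2 E \<diamondop> up i1 W'\<close>: the first by two instances of
  \<open>corep_right\<close>, the second by \<open>E_comm\<close> multiplied with
  \<open>up i1 W'\<close>.\<close>

lemma E_comm2: "up i1 E \<diamondop> up (comult H) E = up (comult H) E \<diamondop> up i1 E"
proof -
  interpret HHm: monoid homHH by (rule conv_monoid[OF H_coalgebra HH_alg])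
  have r: "lin H HH (restrict (comult H) (carrier H))" using lin_restrict[OF H_vs comult_lin] by simp
  have q: "lin H HH (compose (carrier H) i1 S)" using conv_carrierD[OF HHc(2)[OF i1_lin]] .
  note c = HHc[OF i1_lin] HHc[OF i2_lin] HHc[OF comult_lin]
  \<comment> \<open>Cancels \<open>i1\<close> in the factorisation of \<open>\<Delta>\<close>;
    pointwise, \<open>S(h1) h2 \<otimes> h3 = 1 \<otimes> h\<close>.\<close>
  have "conv H HH (compose (carrier H) i1 S) (restrict (comult H) (carrier H)) = restrict i2 (carrier H)"
    using antipode_conv_hom(1)[OF HH_alg i1_hom] c
    by (simp add: comult_conv HHm.m_assoc[symmetric])
  then have 1: "up i1 W \<diamondop> up i2 W = up i1 W \<diamondop> (up i1 W' \<diamondop> up (comult H) W)"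
    using corep_right[OF HH_alg i1_hom r] by (simp add: up_restrict)
  \<comment> \<open>The pair is \<open>i2\<close> and \<open>i1 \<circ> S\<close>: their convolution
    on \<open>H\<close> is \<open>\<Delta> \<circ> S\<close> because the antipode reverses the
    comultiplication.\<close>
  have 2: "up i2 W \<diamondop> up (comult H) W' = up i2 W \<diamondop> (up i2 W' \<diamondop> up i1 W')"
    using corep_right[OF HH_alg i2_hom q] by (simp add: comult_antipode[symmetric] up_compose)
  have "up i1 E \<diamondop> up (comult H) E = (up i1 W \<diamondop> (up i1 W' \<diamondop> up (comult H) W)) \<diamondop> up (comult H) W'"
    by (simp add: E_def up_conv MM.m_assoc)
  also have "\<dots> = up i1 W \<diamondop> (up i2 W \<diamondop> up (comult H) W')"
    by (simp add: 1[symmetric] MM.m_assoc)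
  also have "\<dots> = (up i1 W \<diamondop> up i2 E) \<diamondop> up i1 W'"
    by (simp add: 2 E_def up_conv MM.m_assoc)
  also have "\<dots> = up (comult H) E \<diamondop> up i1 E"
    unfolding E_comm[symmetric] by (simp add: MM.m_assoc, simp add: E_def up_conv MM.m_assoc)
  finally show ?thesis .
qed

subsection \<open>Coefficient functionals of the base\<close>

text \<open>The two rules known for \<open>E\<close>, stated for an arbitrary
  \<open>H\<close>-valued map. The maps \<open>act A\<close> that occur are built from
  \<open>E\<close> by slicing and convolution, and the rules are stable under both
  operations.\<close>

definition "good \<phi> \<longleftrightarrow> \<phi> \<in> carrier (conv_monoid D H) \<and>
  up (comult H) \<phi> \<diamondop> up i1 W = up i1 W \<diamondop> up i2 \<phi> \<and>
  up i1 E \<diamondop> up (comult H) \<phi> = up (comult H) \<phi> \<diamondop> up i1 E"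

lemma good_E: "good E" by (simp add: good_def E_comm E_comm2)

lemma good_conv:
  assumes "good \<phi>" "good \<psi>" shows "good (\<phi> \<star> \<psi>)"
proof -
  have c: "\<phi> \<in> carrier (conv_monoid D H)" "\<psi> \<in> carrier (conv_monoid D H)"
    and 1: "up (comult H) \<phi> \<diamondop> up i1 W = up i1 W \<diamondop> up i2 \<phi>" "up (comult H) \<psi> \<diamondop> up i1 W = up i1 W \<diamondop> up i2 \<psi>"
    and 2: "up i1 E \<diamondop> up (comult H) \<phi> = up (comult H) \<phi> \<diamondop> up i1 E" "up i1 E \<diamondop> up (comult H) \<psi> = up (comult H) \<psi> \<diamondop> up i1 E"
    using assms by (auto simp: good_def)
  have "up (comult H) (\<phi> \<star> \<psi>) \<diamondop> up i1 W = up (comult H) \<phi> \<diamondop> (up i1 W \<diamondop> up i2 \<psi>)"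
    using c by (simp add: up_conv MM.m_assoc 1)
  also have "\<dots> = up i1 W \<diamondop> up i2 (\<phi> \<star> \<psi>)"
    using c by (simp add: MM.m_assoc[symmetric] 1, simp add: up_conv MM.m_assoc)
  finally have A: "up (comult H) (\<phi> \<star> \<psi>) \<diamondop> up i1 W = up i1 W \<diamondop> up i2 (\<phi> \<star> \<psi>)" .
  have "up i1 E \<diamondop> up (comult H) (\<phi> \<star> \<psi>) = (up i1 E \<diamondop> up (comult H) \<phi>) \<diamondop> up (comult H) \<psi>"
    using c by (simp add: up_conv MM.m_assoc)
  also have "\<dots> = up (comult H) \<phi> \<diamondop> (up i1 E \<diamondop> up (comult H) \<psi>)"
    unfolding 2(1) using c by (simp add: MM.m_assoc)
  also have "\<dots> = up (comult H) (\<phi> \<star> \<psi>) \<diamondop> up i1 E"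
    using c by (simp add: 2 up_conv MM.m_assoc)
  finally show ?thesis using A c by (simp add: good_def)
qed

lemma up_up:
  "\<lbrakk>\<phi> \<in> carrier (conv_monoid D H); \<And>z. z \<in> carrier H \<Longrightarrow> g (h z) = g' (h' z)\<rbrakk> \<Longrightarrow> up g (up h \<phi>) = up g' (up h' \<phi>)"
  using lin_closed[OF conv_carrierD, of \<phi> D H] by (auto simp: compose_def)

text \<open>All factors other than \<open>\<phi>\<close> enter the two rules through
  \<open>i1\<close>, so applying the slice to the second leg passes through them and merely replaces
  \<open>\<phi>\<close> by its image under \<open>rslice f\<close>.\<close>

lemma good_rslice:
  assumes g: "good \<phi>" and f: "lin H scalars f"
  shows "good (up (rslice f) \<phi>)"
proof -
  have c: "\<phi> \<in> carrier (conv_monoid D H)"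
    and 1: "up (comult H) \<phi> \<diamondop> up i1 W = up i1 W \<diamondop> up i2 \<phi>"
    and 2: "up i1 E \<diamondop> up (comult H) \<phi> = up (comult H) \<phi> \<diamondop> up i1 E"
    using g by (auto simp: good_def)
  note pl = conv_carrierD[OF c]
  have c': "up (rslice f) \<phi> \<in> carrier (conv_monoid D H)"
    by (rule compose_closed[OF D rslice_lin[OF f] pl])
  have sl: "lin HH HH (slice2 f)" using slice2_lin[OF f] by simp
  have L: "up (slice2 f) (up i1 \<psi> \<diamondop> \<chi>) = up i1 \<psi> \<diamondop> up (slice2 f) \<chi>"
    "up (slice2 f) (\<chi> \<diamondop> up i1 \<psi>) = up (slice2 f) \<chi> \<diamondop> up i1 \<psi>"
    if "\<psi> \<in> carrier (conv_monoid D H)" "\<chi> \<in> carrier (conv_monoid D HH)" for \<psi> \<chi>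
  proof -
    note l = conv_carrierD[OF up_closed(1)[OF that(1)]] conv_carrierD[OF that(2)]
    note pc = lin_closed[OF conv_carrierD[OF that(1)]]
    show "up (slice2 f) (up i1 \<psi> \<diamondop> \<chi>) = up i1 \<psi> \<diamondop> up (slice2 f) \<chi>"
      by (rule compose_conv_left[OF D HH_alg HH_alg sl l(1) l(1) l(2)])
        (simp add: compose_apply slice2_i1[OF f] pc)
    show "up (slice2 f) (\<chi> \<diamondop> up i1 \<psi>) = up (slice2 f) \<chi> \<diamondop> up i1 \<psi>"
      by (rule compose_conv_right[OF D HH_alg HH_alg sl l(1) l(1) l(2)])
        (simp add: compose_apply slice2_i1[OF f] pc)
  qed
  have u: "up (slice2 f) (up (comult H) \<phi>) = up (comult H) (up (rslice f) \<phi>)"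
    "up (slice2 f) (up i2 \<phi>) = up i2 (up (rslice f) \<phi>)"
    by (rule up_up[OF c]; simp add: slice2_comult[OF f] slice2_i2[OF f])+
  have "up (slice2 f) (up (comult H) \<phi> \<diamondop> up i1 W) = up (slice2 f) (up i1 W \<diamondop> up i2 \<phi>)" by (simp add: 1)
  moreover have "up (slice2 f) (up i1 E \<diamondop> up (comult H) \<phi>) = up (slice2 f) (up (comult H) \<phi> \<diamondop> up i1 E)"
    by (simp add: 2)
  ultimately show ?thesis using c c' by (simp add: good_def L u)
qed

text \<open>Multiplying a functional by the unit of \<open>H\<close> places it in the same
  convolution monoid as \<open>W\<close> and \<open>W'\<close>. Then \<open>act A\<close> is the map
  that contracting the coaction formula with \<open>A\<close> produces.\<close>

definition "scalar_map A = up (\<lambda>k. k \<odot>\<^bsub>H\<^esub> \<one>\<^bsub>H\<^esub>) A"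
definition "act A = W \<star> (scalar_map A \<star> W')"

abbreviation "dual \<equiv> conv_monoid D scalars"

definition "nice A \<longleftrightarrow> A \<in> carrier dual \<and> act A \<star> W = W \<star> scalar_map A \<and> good (act A)"

lemma scalar_map_closed [simp]: "A \<in> carrier dual \<Longrightarrow> scalar_map A \<in> carrier (conv_monoid D H)"
  unfolding scalar_map_def
  by (rule compose_closed[OF D alg_homD(1)[OF scalar_unit_hom[OF H_alg]] conv_carrierD])

lemma act_closed [simp]: "A \<in> carrier dual \<Longrightarrow> act A \<in> carrier (conv_monoid D H)"
  by (simp add: act_def)

lemma act_one: "act \<one>\<^bsub>dual\<^esub> = E"
  by (simp add: act_def scalar_map_def compose_conv_one[OF scalars_alg D scalar_unit_hom[OF H_alg]] E_def)

lemma scalar_map_conv: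
  "A \<in> carrier dual \<Longrightarrow> A' \<in> carrier dual \<Longrightarrow>
    scalar_map (conv D scalars A A') = scalar_map A \<star> scalar_map A'"
  unfolding scalar_map_def
  by (rule compose_conv[OF D scalars_alg H_alg scalar_unit_hom[OF H_alg]]) (rule conv_carrierD, assumption)+

lemma nice_one: "nice \<one>\<^bsub>dual\<^esub>"
proof -
  interpret du: monoid dual by (rule conv_monoid[OF D scalars_alg])
  have "scalar_map \<one>\<^bsub>dual\<^esub> = \<one>\<^bsub>conv_monoid D H\<^esub>"
    by (simp add: scalar_map_def compose_conv_one[OF scalars_alg D scalar_unit_hom[OF H_alg]])
  then show ?thesis by (simp add: nice_def act_one good_E E_W)
qed

text \<open>In \<open>act A \<star> act A'\<close> the rule for \<open>act A \<star> W\<close> turns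
  the inner copy of \<open>W\<close> into \<open>scalar_map A\<close> next to
  \<open>scalar_map A'\<close>, so a single outer pair \<open>W\<close>, \<open>W'\<close>
  remains.\<close>

lemma act_conv:
  assumes "nice A" "A' \<in> carrier dual"
  shows "act (conv D scalars A A') = act A \<star> act A'"
proof -
  have c: "A \<in> carrier dual" and n: "act A \<star> W = W \<star> scalar_map A" using assms by (auto simp: nice_def)
  have "act A \<star> act A' = (act A \<star> W) \<star> (scalar_map A' \<star> W')"
    using c assms(2) by (simp add: M.m_assoc act_def[of A'])
  also have "\<dots> = act (conv D scalars A A')"
    unfolding n using c assms(2) by (simp add: act_def scalar_map_conv M.m_assoc)
  finally show ?thesis by simp
qed

lemma nice_conv:
  assumes "nice A" "nice A'" shows "nice (conv D scalars A A')"
proof -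
  interpret du: monoid dual by (rule conv_monoid[OF D scalars_alg])
  have c: "A \<in> carrier dual" "A' \<in> carrier dual" and g: "good (act A)" "good (act A')"
    and n: "act A \<star> W = W \<star> scalar_map A" "act A' \<star> W = W \<star> scalar_map A'"
    using assms by (auto simp: nice_def)
  have "act (conv D scalars A A') \<star> W = act A \<star> (W \<star> scalar_map A')"
    using c by (simp add: act_conv[OF assms(1) c(2)] M.m_assoc n)
  also have "\<dots> = W \<star> scalar_map (conv D scalars A A')"
    using c by (simp add: M.m_assoc[symmetric] n, simp add: scalar_map_conv M.m_assoc)
  finally show ?thesis
    using c good_conv[OF g] by (simp add: nice_def act_conv[OF assms(1) c(2)])
qed

text \<open>The slice of the first rule in \<open>good\<close> by \<open>f\<close>: the
  comultiplication on the left becomes \<open>rslice f\<close>, and the second-leg copy of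
  \<open>\<phi>\<close> on the right becomes a scalar.\<close>

lemma rslice_W:
  assumes g: "good \<phi>" and f: "lin H scalars f"
  shows "up (rslice f) \<phi> \<star> W = W \<star> scalar_map (up f \<phi>)"
proof -
  have c: "\<phi> \<in> carrier (conv_monoid D H)"
    and 1: "up (comult H) \<phi> \<diamondop> up i1 W = up i1 W \<diamondop> up i2 \<phi>"
    using g by (auto simp: good_def)
  have sl: "lin HH H (slice f)" using slice_lin[OF f] by simp
  note l = conv_carrierD[OF up_closed(1)[OF W_closed]] W_lin
  have "up (slice f) (up (comult H) \<phi> \<diamondop> up i1 W) = up (slice f) (up (comult H) \<phi>) \<star> W"
    by (rule compose_conv_right[OF D HH_alg H_alg sl l conv_carrierD[OF up_closed(3)[OF c]]])
      (simp add: compose_apply slice_i1[OF f] lin_closed[OF W_lin])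
  moreover have "up (slice f) (up i1 W \<diamondop> up i2 \<phi>) = W \<star> up (slice f) (up i2 \<phi>)"
    by (rule compose_conv_left[OF D HH_alg H_alg sl l conv_carrierD[OF up_closed(2)[OF c]]])
      (simp add: compose_apply slice_i1[OF f] lin_closed[OF W_lin])
  moreover have "up (slice f) (up (comult H) \<phi>) = up (rslice f) \<phi>"
    by (auto simp: compose_def rslice_def)
  moreover have "up (slice f) (up i2 \<phi>) = scalar_map (up f \<phi>)"
    unfolding scalar_map_def by (rule up_up[OF c]) (rule slice_i2[OF f])
  ultimately show ?thesis using 1 by simp
qed

text \<open>\<open>rslice_W\<close> trades the scalar standing to the right of \<open>W\<close> for
  a slice of \<open>E\<close> to its left, after which \<open>W \<star> W'\<close> closes up to
  \<open>E\<close>. The result involves \<open>E\<close> only, which is why it will factor through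
  \<open>Ebar\<close>.\<close>

lemma act_f_E:
  assumes f: "lin H scalars f" shows "act (up f E) = up (rslice f) E \<star> E"
proof -
  have c: "up f E \<in> carrier dual" by (rule compose_closed[OF D f conv_carrierD[OF E_closed]])
  have r: "up (rslice f) E \<in> carrier (conv_monoid D H)"
    by (rule compose_closed[OF D rslice_lin[OF f] conv_carrierD[OF E_closed]])
  have "act (up f E) = (W \<star> scalar_map (up f E)) \<star> W'" using c by (simp add: act_def M.m_assoc)
  also have "\<dots> = up (rslice f) E \<star> E"
    using r by (simp add: rslice_W[OF good_E f, symmetric] M.m_assoc E_def[symmetric])
  finally show ?thesis .
qed

text \<open>In \<open>act (up f E) \<star> W\<close> the trailing \<open>E\<close> is absorbed by
  \<open>E_W\<close>, and \<open>rslice_W\<close> then gives the required rule.\<close>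

lemma nice_f_E:
  assumes f: "lin H scalars f" shows "nice (up f E)"
proof -
  have c: "up f E \<in> carrier dual" by (rule compose_closed[OF D f conv_carrierD[OF E_closed]])
  have r: "up (rslice f) E \<in> carrier (conv_monoid D H)"
    by (rule compose_closed[OF D rslice_lin[OF f] conv_carrierD[OF E_closed]])
  have "act (up f E) \<star> W = W \<star> scalar_map (up f E)"
    using r by (simp add: act_f_E[OF f] M.m_assoc E_W rslice_W[OF good_E f])
  moreover have "good (act (up f E))"
    unfolding act_f_E[OF f] by (intro good_conv good_rslice good_E f)
  ultimately show ?thesis using c by (simp add: nice_def)
qed

end

context vector_spaces
begin

subsection \<open>Coalgebra maps\<close>

lemma coalgebra_mapD:
  assumes "coalgebra_map K C D F"
  shows "lin C D F" "\<And>c. c \<in> carrier C \<Longrightarrow> counit D (F c) = counit C c"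
    "\<And>c. c \<in> carrier C \<Longrightarrow> comult D (F c) = tmap D D F F (comult C c)"
  using assms by (auto simp: coalgebra_map_def tmap_def)

lemma coalgebra_mapI:
  assumes "lin C D F" "\<And>c. c \<in> carrier C \<Longrightarrow> counit D (F c) = counit C c"
    "\<And>c. c \<in> carrier C \<Longrightarrow> comult D (F c) = tmap D D F F (comult C c)"
  shows "coalgebra_map K C D F"
  using assms by (auto simp: coalgebra_map_def tmap_def)

lemma coalgebra_map_tsum:
  assumes C: "coalgebra K C" and D: "vs D" and F: "coalgebra_map K C D F"
    and b: "bilin D D U \<beta>" and U: "vs U" and c: "c \<in> carrier C"
  shows "tsum K U (comult D (F c)) \<beta> = tsum K U (comult C c) (\<lambda>a b. \<beta> (F a) (F b))"
proof -
  note V = coalgebra_vs[OF C]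
  show ?thesis
    unfolding coalgebra_mapD(3)[OF F c]
    by (rule tsum_tmap[OF V V D D coalgebra_mapD(1)[OF F] coalgebra_mapD(1)[OF F] b U comult_closed[OF c C]])
qed

lemma coalgebra_map_compose:
  assumes C: "coalgebra K C" and D: "coalgebra K D" and E: "coalgebra K E"
    and F: "coalgebra_map K C D F" and G: "coalgebra_map K D E G"
  shows "coalgebra_map K C E (\<lambda>x. G (F x))"
proof (rule coalgebra_mapI)
  note l = coalgebra_mapD(1)[OF F] coalgebra_mapD(1)[OF G]
  note V = coalgebra_vs[OF C] coalgebra_vs[OF D] coalgebra_vs[OF E]
  show "lin C E (\<lambda>x. G (F x))" by (rule lin_comp[OF l])
  fix c assume c: "c \<in> carrier C"
  note Fc = lin_closed[OF l(1) c]
  show "counit E (G (F c)) = counit C c"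
    using coalgebra_mapD(2)[OF F c] coalgebra_mapD(2)[OF G Fc] by simp
  have "comult E (G (F c)) = tsum K (tensor K E E) (comult D (F c)) (\<lambda>a b. ptensor K E E (G a) (G b))"
    using coalgebra_mapD(3)[OF G Fc] by (simp add: tmap_def)
  also have "\<dots> = tmap E E (\<lambda>x. G (F x)) (\<lambda>x. G (F x)) (comult C c)"
    unfolding tmap_def
    by (rule coalgebra_map_tsum[OF C V(2) F tmap_bilin[OF V(2) V(2) V(3) V(3) l(2) l(2)] tensor_vs[OF V(3) V(3)] c])
  finally show "comult E (G (F c)) = tmap E E (\<lambda>x. G (F x)) (\<lambda>x. G (F x)) (comult C c)" .
qed

lemma coalgebra_map_cong:
  assumes C: "coalgebra K C" and D: "vs D" and F: "coalgebra_map K C D F"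
    and eq: "\<And>x. x \<in> carrier C \<Longrightarrow> F x = G x"
  shows "coalgebra_map K C D G"
proof (rule coalgebra_mapI)
  note V = coalgebra_vs[OF C] and l = coalgebra_mapD(1)[OF F]
  show "lin C D G" using lin_cong[OF l V] eq by blast
  fix c assume c: "c \<in> carrier C"
  show "counit D (G c) = counit C c" using coalgebra_mapD(2)[OF F c] eq[OF c] by simp
  have "tmap D D F F (comult C c) = tmap D D G G (comult C c)"
    unfolding tmap_def
    by (rule tsum_cong[OF comult_closed[OF c C] tmap_bilin[OF V V D D l l] _ V V tensor_vs[OF D D]]) (simp add: eq)
  then show "comult D (G c) = tmap D D G G (comult C c)"
    using coalgebra_mapD(3)[OF F c] eq[OF c] by simp
qed

lemma compose_coalgebra_map:
  assumes C: "coalgebra K C" and D: "coalgebra K D" and F: "coalgebra_map K C D F" and B: "alg B"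
    and l: "lin D B \<phi>" "lin D B \<psi>"
  shows "compose (carrier C) (conv D B \<phi> \<psi>) F = conv C B (compose (carrier C) \<phi> F) (compose (carrier C) \<psi> F)"
proof (rule extensionalityI[of _ "carrier C"])
  note Fl = coalgebra_mapD(1)[OF F] and V = coalgebra_vs[OF C]
  fix x assume x: "x \<in> carrier C"
  have "compose (carrier C) (conv D B \<phi> \<psi>) F x = tsum K B (comult D (F x)) (\<lambda>a b. \<phi> a \<otimes>\<^bsub>B\<^esub> \<psi> b)"
    using x lin_closed[OF Fl x] by (simp add: compose_apply conv_apply)
  also have "\<dots> = tsum K B (comult C x) (\<lambda>a b. \<phi> (F a) \<otimes>\<^bsub>B\<^esub> \<psi> (F b))"
    by (rule coalgebra_map_tsum[OF C coalgebra_vs[OF D] F conv_bilin[OF D B l] alg_vs[OF B] x])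
  also have "\<dots> = conv C B (compose (carrier C) \<phi> F) (compose (carrier C) \<psi> F) x"
    unfolding conv_apply[OF x]
    by (rule tsum_cong[OF comult_closed[OF x C] bilin_precomp[OF conv_bilin[OF D B l] Fl Fl] _ V V alg_vs[OF B]])
      (simp add: compose_apply)
  finally show "compose (carrier C) (conv D B \<phi> \<psi>) F x = conv C B (compose (carrier C) \<phi> F) (compose (carrier C) \<psi> F) x" .
qed (auto simp: compose_def conv_monoid_def)

text \<open>Every element of \<open>Q\<close> is a value of \<open>q\<close>, and every Sweedler sum
  over \<open>q x\<close> can be written as a sum over \<open>x\<close>, so the axioms of
  \<open>Q\<close> are images of those of \<open>P\<close>.\<close>

lemma quotient_coalgebra:
  assumes P: "coalgebra K P" and Q: "vs Q" and q: "lin P Q q" and surj: "carrier Q = q ` carrier P"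
    and cm: "\<And>x. x \<in> carrier P \<Longrightarrow> comult Q (q x) = tmap Q Q q q (comult P x)"
    and cu: "\<And>x. x \<in> carrier P \<Longrightarrow> counit Q (q x) = counit P x"
  shows "coalgebra K Q" "coalgebra_map K P Q q"
proof -
  interpret P: module K P by (rule coalgebra_vs[OF P])
  note V = coalgebra_vs[OF P] and QQ = tensor_vs[OF Q Q]
  note tl = tmap_lin[OF V V Q Q q q] and cc = comult_closed[OF _ P]
  show m: "coalgebra_map K P Q q" by (rule coalgebra_mapI[OF q cu cm])
  note ts = coalgebra_map_tsum[OF P Q m]
  have cl: "lin Q (tensor K Q Q) (comult Q)"
  proof (rule linI)
    fix x assume "x \<in> carrier Q"
    then obtain y where "y \<in> carrier P" "x = q y" unfolding surj by blast
    then show "comult Q x \<in> carrier (tensor K Q Q)" using lin_closed[OF tl cc] cm by simp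
  next
    fix x x' assume "x \<in> carrier Q" "x' \<in> carrier Q"
    then obtain y y' where y: "y \<in> carrier P" "x = q y" "y' \<in> carrier P" "x' = q y'" unfolding surj by blast
    then have "comult Q (q (y \<oplus>\<^bsub>P\<^esub> y')) = comult Q (q y) \<oplus>\<^bsub>tensor K Q Q\<^esub> comult Q (q y')"
      by (simp add: cm lin_add[OF coalgebra.comult_linear[OF P]] lin_add[OF tl] cc)
    then show "comult Q (x \<oplus>\<^bsub>Q\<^esub> x') = comult Q x \<oplus>\<^bsub>tensor K Q Q\<^esub> comult Q x'"
      using y by (simp add: lin_add[OF q])
  next
    fix a x assume a: "a \<in> carrier K" and "x \<in> carrier Q"
    then obtain y where y: "y \<in> carrier P" "x = q y" unfolding surj by blast
    then have "comult Q (q (a \<odot>\<^bsub>P\<^esub> y)) = a \<odot>\<^bsub>tensor K Q Q\<^esub> comult Q (q y)"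
      using a by (simp add: cm lin_smult[OF coalgebra.comult_linear[OF P]] lin_smult[OF tl] cc)
    then show "comult Q (a \<odot>\<^bsub>Q\<^esub> x) = a \<odot>\<^bsub>tensor K Q Q\<^esub> comult Q x"
      using y a by (simp add: lin_smult[OF q])
  qed
  have cul: "lin Q scalars (counit Q)"
  proof (rule linI)
    fix x assume "x \<in> carrier Q"
    then show "counit Q x \<in> carrier scalars" unfolding surj using cu coalgebra.counit_closed[OF P] by auto
  next
    fix x x' assume "x \<in> carrier Q" "x' \<in> carrier Q"
    then obtain y y' where y: "y \<in> carrier P" "x = q y" "y' \<in> carrier P" "x' = q y'" unfolding surj by blast
    then have "counit Q (q (y \<oplus>\<^bsub>P\<^esub> y')) = counit Q (q y) \<oplus> counit Q (q y')"
      by (simp add: cu coalgebra.counit_add[OF P])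
    then show "counit Q (x \<oplus>\<^bsub>Q\<^esub> x') = counit Q x \<oplus>\<^bsub>scalars\<^esub> counit Q x'"
      using y by (simp add: lin_add[OF q])
  next
    fix a x assume a: "a \<in> carrier K" and "x \<in> carrier Q"
    then obtain y where y: "y \<in> carrier P" "x = q y" unfolding surj by blast
    then have "counit Q (q (a \<odot>\<^bsub>P\<^esub> y)) = a \<otimes> counit Q (q y)"
      using a by (simp add: cu coalgebra.counit_smult[OF P])
    then show "counit Q (a \<odot>\<^bsub>Q\<^esub> x) = a \<odot>\<^bsub>scalars\<^esub> counit Q x"
      using y a by (simp add: lin_smult[OF q])
  qed
  have qc: "q x \<in> carrier Q" if "x \<in> carrier P" for x by (rule lin_closed[OF q that])
  have ccQ: "comult Q x \<in> carrier (tensor K Q Q)" if "x \<in> carrier Q" for x by (rule lin_closed[OF cl that])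
  have cuc: "counit Q x \<in> carrier K" if "x \<in> carrier Q" for x using lin_closed[OF cul that] by simp
  show "coalgebra K Q"
  proof (intro coalgebra.intro coalgebra_axioms.intro field_axioms Q cl)
    fix c assume "c \<in> carrier Q" then show "counit Q c \<in> carrier K" by (rule cuc)
  next
    fix c d assume "c \<in> carrier Q" "d \<in> carrier Q"
    then show "counit Q (c \<oplus>\<^bsub>Q\<^esub> d) = counit Q c \<oplus> counit Q d" using lin_add[OF cul] by simp
  next
    fix a c assume "a \<in> carrier K" "c \<in> carrier Q"
    then show "counit Q (a \<odot>\<^bsub>Q\<^esub> c) = a \<otimes> counit Q c" using lin_smult[OF cul] by simp
  next
    fix c assume "c \<in> carrier Q"
    then obtain x where x: "x \<in> carrier P" "c = q x" unfolding surj by blast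
    have b: "bilin Q Q Q (\<lambda>c1 c2. counit Q c1 \<odot>\<^bsub>Q\<^esub> c2)"
      by (assumption | rule Q cul cuc lin_app[OF cul] lins)+
    have b': "bilin P P P (\<lambda>c1 c2. counit P c1 \<odot>\<^bsub>P\<^esub> c2)"
      by (assumption | rule V P lins)+
    have "tsum K Q (comult Q c) (\<lambda>c1 c2. counit Q c1 \<odot>\<^bsub>Q\<^esub> c2) = tsum K Q (comult P x) (\<lambda>c1 c2. counit Q (q c1) \<odot>\<^bsub>Q\<^esub> q c2)"
      unfolding x(2) by (rule ts[OF b Q x(1)])
    also have "\<dots> = tsum K Q (comult P x) (\<lambda>c1 c2. q (counit P c1 \<odot>\<^bsub>P\<^esub> c2))"
      by (rule tsum_cong[OF cc[OF x(1)] bilin_precomp[OF b q q] _ V V Q])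
        (simp add: cu lin_smult[OF q] coalgebra.counit_closed[OF P])
    also have "\<dots> = q (tsum K P (comult P x) (\<lambda>c1 c2. counit P c1 \<odot>\<^bsub>P\<^esub> c2))"
      by (rule tsum_hom[OF cc[OF x(1)] q b' V V V Q, symmetric])
    finally show "tsum K Q (comult Q c) (\<lambda>c1 c2. counit Q c1 \<odot>\<^bsub>Q\<^esub> c2) = c"
      by (simp add: coalgebra.counit_left[OF P x(1)] x(2))
    have b: "bilin Q Q Q (\<lambda>c1 c2. counit Q c2 \<odot>\<^bsub>Q\<^esub> c1)"
      by (assumption | rule Q cul cuc lin_app[OF cul] lins)+
    have b': "bilin P P P (\<lambda>c1 c2. counit P c2 \<odot>\<^bsub>P\<^esub> c1)"
      by (assumption | rule V P lins)+
    have "tsum K Q (comult Q c) (\<lambda>c1 c2. counit Q c2 \<odot>\<^bsub>Q\<^esub> c1) = tsum K Q (comult P x) (\<lambda>c1 c2. counit Q (q c2) \<odot>\<^bsub>Q\<^esub> q c1)"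
      unfolding x(2) by (rule ts[OF b Q x(1)])
    also have "\<dots> = tsum K Q (comult P x) (\<lambda>c1 c2. q (counit P c2 \<odot>\<^bsub>P\<^esub> c1))"
      by (rule tsum_cong[OF cc[OF x(1)] bilin_precomp[OF b q q] _ V V Q])
        (simp add: cu lin_smult[OF q] coalgebra.counit_closed[OF P])
    also have "\<dots> = q (tsum K P (comult P x) (\<lambda>c1 c2. counit P c2 \<odot>\<^bsub>P\<^esub> c1))"
      by (rule tsum_hom[OF cc[OF x(1)] q b' V V V Q, symmetric])
    finally show "tsum K Q (comult Q c) (\<lambda>c1 c2. counit Q c2 \<odot>\<^bsub>Q\<^esub> c1) = c"
      by (simp add: coalgebra.counit_right[OF P x(1)] x(2))
    let ?T = "tensor3 K Q Q Q" and ?p = "ptensor3 K Q Q Q"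
    have T: "vs ?T" by (rule tensor_vs[OF Q QQ])
    have i1: "bilin Q Q ?T (\<lambda>c2 c3. ?p a c2 c3)" if "a \<in> carrier Q" for a
      using that by - (assumption | rule Q QQ lins)+
    have i2: "bilin Q Q ?T (\<lambda>c1 c2. ?p c1 c2 a)" if "a \<in> carrier Q" for a
      using that by - (assumption | rule Q QQ lins)+
    have B1: "bilin Q Q ?T (\<lambda>c1 c'. tsum K ?T (comult Q c') (\<lambda>c2 c3. ?p c1 c2 c3))"
      by (assumption | rule Q QQ T ccQ i1 lin_app[OF cl] lins)+
    have B2: "bilin Q Q ?T (\<lambda>c' c3. tsum K ?T (comult Q c') (\<lambda>c1 c2. ?p c1 c2 c3))"
      by (assumption | rule Q QQ T ccQ i2 lin_app[OF cl] lins)+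
    have "tsum K ?T (comult Q c) (\<lambda>c1 c'. tsum K ?T (comult Q c') (\<lambda>c2 c3. ?p c1 c2 c3)) =
      tsum K ?T (comult P x) (\<lambda>c1 c'. tsum K ?T (comult Q (q c')) (\<lambda>c2 c3. ?p (q c1) c2 c3))"
      unfolding x(2) by (rule ts[OF B1 T x(1)])
    also have "\<dots> = tsum K ?T (comult P x) (\<lambda>c1 c'. tsum K ?T (comult P c') (\<lambda>c2 c3. ?p (q c1) (q c2) (q c3)))"
      by (rule tsum_cong[OF cc[OF x(1)] bilin_precomp[OF B1 q q] _ V V T], rule ts[OF i1 T]) (simp_all add: qc)
    also have "\<dots> = tsum K ?T (comult P x) (\<lambda>c' c3. tsum K ?T (comult P c') (\<lambda>c1 c2. ?p (q c1) (q c2) (q c3)))"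
      by (rule coassoc_tsum[OF P T x(1)])
        (assumption | rule Q QQ qc lin_app[OF q] lins)+
    also have "\<dots> = tsum K ?T (comult P x) (\<lambda>c' c3. tsum K ?T (comult Q (q c')) (\<lambda>c1 c2. ?p c1 c2 (q c3)))"
      by (rule tsum_cong[OF cc[OF x(1)] bilin_precomp[OF B2 q q] _ V V T, symmetric], rule ts[OF i2 T]) (simp_all add: qc)
    also have "\<dots> = tsum K ?T (comult Q c) (\<lambda>c' c3. tsum K ?T (comult Q c') (\<lambda>c1 c2. ?p c1 c2 c3))"
      unfolding x(2) by (rule ts[OF B2 T x(1), symmetric])
    finally show "tsum K ?T (comult Q c) (\<lambda>c1 c'. tsum K ?T (comult Q c') (\<lambda>c2 c3. ?p c1 c2 c3)) = \<dots>" .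
  qed
qed

text \<open>By \<open>mult\<close>, contracting the comultiplication of a point of the common kernel
  \<open>N\<close> with two members of the family gives zero. This makes \<open>N\<close> a coideal,
  so \<open>(q \<otimes> q) \<circ> \<Delta>\<close> depends on \<open>q x\<close> only; the counit
  descends because it belongs to the family.\<close>

lemma coideal_quotient:
  fixes P :: "('k, 'c) coalgebra"
  assumes P: "coalgebra K P" and \<A>: "\<And>\<alpha>. \<alpha> \<in> \<A> \<Longrightarrow> lin P scalars \<alpha>"
    and counit: "counit P \<in> \<A>"
    and mult: "\<And>\<alpha> \<beta> x. \<lbrakk>\<alpha> \<in> \<A>; \<beta> \<in> \<A>; x \<in> carrier P; \<And>\<gamma>. \<gamma> \<in> \<A> \<Longrightarrow> \<gamma> x = \<zero>\<rbrakk> \<Longrightarrow> conv P scalars \<alpha> \<beta> x = \<zero>"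
  obtains Q :: "('k, 'c) coalgebra" and q where "coalgebra K Q" "coalgebra_map K P Q q"
    "carrier Q = q ` carrier P" "lin Q P (\<lambda>x. x)" "zero Q = zero P"
    "\<And>x. \<lbrakk>x \<in> carrier P; \<forall>\<alpha>\<in>\<A>. \<alpha> x = \<zero>\<rbrakk> \<Longrightarrow> q x = \<zero>\<^bsub>P\<^esub>"
    "\<And>x. x \<in> carrier P \<Longrightarrow> \<exists>y\<in>carrier P. x = q x \<oplus>\<^bsub>P\<^esub> y \<and> (\<forall>\<alpha>\<in>\<A>. \<alpha> y = \<zero>)"
proof -
  note V = coalgebra_vs[OF P]
  interpret P: module K P by (rule V)
  define N where "N = {x \<in> carrier P. \<forall>\<alpha>\<in>\<A>. \<alpha> x = \<zero>}"
  have N: "submodule N K P" unfolding N_def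
    using submodule_common_kernel[OF V scalars_vs \<A>] by simp
  obtain r where r: "lin P P r" "\<And>v. v \<in> carrier P \<Longrightarrow> r v \<in> N" "\<And>x. x \<in> N \<Longrightarrow> r x = x"
    by (rule projection_exists[OF V N], rule that)
  define q where "q x = x \<ominus>\<^bsub>P\<^esub> r x" for x
  have rc: "v \<in> carrier P \<Longrightarrow> r v \<in> carrier P" for v using lin_closed[OF r(1)] .
  have ql: "lin P P q" unfolding q_def by (rule lin_minus_fun[OF lin_id r(1) V])
  have qc: "q x \<in> carrier P" if "x \<in> carrier P" for x by (rule lin_closed[OF ql that])
  have qN: "q x = \<zero>\<^bsub>P\<^esub>" if "x \<in> N" for x
    using that r(3) by (simp add: q_def a_minus_def[of P] P.r_neg N_def)
  have dec: "x = q x \<oplus>\<^bsub>P\<^esub> r x" if "x \<in> carrier P" for x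
    using that rc by (simp add: q_def a_minus_def P.a_assoc P.l_neg)
  have rz: "\<alpha> (r x) = \<zero>" if "x \<in> carrier P" "\<alpha> \<in> \<A>" for x \<alpha>
    using r(2)[OF that(1)] that(2) unfolding N_def by blast
  have qq: "q (q x) = q x" if x: "x \<in> carrier P" for x
    using lin_add[OF ql qc[OF x] rc[OF x]] dec[OF x] qN[OF r(2)[OF x]] qc[OF qc[OF x]] by simp
  have aq: "\<alpha> (q x) = \<alpha> x" if "x \<in> carrier P" "\<alpha> \<in> \<A>" for x \<alpha>
    using lin_add[OF \<A>[OF that(2)] qc[OF that(1)] rc[OF that(1)]] dec[OF that(1)] rz[OF that]
      lin_closed[OF \<A>[OF that(2)] qc[OF that(1)]] by simp
  \<comment> \<open>\<open>Q0\<close> fixes the module structure first: the tensor square in which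
    the comultiplication of \<open>Q\<close> takes its values has to be available before that
    comultiplication is defined.\<close>
  define Q0 where "Q0 = P\<lparr>carrier := q ` carrier P\<rparr>"
  define Q where "Q = Q0\<lparr>comult := \<lambda>y. tmap Q0 Q0 q q (comult P y)\<rparr>"
  have Qs: "carrier Q0 = q ` carrier P" "carrier Q = q ` carrier P" "add Q0 = add P" "add Q = add P"
    "zero Q0 = zero P" "zero Q = zero P" "smult Q0 = smult P" "smult Q = smult P" "counit Q = counit P"
    "comult Q = (\<lambda>y. tmap Q0 Q0 q q (comult P y))"
    by (simp_all add: Q_def Q0_def)
  have TQ: "tensor K Q Q = tensor K Q0 Q0" "ptensor K Q Q = ptensor K Q0 Q0"
    by (simp_all add: tensor_def ptensor_def tensor_null_def bilinear_relations_def Qs fun_eq_iff)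
  have Q0V: "vs Q0" unfolding Q0_def by (rule submodule.submodule_is_module[OF submodule_image[OF V V ql] V])
  have QV: "vs Q"
    using Q0V by (simp add: Q_def module_def module_axioms_def abelian_group_def abelian_group_axioms_def
      abelian_monoid_def comm_group_def)
  have ql0: "lin P Q0 q" and qlQ: "lin P Q q" and il: "lin Q0 P (\<lambda>x. x)" and ilQ: "lin Q P (\<lambda>x. x)"
    using lin_add[OF ql] lin_smult[OF ql] qc by (auto intro!: linI simp: Qs)
  note cc = comult_closed[OF _ P] and tl = tmap_lin[OF V V Q0V Q0V ql0 ql0]
  \<comment> \<open>A point of the complement killed by the whole family lies in \<open>N\<close>,
    where \<open>q\<close> vanishes, and it is also fixed by \<open>q\<close>.\<close>
  have sep: "separating Q0 \<A>"
    unfolding separating_def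
  proof (intro conjI ballI impI)
    fix \<alpha> assume "\<alpha> \<in> \<A>"
    then show "lin Q0 scalars \<alpha>" using lin_comp[OF il \<A>] by blast
  next
    fix y assume y: "y \<in> carrier Q0" and z: "\<forall>\<alpha>\<in>\<A>. \<alpha> y = \<zero>"
    obtain x where x: "x \<in> carrier P" "y = q x" using y Qs by auto
    then have "y \<in> N" using z qc unfolding N_def by blast
    then have "q y = \<zero>\<^bsub>P\<^esub>" by (rule qN)
    then show "y = \<zero>\<^bsub>Q0\<^esub>" using qq[OF x(1)] x(2) by (simp add: Qs)
  qed
  \<comment> \<open>Contracting the second leg with \<open>\<beta>\<close> leaves
    \<open>q ?y\<close>, where \<open>?y\<close> is the contraction of the comultiplication of
    \<open>n\<close>. Each \<open>\<alpha> ?y\<close> is a convolution product evaluated at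
    \<open>n\<close>, hence zero, so \<open>?y\<close> is again in \<open>N\<close>.\<close>
  have coideal: "tmap Q0 Q0 q q (comult P n) = \<zero>\<^bsub>tensor K Q0 Q0\<^esub>" if n: "n \<in> N" for n
  proof (rule tensor_eq_zeroI[OF Q0V Q0V sep])
    have nP: "n \<in> carrier P" using n by (simp add: N_def)
    show "tmap Q0 Q0 q q (comult P n) \<in> carrier (tensor K Q0 Q0)" by (rule lin_closed[OF tl cc[OF nP]])
    fix \<beta> assume \<beta>: "\<beta> \<in> \<A>"
    note b = functional_slice_bilin'[OF Q0V Q0V lin_comp[OF il \<A>[OF \<beta>]]]
      and b' = functional_slice_bilin'[OF V V \<A>[OF \<beta>]]
    have bc: "\<beta> x \<in> carrier K" if "x \<in> carrier P" for x using lin_closed[OF \<A>[OF \<beta>] that] by simp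
    let ?y = "tsum K P (comult P n) (\<lambda>v w. \<beta> w \<odot>\<^bsub>P\<^esub> v)"
    have y: "?y \<in> carrier P" by (rule lin_closed[OF tsum_lin[OF V V V b'] cc[OF nP]])
    have "\<alpha> ?y = \<zero>" if \<alpha>: "\<alpha> \<in> \<A>" for \<alpha>
    proof -
      note al = \<A>[OF \<alpha>]
      have "\<alpha> ?y = tsum K scalars (comult P n) (\<lambda>v w. \<alpha> (\<beta> w \<odot>\<^bsub>P\<^esub> v))"
        by (rule tsum_hom[OF cc[OF nP] al b' V V V scalars_vs])
      also have "\<dots> = tsum K scalars (comult P n) (\<lambda>v w. \<alpha> v \<otimes>\<^bsub>scalars\<^esub> \<beta> w)"
        using lin_closed[OF al]
        by (intro tsum_cong[OF cc[OF nP] bilin_comp[OF b' al] _ V V scalars_vs]) (simp add: bc lin_smult[OF al] m_comm)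
      also have "\<dots> = conv P scalars \<alpha> \<beta> n" by (rule conv_apply[OF nP, symmetric])
      also have "\<dots> = \<zero>" by (rule mult[OF \<alpha> \<beta> nP]) (use n in \<open>unfold N_def, blast\<close>)
      finally show ?thesis .
    qed
    then have "?y \<in> N" using y unfolding N_def by blast
    then have qy: "q ?y = \<zero>\<^bsub>P\<^esub>" by (rule qN)
    have "tsum K Q0 (tmap Q0 Q0 q q (comult P n)) (\<lambda>v w. \<beta> w \<odot>\<^bsub>Q0\<^esub> v) =
      tsum K Q0 (comult P n) (\<lambda>v w. \<beta> (q w) \<odot>\<^bsub>Q0\<^esub> q v)"
      by (rule tsum_tmap[OF V V Q0V Q0V ql0 ql0 b Q0V cc[OF nP]])
    also have "\<dots> = tsum K Q0 (comult P n) (\<lambda>v w. q (\<beta> w \<odot>\<^bsub>P\<^esub> v))"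
      by (rule tsum_cong[OF cc[OF nP] bilin_precomp[OF b ql0 ql0] _ V V Q0V])
        (simp add: aq \<beta> Qs bc lin_smult[OF ql])
    also have "\<dots> = q ?y" by (rule tsum_hom[OF cc[OF nP] ql0 b' V V V Q0V, symmetric])
    finally show "tsum K Q0 (tmap Q0 Q0 q q (comult P n)) (\<lambda>v w. \<beta> w \<odot>\<^bsub>Q0\<^esub> v) = \<zero>\<^bsub>Q0\<^esub>"
      using qy by (simp add: Qs)
  qed
  interpret QQ: module K "tensor K Q0 Q0" by (rule tensor_vs[OF Q0V Q0V])
  \<comment> \<open>\<open>x\<close> and \<open>q x\<close> differ by \<open>r x\<close>, a point of
    \<open>N\<close>, to which the coideal property applies.\<close>
  have cmQ: "comult Q (q x) = tmap Q Q q q (comult P x)" if x: "x \<in> carrier P" for x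
  proof -
    have "tmap Q0 Q0 q q (comult P x) = tmap Q0 Q0 q q (comult P (q x)) \<oplus>\<^bsub>tensor K Q0 Q0\<^esub> tmap Q0 Q0 q q (comult P (r x))"
      using x by (subst dec[OF x]) (simp add: lin_add[OF coalgebra.comult_linear[OF P]] lin_add[OF tl] cc qc rc)
    then have "tmap Q0 Q0 q q (comult P x) = tmap Q0 Q0 q q (comult P (q x))"
      using coideal[OF r(2)[OF x]] lin_closed[OF tl cc[OF qc[OF x]]] by simp
    moreover have "tmap Q Q q q = tmap Q0 Q0 q q" by (simp add: tmap_def fun_eq_iff TQ)
    ultimately show ?thesis by (simp add: Qs)
  qed
  have cuQ: "counit Q (q x) = counit P x" if x: "x \<in> carrier P" for x
    using aq[OF x counit] by (simp add: Qs)
  have "coalgebra K Q" "coalgebra_map K P Q q"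
    by (rule quotient_coalgebra[OF P QV qlQ Qs(2) cmQ cuQ]; assumption)+
  moreover have "q x = \<zero>\<^bsub>P\<^esub>" if "x \<in> carrier P" "\<forall>\<alpha>\<in>\<A>. \<alpha> x = \<zero>" for x
    using that by (intro qN) (unfold N_def, blast)
  moreover have "\<exists>y\<in>carrier P. x = q x \<oplus>\<^bsub>P\<^esub> y \<and> (\<forall>\<alpha>\<in>\<A>. \<alpha> y = \<zero>)" if "x \<in> carrier P" for x
    using dec[OF that] rc[OF that] rz[OF that] by blast
  ultimately show ?thesis using that Qs(2,6) ilQ by blast
qed

subsection \<open>Subcoalgebras\<close>

text \<open>The tensor product sees only the module fields, so the comultiplication put on the
  restriction does not affect it.\<close>

lemma tensor_carrier_update:
  "tensor K (V\<lparr>carrier := X\<rparr>) (V\<lparr>carrier := X\<rparr>) = tensor K (restrict_coalgebra K V X) (restrict_coalgebra K V X)"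
  by (simp add: tensor_def tensor_null_def bilinear_relations_def restrict_coalgebra_def)

lemma restrict_coalgebra_simps [simp]:
  "carrier (restrict_coalgebra K D X) = X" "add (restrict_coalgebra K D X) = add D"
  "zero (restrict_coalgebra K D X) = zero D" "smult (restrict_coalgebra K D X) = smult D"
  "counit (restrict_coalgebra K D X) = counit D"
  by (simp_all add: restrict_coalgebra_def)

lemma subcoalgebraD:
  assumes "subcoalgebra K D X"
  shows "submodule X K D"
    "\<And>x. x \<in> X \<Longrightarrow> comult D x \<in> tensor_incl K D ` carrier (tensor K (restrict_coalgebra K D X) (restrict_coalgebra K D X))"
  using assms by (auto simp: subcoalgebra_def tensor_carrier_update)

lemma restrict_coalgebra_vs:
  assumes D: "vs D" and X: "submodule X K D"
  shows "vs (restrict_coalgebra K D X)"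
proof -
  have "vs (D\<lparr>carrier := X\<rparr>)" by (rule submodule.submodule_is_module[OF X D])
  then show ?thesis
    by (simp add: restrict_coalgebra_def module_def module_axioms_def abelian_group_def abelian_group_axioms_def
      abelian_monoid_def comm_group_def)
qed

context
  fixes D :: "('k, 'a) coalgebra" and X
  assumes D: "vs D" and X: "submodule X K D"
begin

abbreviation (input) "R \<equiv> restrict_coalgebra K D X"

interpretation D: module K D by (rule D)

lemma R_vs: "vs R" by (rule restrict_coalgebra_vs[OF D X])

lemma sub_carrier: "x \<in> X \<Longrightarrow> x \<in> carrier D"
  using D.submoduleE(1)[OF X] by blast

lemma incl_lin: "lin R D (\<lambda>x. x)"
  by (rule linI) (auto simp: sub_carrier)

lemma lin_restrict_coalgebra: "lin D U f \<Longrightarrow> lin R U f"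
  by (rule lin_comp[OF incl_lin])

lemma tensor_incl_tmap: "tensor_incl K D = tmap D D (\<lambda>x. x) (\<lambda>x. x)"
  by (auto simp: tensor_incl_def tmap_def)

lemma retraction_exists:
  obtains r where "lin D R r" "\<And>x. x \<in> X \<Longrightarrow> r x = x"
proof -
  obtain r where r: "lin D D r" "\<And>v. v \<in> carrier D \<Longrightarrow> r v \<in> X" "\<And>x. x \<in> X \<Longrightarrow> r x = x"
    by (rule projection_exists[OF D X], rule that)
  have "lin D R r" by (rule linI) (simp_all add: r(2) lin_add[OF r(1)] lin_smult[OF r(1)])
  then show ?thesis using r(3) that by blast
qed

lemma tensor_incl_lin: "lin (tensor K R R) (tensor K D D) (tensor_incl K D)"
  unfolding tensor_incl_tmap by (rule tmap_lin[OF R_vs R_vs D D incl_lin incl_lin])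

text \<open>A linear retraction \<open>r\<close> onto \<open>X\<close> yields the left inverse
  \<open>r \<otimes> r\<close> of the inclusion of tensor squares. Its injectivity is what makes the
  pulled back comultiplication of a restriction unique.\<close>

lemma tensor_incl_retract:
  assumes r: "lin D R r" "\<And>x. x \<in> X \<Longrightarrow> r x = x" and t: "t \<in> carrier (tensor K R R)"
  shows "tmap R R r r (tensor_incl K D t) = t"
proof -
  note V = R_vs R_vs and RR = tensor_vs[OF R_vs R_vs]
  have "tmap R R r r (tensor_incl K D t) = tsum K (tensor K R R) t (\<lambda>v w. ptensor K R R (r v) (r w))"
    unfolding tensor_incl_tmap tmap_def[of R R]
    by (rule tsum_tmap[OF V D D incl_lin incl_lin tmap_bilin[OF D D V r(1) r(1)] RR t])
  also have "\<dots> = tsum K (tensor K R R) t (ptensor K R R)"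
    by (rule tsum_cong[OF t ptensor_bilin[OF V] _ V RR, symmetric]) (simp add: r(2))
  also have "\<dots> = t" by (rule tsum_id[OF t V])
  finally show ?thesis .
qed

lemma tensor_incl_inj:
  "t \<in> carrier (tensor K R R) \<Longrightarrow> s \<in> carrier (tensor K R R) \<Longrightarrow> tensor_incl K D t = tensor_incl K D s \<Longrightarrow> t = s"
proof -
  assume ts: "t \<in> carrier (tensor K R R)" "s \<in> carrier (tensor K R R)" "tensor_incl K D t = tensor_incl K D s"
  obtain r where r: "lin D R r" "\<And>x. x \<in> X \<Longrightarrow> r x = x" by (rule retraction_exists, rule that)
  have "t = tmap R R r r (tensor_incl K D t)" by (rule tensor_incl_retract[OF r ts(1), symmetric])
  also have "\<dots> = tmap R R r r (tensor_incl K D s)" by (simp only: ts(3))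
  also have "\<dots> = s" by (rule tensor_incl_retract[OF r ts(2)])
  finally show ?thesis .
qed

lemma restrict_comult_eqI:
  assumes "t \<in> carrier (tensor K R R)" "tensor_incl K D t = comult D x"
  shows "comult R x = t"
proof -
  have "comult R x = (THE t. t \<in> carrier (tensor K R R) \<and> tensor_incl K D t = comult D x)"
    unfolding tensor_carrier_update[symmetric] by (simp add: restrict_coalgebra_def)
  also have "\<dots> = t"
  proof (rule the_equality)
    show "t \<in> carrier (tensor K R R) \<and> tensor_incl K D t = comult D x" using assms by simp
  next
    fix s assume "s \<in> carrier (tensor K R R) \<and> tensor_incl K D s = comult D x"
    then show "s = t" using assms by (elim conjE) (rule tensor_incl_inj, simp_all)
  qed
  finally show ?thesis .
qed

end

context
  fixes D :: "('k, 'a) coalgebra" and X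
  assumes D: "coalgebra K D" and X: "subcoalgebra K D X"
begin

abbreviation (input) "R' \<equiv> restrict_coalgebra K D X"

lemmas D_module = coalgebra_vs[OF D]
lemmas X_submodule = subcoalgebraD(1)[OF X]
lemmas restrict_module = R_vs[OF D_module X_submodule]

lemma restrict_comult:
  assumes "x \<in> X"
  shows "comult R' x \<in> carrier (tensor K R' R')" "tensor_incl K D (comult R' x) = comult D x"
  using subcoalgebraD(2)[OF X assms] restrict_comult_eqI[OF D_module X_submodule] by auto

text \<open>For a summand bilinear on all of \<open>D\<close>, the sum sees the restricted
  comultiplication only through its inclusion into the tensor square of \<open>D\<close>.\<close>

lemma restrict_tsum:
  assumes x: "x \<in> X" and b: "bilin D D U \<beta>" and U: "vs U"
  shows "tsum K U (comult R' x) \<beta> = tsum K U (comult D x) \<beta>"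
  unfolding restrict_comult(2)[OF x, symmetric] tensor_incl_tmap[OF D_module X_submodule]
  by (rule tsum_tmap[OF restrict_module restrict_module D_module D_module incl_lin[OF D_module X_submodule] incl_lin[OF D_module X_submodule] b U restrict_comult(1)[OF x], symmetric])

text \<open>Triple tensors of \<open>X\<close> make sense on \<open>X\<close> only, so
  coassociativity of \<open>D\<close> does not apply to them directly. Inserting the retraction
  \<open>r\<close>, which is the identity on \<open>X\<close>, extends the summands to
  \<open>D\<close>, and \<open>restrict_tsum\<close> then allows passing to \<open>D\<close> and
  back.\<close>

lemma restrict_coalgebra: "coalgebra K R'"
proof -
  note [simp] = sub_carrier[OF D_module X_submodule]
  obtain r where r: "lin D R' r" "\<And>x. x \<in> X \<Longrightarrow> r x = x" by (rule retraction_exists[OF D_module X_submodule], rule that)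
  have rc: "r x \<in> X" if "x \<in> carrier D" for x using lin_closed[OF r(1) that] by simp
  note RR = tensor_vs[OF restrict_module restrict_module]
  have cmr: "comult R' x = tmap R' R' r r (comult D x)" if "x \<in> X" for x
    using tensor_incl_retract[OF D_module X_submodule r restrict_comult(1)[OF that]] restrict_comult(2)[OF that] by simp
  have cl: "lin R' (tensor K R' R') (comult R')"
  proof (rule lin_cong[OF _ restrict_module])
    show "lin R' (tensor K R' R') (\<lambda>x. tmap R' R' r r (comult D x))"
      by (rule lin_comp[OF lin_restrict_coalgebra[OF D_module X_submodule coalgebra.comult_linear[OF D]] tmap_lin[OF D_module D_module restrict_module restrict_module r(1) r(1)]])
  qed (simp add: cmr)
  have il: "lin R' D (\<lambda>x. x)" by (rule incl_lin[OF D_module X_submodule])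
  have iccl: "lin R' scalars (counit D)" by (rule lin_restrict_coalgebra[OF D_module X_submodule counit_lin[OF D]])
  have iccc: "counit D x \<in> carrier K" if "x \<in> carrier R'" for x using lin_closed[OF iccl that] by simp
  show ?thesis
  proof (intro coalgebra.intro coalgebra_axioms.intro field_axioms restrict_module cl)
    fix c assume c: "c \<in> carrier R'"
    then show "counit R' c \<in> carrier K" by (simp add: coalgebra.counit_closed[OF D])
    have cX: "c \<in> X" using c by simp
    have b: "bilin R' R' R' (\<lambda>c1 c2. counit D c1 \<odot>\<^bsub>R'\<^esub> c2)"
      by (assumption | rule restrict_module iccl iccc lin_app[OF iccl] lins)+
    have "tsum K R' (comult R' c) (\<lambda>c1 c2. counit D c1 \<odot>\<^bsub>R'\<^esub> c2) = tsum K D (comult R' c) (\<lambda>c1 c2. counit D c1 \<odot>\<^bsub>R'\<^esub> c2)"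
      by (rule tsum_hom[OF restrict_comult(1)[OF cX] il b restrict_module restrict_module restrict_module D_module])
    also have "\<dots> = tsum K D (comult D c) (\<lambda>c1 c2. counit D c1 \<odot>\<^bsub>D\<^esub> c2)"
      unfolding restrict_coalgebra_simps
      by (rule restrict_tsum[OF cX _ D_module]) (assumption | rule D_module D lins)+
    finally show "tsum K R' (comult R' c) (\<lambda>c1 c2. counit R' c1 \<odot>\<^bsub>R'\<^esub> c2) = c"
      using cX by (simp add: coalgebra.counit_left[OF D])
    have b: "bilin R' R' R' (\<lambda>c1 c2. counit D c2 \<odot>\<^bsub>R'\<^esub> c1)"
      by (assumption | rule restrict_module iccl iccc lin_app[OF iccl] lins)+
    have "tsum K R' (comult R' c) (\<lambda>c1 c2. counit D c2 \<odot>\<^bsub>R'\<^esub> c1) = tsum K D (comult R' c) (\<lambda>c1 c2. counit D c2 \<odot>\<^bsub>R'\<^esub> c1)"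
      by (rule tsum_hom[OF restrict_comult(1)[OF cX] il b restrict_module restrict_module restrict_module D_module])
    also have "\<dots> = tsum K D (comult D c) (\<lambda>c1 c2. counit D c2 \<odot>\<^bsub>D\<^esub> c1)"
      unfolding restrict_coalgebra_simps
      by (rule restrict_tsum[OF cX _ D_module]) (assumption | rule D_module D lins)+
    finally show "tsum K R' (comult R' c) (\<lambda>c1 c2. counit R' c2 \<odot>\<^bsub>R'\<^esub> c1) = c"
      using cX by (simp add: coalgebra.counit_right[OF D])
    let ?T = "tensor3 K R' R' R'" and ?p = "ptensor3 K R' R' R'"
    have T: "vs ?T" by (rule tensor_vs[OF restrict_module RR])
    have i1: "bilin R' R' ?T (\<lambda>c2 c3. ?p a c2 c3)" if "a \<in> carrier R'" for a
      using that by - (assumption | rule restrict_module RR lins)+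
    have i2: "bilin R' R' ?T (\<lambda>c1 c2. ?p c1 c2 a)" if "a \<in> carrier R'" for a
      using that by - (assumption | rule restrict_module RR lins)+
    have ccR: "comult R' x \<in> carrier (tensor K R' R')" if "x \<in> carrier R'" for x by (rule lin_closed[OF cl that])
    have B1: "bilin R' R' ?T (\<lambda>c1 c'. tsum K ?T (comult R' c') (\<lambda>c2 c3. ?p c1 c2 c3))"
      by (assumption | rule restrict_module RR T ccR i1 lin_app[OF cl] lins)+
    have B2: "bilin R' R' ?T (\<lambda>c' c3. tsum K ?T (comult R' c') (\<lambda>c1 c2. ?p c1 c2 c3))"
      by (assumption | rule restrict_module RR T ccR i2 lin_app[OF cl] lins)+
    have rc': "r x \<in> carrier R'" if "x \<in> carrier D" for x using rc that by simp
    have j1: "bilin D D ?T (\<lambda>c2 c3. ?p (r a) (r c2) (r c3))" if "a \<in> carrier D" for a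
      using that by - (assumption | rule restrict_module RR D_module rc' lin_app[OF r(1)] lins)+
    have j2: "bilin D D ?T (\<lambda>c1 c2. ?p (r c1) (r c2) (r a))" if "a \<in> carrier D" for a
      using that by - (assumption | rule restrict_module RR D_module rc' lin_app[OF r(1)] lins)+
    have J1: "bilin D D ?T (\<lambda>c1 c'. tsum K ?T (comult D c') (\<lambda>c2 c3. ?p (r c1) (r c2) (r c3)))"
      by (assumption | rule restrict_module RR D_module T D j1 rc' lin_app[OF r(1)] lins)+
    have J2: "bilin D D ?T (\<lambda>c' c3. tsum K ?T (comult D c') (\<lambda>c1 c2. ?p (r c1) (r c2) (r c3)))"
      by (assumption | rule restrict_module RR D_module T D j2 rc' lin_app[OF r(1)] lins)+
    note rcm = restrict_comult(1)
    have "tsum K ?T (comult R' c) (\<lambda>c1 c'. tsum K ?T (comult R' c') (\<lambda>c2 c3. ?p c1 c2 c3)) =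
      tsum K ?T (comult R' c) (\<lambda>c1 c'. tsum K ?T (comult D c') (\<lambda>c2 c3. ?p (r c1) (r c2) (r c3)))"
    proof (rule tsum_cong[OF rcm[OF cX] B1 _ restrict_module restrict_module T])
      fix c1 c' assume h: "c1 \<in> carrier R'" "c' \<in> carrier R'"
      have "tsum K ?T (comult R' c') (\<lambda>c2 c3. ?p c1 c2 c3) = tsum K ?T (comult R' c') (\<lambda>c2 c3. ?p (r c1) (r c2) (r c3))"
        using h by (intro tsum_cong[OF rcm i1 _ restrict_module restrict_module T]) (simp_all add: r(2))
      also have "\<dots> = tsum K ?T (comult D c') (\<lambda>c2 c3. ?p (r c1) (r c2) (r c3))"
        using h by (intro restrict_tsum j1 T) simp_all
      finally show "tsum K ?T (comult R' c') (\<lambda>c2 c3. ?p c1 c2 c3) = \<dots>" .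
    qed
    also have "\<dots> = tsum K ?T (comult D c) (\<lambda>c1 c'. tsum K ?T (comult D c') (\<lambda>c2 c3. ?p (r c1) (r c2) (r c3)))"
      by (rule restrict_tsum[OF cX J1 T])
    also have "\<dots> = tsum K ?T (comult D c) (\<lambda>c' c3. tsum K ?T (comult D c') (\<lambda>c1 c2. ?p (r c1) (r c2) (r c3)))"
      by (rule coassoc_tsum[OF D T]) (use cX in simp, (assumption | rule restrict_module RR D_module rc' lin_app[OF r(1)] lins)+)
    also have "\<dots> = tsum K ?T (comult R' c) (\<lambda>c' c3. tsum K ?T (comult D c') (\<lambda>c1 c2. ?p (r c1) (r c2) (r c3)))"
      by (rule restrict_tsum[OF cX J2 T, symmetric])
    also have "\<dots> = tsum K ?T (comult R' c) (\<lambda>c' c3. tsum K ?T (comult R' c') (\<lambda>c1 c2. ?p c1 c2 c3))"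
    proof (rule tsum_cong[OF rcm[OF cX] B2 _ restrict_module restrict_module T, symmetric])
      fix c' c3 assume h: "c' \<in> carrier R'" "c3 \<in> carrier R'"
      have "tsum K ?T (comult R' c') (\<lambda>c1 c2. ?p c1 c2 c3) = tsum K ?T (comult R' c') (\<lambda>c1 c2. ?p (r c1) (r c2) (r c3))"
        using h by (intro tsum_cong[OF rcm i2 _ restrict_module restrict_module T]) (simp_all add: r(2))
      also have "\<dots> = tsum K ?T (comult D c') (\<lambda>c1 c2. ?p (r c1) (r c2) (r c3))"
        using h by (intro restrict_tsum j2 T) simp_all
      finally show "tsum K ?T (comult R' c') (\<lambda>c1 c2. ?p c1 c2 c3) = \<dots>" .
    qed
    finally show "tsum K ?T (comult R' c) (\<lambda>c1 c'. tsum K ?T (comult R' c') (\<lambda>c2 c3. ?p c1 c2 c3)) = \<dots>" .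
  qed (simp_all add: coalgebra.counit_add[OF D] coalgebra.counit_smult[OF D])
qed

end

text \<open>\<open>F \<otimes> F\<close>, read with values in the tensor square of the image,
  supplies preimages of the comultiplications under the inclusion. They show that the image is a
  subcoalgebra and, by uniqueness, they are its comultiplication.\<close>

lemma image_subcoalgebra:
  assumes C: "coalgebra K C" and D: "coalgebra K D" and F: "coalgebra_map K C D F"
  shows "subcoalgebra K D (F ` carrier C)" "coalgebra_map K C (restrict_coalgebra K D (F ` carrier C)) F"
proof -
  let ?X = "F ` carrier C" and ?R = "restrict_coalgebra K D (F ` carrier C)"
  interpret C: module K C by (rule coalgebra_vs[OF C])
  interpret D: module K D by (rule coalgebra_vs[OF D])
  note Fl = coalgebra_mapD(1)[OF F] and V = coalgebra_vs[OF C] coalgebra_vs[OF D]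
  have X: "submodule ?X K D" by (rule submodule_image[OF V Fl])
  note RV = R_vs[OF V(2) X]
  have Fr: "lin C ?R F" by (rule linI) (simp_all add: lin_add[OF Fl] lin_smult[OF Fl])
  have t: "tmap ?R ?R F F (comult C x) \<in> carrier (tensor K ?R ?R)" if "x \<in> carrier C" for x
    by (rule lin_closed[OF tmap_lin[OF V(1) V(1) RV RV Fr Fr] comult_closed[OF that C]])
  have i: "tensor_incl K D (tmap ?R ?R F F (comult C x)) = comult D (F x)" if x: "x \<in> carrier C" for x
  proof -
    have "tensor_incl K D (tmap ?R ?R F F (comult C x)) = tsum K (tensor K D D) (comult C x) (\<lambda>a b. ptensor K D D (F a) (F b))"
      unfolding tensor_incl_def
      by (rule tsum_tmap[OF V(1) V(1) RV RV Fr Fr _ tensor_vs[OF V(2) V(2)] comult_closed[OF x C]],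
        rule bilin_precomp[OF ptensor_bilin[OF V(2) V(2)] incl_lin[OF V(2) X] incl_lin[OF V(2) X]])
    then show ?thesis using coalgebra_mapD(3)[OF F x] by (simp add: tmap_def)
  qed
  show "subcoalgebra K D ?X"
    unfolding subcoalgebra_def tensor_carrier_update
  proof (intro conjI X ballI)
    fix y assume "y \<in> ?X"
    then obtain x where x: "x \<in> carrier C" "y = F x" by blast
    show "comult D y \<in> tensor_incl K D ` carrier (tensor K ?R ?R)"
      unfolding x(2) i[OF x(1), symmetric] by (rule imageI[OF t[OF x(1)]])
  qed
  show "coalgebra_map K C ?R F"
  proof (rule coalgebra_mapI[OF Fr])
    fix c assume c: "c \<in> carrier C"
    show "counit ?R (F c) = counit C c" using coalgebra_mapD(2)[OF F c] by simp
    show "comult ?R (F c) = tmap ?R ?R F F (comult C c)"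
      by (rule restrict_comult_eqI[OF V(2) X t[OF c] i[OF c]])
  qed
qed

subsection \<open>Sums of subcoalgebras\<close>

context
  fixes M :: "('k, 'a, 'm) module_scheme" and \<X>
  assumes M: "vs M" and sub: "\<And>X. X \<in> \<X> \<Longrightarrow> submodule X K M"
begin

interpretation M: module K M by (rule M)

lemma sum_submodules_incl: assumes "X \<in> \<X>" "x \<in> X" shows "x \<in> sum_submodules M \<X>"
proof -
  have "x \<in> carrier M" using assms sub M.submoduleE(1) by blast
  then have "x = (\<Oplus>\<^bsub>M\<^esub>Y\<in>{X}. x)" by simp
  then show ?thesis unfolding sum_submodules_def using assms
    by (intro CollectI exI[of _ "{X}"] exI[of _ "\<lambda>_. x"]) auto
qed

lemma sum_submodules_induct:
  assumes x: "x \<in> sum_submodules M \<X>"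
    and z: "P \<zero>\<^bsub>M\<^esub>" and m: "\<And>X x. X \<in> \<X> \<Longrightarrow> x \<in> X \<Longrightarrow> P x"
    and a: "\<And>x y. \<lbrakk>x \<in> carrier M; y \<in> carrier M; P x; P y\<rbrakk> \<Longrightarrow> P (x \<oplus>\<^bsub>M\<^esub> y)"
  shows "P x"
proof -
  obtain F g where F: "x = (\<Oplus>\<^bsub>M\<^esub>X\<in>F. g X)" "finite F" "F \<subseteq> \<X>" "\<forall>X\<in>F. g X \<in> X"
    using x by (auto simp: sum_submodules_def)
  have gc: "X \<in> F \<Longrightarrow> g X \<in> carrier M" for X using F sub M.submoduleE(1) by blast
  from F(2,3,4) gc have "P (\<Oplus>\<^bsub>M\<^esub>X\<in>F. g X)"
  proof (induct F)
    case empty then show ?case using z by simp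
  next
    case (insert X F)
    then have "(\<Oplus>\<^bsub>M\<^esub>X\<in>insert X F. g X) = g X \<oplus>\<^bsub>M\<^esub> (\<Oplus>\<^bsub>M\<^esub>X\<in>F. g X)" by (auto intro!: M.finsum_insert)
    moreover have "(\<Oplus>\<^bsub>M\<^esub>X\<in>F. g X) \<in> carrier M" using insert by (intro M.finsum_closed) auto
    ultimately show ?case using insert m[of X "g X"] by (auto intro!: a)
  qed
  then show ?thesis using F(1) by simp
qed

lemma sum_submodules_carrier: "x \<in> sum_submodules M \<X> \<Longrightarrow> x \<in> carrier M"
  by (erule sum_submodules_induct) (use sub M.submoduleE(1) in auto)

lemma sum_submodules_add:
  assumes "x \<in> sum_submodules M \<X>" "y \<in> sum_submodules M \<X>"
  shows "x \<oplus>\<^bsub>M\<^esub> y \<in> sum_submodules M \<X>"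
proof -
  obtain F g where F: "x = (\<Oplus>\<^bsub>M\<^esub>X\<in>F. g X)" "finite F" "F \<subseteq> \<X>" "\<forall>X\<in>F. g X \<in> X"
    using assms(1) by (auto simp: sum_submodules_def)
  obtain G h where G: "y = (\<Oplus>\<^bsub>M\<^esub>X\<in>G. h X)" "finite G" "G \<subseteq> \<X>" "\<forall>X\<in>G. h X \<in> X"
    using assms(2) by (auto simp: sum_submodules_def)
  \<comment> \<open>Both families are padded with zeros to the common index set
    \<open>F \<union> G\<close>.\<close>
  let ?g = "\<lambda>X. if X \<in> F then g X else \<zero>\<^bsub>M\<^esub>" and ?h = "\<lambda>X. if X \<in> G then h X else \<zero>\<^bsub>M\<^esub>"
  have s: "X \<in> F \<union> G \<Longrightarrow> submodule X K M" for X using F G sub by blast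
  have gX: "X \<in> F \<union> G \<Longrightarrow> ?g X \<in> X" and hX: "X \<in> F \<union> G \<Longrightarrow> ?h X \<in> X" for X
    using F(4) G(4) submodule_zero[OF M s] by auto
  have gc: "?g \<in> F \<union> G \<rightarrow> carrier M" "?h \<in> F \<union> G \<rightarrow> carrier M"
    using gX hX s M.submoduleE(1) by blast+
  have "x = (\<Oplus>\<^bsub>M\<^esub>X\<in>F \<union> G. ?g X)" unfolding F(1)
    using F G gc by (intro M.add.finprod_mono_neutral_cong_left) auto
  moreover have "y = (\<Oplus>\<^bsub>M\<^esub>X\<in>F \<union> G. ?h X)" unfolding G(1)
    using F G gc by (intro M.add.finprod_mono_neutral_cong_left) auto
  ultimately have "x \<oplus>\<^bsub>M\<^esub> y = (\<Oplus>\<^bsub>M\<^esub>X\<in>F \<union> G. ?g X \<oplus>\<^bsub>M\<^esub> ?h X)"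
    using M.finsum_addf[OF gc] by simp
  moreover have "\<forall>X\<in>F \<union> G. ?g X \<oplus>\<^bsub>M\<^esub> ?h X \<in> X" using gX hX M.submoduleE(5)[OF s] by blast
  ultimately show ?thesis unfolding sum_submodules_def using F G
    by (intro CollectI exI[of _ "F \<union> G"] exI[of _ "\<lambda>X. ?g X \<oplus>\<^bsub>M\<^esub> ?h X"]) auto
qed

lemma sum_submodules_zero: "\<zero>\<^bsub>M\<^esub> \<in> sum_submodules M \<X>"
  unfolding sum_submodules_def by (intro CollectI exI[of _ "{}"]) auto

lemma sum_submodules_submodule: "submodule (sum_submodules M \<X>) K M"
proof -
  have smult: "a \<odot>\<^bsub>M\<^esub> x \<in> sum_submodules M \<X>" if a: "a \<in> carrier K" and x: "x \<in> sum_submodules M \<X>" for a x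
    using x
  proof (rule sum_submodules_induct)
    show "a \<odot>\<^bsub>M\<^esub> \<zero>\<^bsub>M\<^esub> \<in> sum_submodules M \<X>" using a sum_submodules_zero by simp
  next
    fix X x assume "X \<in> \<X>" "x \<in> X"
    then show "a \<odot>\<^bsub>M\<^esub> x \<in> sum_submodules M \<X>" using M.submoduleE(4)[OF sub a] sum_submodules_incl by blast
  next
    fix x y assume "x \<in> carrier M" "y \<in> carrier M" "a \<odot>\<^bsub>M\<^esub> x \<in> sum_submodules M \<X>" "a \<odot>\<^bsub>M\<^esub> y \<in> sum_submodules M \<X>"
    then show "a \<odot>\<^bsub>M\<^esub> (x \<oplus>\<^bsub>M\<^esub> y) \<in> sum_submodules M \<X>"
      using a sum_submodules_add by (simp add: M.smult_r_distr)
  qed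
  show ?thesis
    by (rule submoduleI[OF M]) (auto intro: sum_submodules_zero sum_submodules_add smult sum_submodules_carrier)
qed

end

text \<open>The tensor square of a member maps into that of the sum compatibly with the inclusions
  into the tensor square of \<open>D\<close>; linearity of the comultiplication covers the remaining
  elements.\<close>

lemma sum_subcoalgebra:
  assumes D: "coalgebra K D" and sub: "\<And>X. X \<in> \<X> \<Longrightarrow> subcoalgebra K D X"
  shows "subcoalgebra K D (sum_submodules D \<X>)"
proof -
  interpret D: module K D by (rule coalgebra_vs[OF D])
  note V = coalgebra_vs[OF D]
  have subm: "X \<in> \<X> \<Longrightarrow> submodule X K D" for X using sub subcoalgebraD(1) by blast
  let ?S = "sum_submodules D \<X>"
  let ?R = "restrict_coalgebra K D ?S"
  have S: "submodule ?S K D" by (rule sum_submodules_submodule[OF V subm])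
  note RV = R_vs[OF V S]
  interpret RR: module K "tensor K ?R ?R" by (rule tensor_vs[OF RV RV])
  note il = tensor_incl_lin[OF V S] and DD = tensor_vs[OF V V] and RR = tensor_vs[OF RV RV]
  note cl = coalgebra.comult_linear[OF D]
  have "comult D x \<in> tensor_incl K D ` carrier (tensor K ?R ?R)" if x: "x \<in> ?S" for x
  proof (rule sum_submodules_induct[OF V subm x])
    show "comult D \<zero>\<^bsub>D\<^esub> \<in> tensor_incl K D ` carrier (tensor K ?R ?R)"
      using lin_zero[OF V DD cl] lin_zero[OF RR DD il] RR.zero_closed by (metis imageI)
  next
    fix X x assume X: "X \<in> \<X>" and x: "x \<in> X"
    let ?Q = "restrict_coalgebra K D X"
    note QV = R_vs[OF V subm[OF X]]
    obtain t where t: "t \<in> carrier (tensor K ?Q ?Q)" "comult D x = tensor_incl K D t"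
      using subcoalgebraD(2)[OF sub[OF X] x] by blast
    have j: "lin ?Q ?R (\<lambda>x. x)" by (rule linI) (auto intro: sum_submodules_incl[OF V subm X])
    have "tensor_incl K D (tmap ?R ?R (\<lambda>x. x) (\<lambda>x. x) t) = tensor_incl K D t"
      unfolding tensor_incl_def[of K D]
      by (rule tsum_tmap[OF QV QV RV RV j j _ DD t(1)],
        rule bilin_precomp[OF ptensor_bilin[OF V V] incl_lin[OF V S] incl_lin[OF V S]])
    moreover have "tmap ?R ?R (\<lambda>x. x) (\<lambda>x. x) t \<in> carrier (tensor K ?R ?R)"
      by (rule lin_closed[OF tmap_lin[OF QV QV RV RV j j] t(1)])
    ultimately show "comult D x \<in> tensor_incl K D ` carrier (tensor K ?R ?R)"
      unfolding t(2) by (metis imageI)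
  next
    fix x y assume xy: "x \<in> carrier D" "y \<in> carrier D"
      "comult D x \<in> tensor_incl K D ` carrier (tensor K ?R ?R)" "comult D y \<in> tensor_incl K D ` carrier (tensor K ?R ?R)"
    then obtain s t where "s \<in> carrier (tensor K ?R ?R)" "t \<in> carrier (tensor K ?R ?R)"
      "comult D x = tensor_incl K D s" "comult D y = tensor_incl K D t" by blast
    then show "comult D (x \<oplus>\<^bsub>D\<^esub> y) \<in> tensor_incl K D ` carrier (tensor K ?R ?R)"
      using xy by (intro image_eqI[of _ _ "s \<oplus>\<^bsub>tensor K ?R ?R\<^esub> t"]) (auto simp: lin_add[OF cl] lin_add[OF il])
  qed
  then show ?thesis using S by (simp add: subcoalgebra_def tensor_carrier_update)
qed

end

section \<open>Partial corepresentations on subcoalgebras and on their sums\<close>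

context vector_spaces
begin

lemma restrict_tsum2:
  fixes D :: "('k, 'a) coalgebra"
  assumes D: "coalgebra K D" and X: "subcoalgebra K D X" and x: "x \<in> X" and U: "vs U"
    and b: "\<And>a. a \<in> carrier D \<Longrightarrow> bilin D D U (\<beta> a)"
    and l: "\<And>a b. a \<in> carrier D \<Longrightarrow> b \<in> carrier D \<Longrightarrow> lin D U (\<lambda>x. \<beta> x a b)"
  shows "tsum K U (comult (restrict_coalgebra K D X) x) (\<lambda>c1 c'.
      tsum K U (comult (restrict_coalgebra K D X) c') (\<lambda>c2 c3. \<beta> c1 c2 c3)) =
    tsum K U (comult D x) (\<lambda>c1 c'. tsum K U (comult D c') (\<lambda>c2 c3. \<beta> c1 c2 c3))"
proof -
  let ?R = "restrict_coalgebra K D X"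
  note V = coalgebra_vs[OF D] and XS = subcoalgebraD(1)[OF X]
  note RV = R_vs[OF V XS] and il = incl_lin[OF V XS]
  have B: "bilin D D U (\<lambda>c1 c'. tsum K U (comult D c') (\<lambda>c2 c3. \<beta> c1 c2 c3))"
    by (assumption | rule V U D b l lins)+
  have "tsum K U (comult D x) (\<lambda>c1 c'. tsum K U (comult D c') (\<lambda>c2 c3. \<beta> c1 c2 c3)) =
    tsum K U (comult ?R x) (\<lambda>c1 c'. tsum K U (comult D c') (\<lambda>c2 c3. \<beta> c1 c2 c3))"
    by (rule restrict_tsum[OF D X x B U, symmetric])
  also have "\<dots> = tsum K U (comult ?R x) (\<lambda>c1 c'. tsum K U (comult ?R c') (\<lambda>c2 c3. \<beta> c1 c2 c3))"
  proof (rule tsum_cong[OF restrict_comult(1)[OF D X x] bilin_precomp[OF B il il] _ RV RV U])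
    fix c1 c' assume "c1 \<in> carrier ?R" "c' \<in> carrier ?R"
    then show "tsum K U (comult D c') (\<lambda>c2 c3. \<beta> c1 c2 c3) = tsum K U (comult ?R c') (\<lambda>c2 c3. \<beta> c1 c2 c3)"
      by (intro restrict_tsum[OF D X _ b U, symmetric]) (auto simp: sub_carrier[OF V XS])
  qed
  finally show ?thesis by simp
qed

end

context hopf
begin

text \<open>The axioms at a single element \<open>c\<close>. Read inside \<open>D\<close> they do
  not depend on the subcoalgebra containing \<open>c\<close>, and both sides are linear in
  \<open>c\<close>; this is how they reach the sum of all admissible subcoalgebras.\<close>

definition "corepL D \<omega> c \<longleftrightarrow>
  tsum K (tensor K H H) (comult D c) (\<lambda>c1 c2.
        tsum K (tensor K H H) (comult H (\<omega> c1)) (\<lambda>a b.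
          ptensor K H H a (b \<otimes>\<^bsub>H\<^esub> S (\<omega> c2)))) =
      tsum K (tensor K H H) (comult D c) (\<lambda>c1 c'.
        tsum K (tensor K H H) (comult D c') (\<lambda>c2 c3.
          ptensor K H H (\<omega> c1) (\<omega> c2 \<otimes>\<^bsub>H\<^esub> S (\<omega> c3))))"

definition "corepR D \<omega> c \<longleftrightarrow>
  tsum K (tensor K H H) (comult D c) (\<lambda>c1 c2.
        tsum K (tensor K H H) (comult H (\<omega> c2)) (\<lambda>a b.
          ptensor K H H (\<omega> c1 \<otimes>\<^bsub>H\<^esub> S a) b)) =
      tsum K (tensor K H H) (comult D c) (\<lambda>c1 c'.
        tsum K (tensor K H H) (comult D c') (\<lambda>c2 c3.
          ptensor K H H (\<omega> c1 \<otimes>\<^bsub>H\<^esub> S (\<omega> c2)) (\<omega> c3)))"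

lemma partial_corep_iff: "partial_corep K H D \<omega> \<longleftrightarrow> lin D H \<omega> \<and>
  (\<forall>c\<in>carrier D. counit H (\<omega> c) = counit D c \<and> corepL D \<omega> c \<and> corepR D \<omega> c)"
  unfolding partial_corep_def corepL_def corepR_def by blast

context
  fixes D :: "('k, 'd) coalgebra" and w
  assumes D: "coalgebra K D" and w: "lin D H w"
begin

lemma w_closed: "x \<in> carrier D \<Longrightarrow> w x \<in> carrier H" by (rule lin_closed[OF w])
lemma antipode_closed: "x \<in> carrier H \<Longrightarrow> S x \<in> carrier H" by (rule lin_closed[OF S_lin])

lemmas corep_rules = coalgebra_vs[OF D] H_vs HT_vs H_alg H_coalgebra D w_closed antipode_closed lin_app[OF S_lin] lin_app[OF w] lins

lemma corep_bilin1: "bilin D D (tensor K H H) (\<lambda>c1 c2. tsum K (tensor K H H) (comult H (w c1)) (\<lambda>a b.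
          ptensor K H H a (b \<otimes>\<^bsub>H\<^esub> S (w c2))))"
  by (assumption | rule corep_rules)+

lemma corep_bilin2: "bilin D D (tensor K H H) (\<lambda>c1 c2. tsum K (tensor K H H) (comult H (w c2)) (\<lambda>a b.
          ptensor K H H (w c1 \<otimes>\<^bsub>H\<^esub> S a) b))"
  by (assumption | rule corep_rules)+

lemma corep_bilin3: "a \<in> carrier D \<Longrightarrow> bilin D D (tensor K H H) (\<lambda>c2 c3. ptensor K H H (w a) (w c2 \<otimes>\<^bsub>H\<^esub> S (w c3)))"
  "c2 \<in> carrier D \<Longrightarrow> c3 \<in> carrier D \<Longrightarrow> lin D (tensor K H H) (\<lambda>a. ptensor K H H (w a) (w c2 \<otimes>\<^bsub>H\<^esub> S (w c3)))"
  by (assumption | rule corep_rules)+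

lemma corep_bilin4: "a \<in> carrier D \<Longrightarrow> bilin D D (tensor K H H) (\<lambda>c2 c3. ptensor K H H (w a \<otimes>\<^bsub>H\<^esub> S (w c2)) (w c3))"
  "c2 \<in> carrier D \<Longrightarrow> c3 \<in> carrier D \<Longrightarrow> lin D (tensor K H H) (\<lambda>a. ptensor K H H (w a \<otimes>\<^bsub>H\<^esub> S (w c2)) (w c3))"
  by (assumption | rule corep_rules)+

lemma corep_bilin5: "bilin D D (tensor K H H) (\<lambda>c1 c'. tsum K (tensor K H H) (comult D c') (\<lambda>c2 c3.
          ptensor K H H (w c1) (w c2 \<otimes>\<^bsub>H\<^esub> S (w c3))))"
  "bilin D D (tensor K H H) (\<lambda>c1 c'. tsum K (tensor K H H) (comult D c') (\<lambda>c2 c3.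
          ptensor K H H (w c1 \<otimes>\<^bsub>H\<^esub> S (w c2)) (w c3)))"
  by (assumption | rule corep_rules corep_bilin3 corep_bilin4)+

lemma corep_restrict:
  assumes X: "subcoalgebra K D X" and x: "x \<in> X"
  shows "corepL (restrict_coalgebra K D X) w x = corepL D w x"
    "corepR (restrict_coalgebra K D X) w x = corepR D w x"
proof -
  let ?R = "restrict_coalgebra K D X"
  have 3: "tsum K (tensor K H H) (comult ?R x) (\<lambda>c1 c'. tsum K (tensor K H H) (comult ?R c') (\<lambda>c2 c3.
      ptensor K H H (w c1) (w c2 \<otimes>\<^bsub>H\<^esub> S (w c3)))) =
    tsum K (tensor K H H) (comult D x) (\<lambda>c1 c'. tsum K (tensor K H H) (comult D c') (\<lambda>c2 c3.
      ptensor K H H (w c1) (w c2 \<otimes>\<^bsub>H\<^esub> S (w c3))))"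
    by (rule restrict_tsum2[OF D X x HT_vs]) (rule corep_bilin3; assumption)+
  have 4: "tsum K (tensor K H H) (comult ?R x) (\<lambda>c1 c'. tsum K (tensor K H H) (comult ?R c') (\<lambda>c2 c3.
      ptensor K H H (w c1 \<otimes>\<^bsub>H\<^esub> S (w c2)) (w c3))) =
    tsum K (tensor K H H) (comult D x) (\<lambda>c1 c'. tsum K (tensor K H H) (comult D c') (\<lambda>c2 c3.
      ptensor K H H (w c1 \<otimes>\<^bsub>H\<^esub> S (w c2)) (w c3)))"
    by (rule restrict_tsum2[OF D X x HT_vs]) (rule corep_bilin4; assumption)+
  show "corepL ?R w x = corepL D w x" "corepR ?R w x = corepR D w x"
    unfolding corepL_def corepR_def 3 4
      restrict_tsum[OF D X x corep_bilin1 HT_vs] restrict_tsum[OF D X x corep_bilin2 HT_vs]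
    by (rule refl)+
qed

lemma partial_corep_restrict_iff:
  assumes X: "subcoalgebra K D X"
  shows "partial_corep K H (restrict_coalgebra K D X) w \<longleftrightarrow>
    (\<forall>x\<in>X. counit H (w x) = counit D x \<and> corepL D w x \<and> corepR D w x)"
  unfolding partial_corep_iff
  using corep_restrict[OF X] lin_restrict_coalgebra[OF coalgebra_vs[OF D] subcoalgebraD(1)[OF X] w] by auto

lemma corep_zero: "corepL D w \<zero>\<^bsub>D\<^esub>" "corepR D w \<zero>\<^bsub>D\<^esub>"
proof -
  note V = coalgebra_vs[OF D]
  have "comult D \<zero>\<^bsub>D\<^esub> = \<zero>\<^bsub>tensor K D D\<^esub>"
    by (rule lin_zero[OF V tensor_vs[OF V V] coalgebra.comult_linear[OF D]])
  then show "corepL D w \<zero>\<^bsub>D\<^esub>" "corepR D w \<zero>\<^bsub>D\<^esub>"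
    using lin_zero[OF tensor_vs[OF V V] HT_vs tsum_lin[OF V V HT_vs corep_bilin1]]
      lin_zero[OF tensor_vs[OF V V] HT_vs tsum_lin[OF V V HT_vs corep_bilin2]]
      lin_zero[OF tensor_vs[OF V V] HT_vs tsum_lin[OF V V HT_vs corep_bilin5(1)]]
      lin_zero[OF tensor_vs[OF V V] HT_vs tsum_lin[OF V V HT_vs corep_bilin5(2)]]
    by (simp_all add: corepL_def corepR_def)
qed

lemma corep_add:
  assumes "x \<in> carrier D" "y \<in> carrier D"
  shows "corepL D w x \<Longrightarrow> corepL D w y \<Longrightarrow> corepL D w (x \<oplus>\<^bsub>D\<^esub> y)"
    "corepR D w x \<Longrightarrow> corepR D w y \<Longrightarrow> corepR D w (x \<oplus>\<^bsub>D\<^esub> y)"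
proof -
  note V = coalgebra_vs[OF D]
  have "comult D (x \<oplus>\<^bsub>D\<^esub> y) = comult D x \<oplus>\<^bsub>tensor K D D\<^esub> comult D y"
    using assms by (simp add: lin_add[OF coalgebra.comult_linear[OF D]])
  then show "corepL D w x \<Longrightarrow> corepL D w y \<Longrightarrow> corepL D w (x \<oplus>\<^bsub>D\<^esub> y)"
    "corepR D w x \<Longrightarrow> corepR D w y \<Longrightarrow> corepR D w (x \<oplus>\<^bsub>D\<^esub> y)"
    using assms comult_closed[OF _ D]
      lin_add[OF tsum_lin[OF V V HT_vs corep_bilin1]] lin_add[OF tsum_lin[OF V V HT_vs corep_bilin2]]
      lin_add[OF tsum_lin[OF V V HT_vs corep_bilin5(1)]] lin_add[OF tsum_lin[OF V V HT_vs corep_bilin5(2)]]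
    by (simp_all add: corepL_def corepR_def)
qed

end

end

section \<open>The base coalgebra\<close>

locale base = hopf K H for K :: "('k, 'r) ring_scheme" (structure) and H :: "('k, 'h, 'm) hopf_algebra_scheme" +
  fixes CH :: "('k, 'c) coalgebra" and p :: "'c \<Rightarrow> 'h"
  assumes cofree: "cofree_coalgebra K H CH p"
begin

abbreviation "P \<equiv> hpar K H CH p"
abbreviation "Ebar \<equiv> base_Ebar K H CH p"
abbreviation "C \<equiv> base_coalgebra K H CH p"

lemma CH: "coalgebra K CH" and p_lin: "lin CH H p"
  and cofreeD: "coalgebra K (D :: ('k, 'c) coalgebra) \<Longrightarrow> cofree_property K H CH p D"
  using cofree by (simp_all add: cofree_coalgebra_def)

lemma CH_vs: "vs CH" by (rule coalgebra_vs[OF CH])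

abbreviation "corep_family \<equiv> {X. subcoalgebra K CH X \<and> partial_corep K H (restrict_coalgebra K CH X) p}"

lemma P_subcoalgebra: "subcoalgebra K CH (sum_submodules CH corep_family)"
  by (rule sum_subcoalgebra[OF CH]) simp

lemma P_coalgebra: "coalgebra K P"
  unfolding hpar_def by (rule restrict_coalgebra[OF CH P_subcoalgebra])

text \<open>Each condition can be read inside \<open>CH\<close> and is additive in the element, so
  it passes from the members of the family to their sum.\<close>

lemma P_partial_corep: "partial_corep K H P p"
  unfolding hpar_def partial_corep_restrict_iff[OF CH p_lin P_subcoalgebra]
proof
  interpret CH: module K CH by (rule CH_vs)
  have sm: "X \<in> corep_family \<Longrightarrow> submodule X K CH" for X using subcoalgebraD(1) by blast
  fix x assume "x \<in> sum_submodules CH corep_family"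
  then show "counit H (p x) = counit CH x \<and> corepL CH p x \<and> corepR CH p x"
  proof (rule sum_submodules_induct[OF CH_vs sm, rotated 1])
    show "counit H (p \<zero>\<^bsub>CH\<^esub>) = counit CH \<zero>\<^bsub>CH\<^esub> \<and> corepL CH p \<zero>\<^bsub>CH\<^esub> \<and> corepR CH p \<zero>\<^bsub>CH\<^esub>"
      using corep_zero[OF CH p_lin] lin_zero[OF CH_vs H_vs p_lin] lin_zero[OF CH_vs scalars_vs counit_lin[OF CH]]
        lin_zero[OF H_vs scalars_vs counit_lin[OF H_coalgebra]] by simp
  next
    fix X x assume "X \<in> corep_family" "x \<in> X"
    then show "counit H (p x) = counit CH x \<and> corepL CH p x \<and> corepR CH p x"
      using partial_corep_restrict_iff[OF CH p_lin] by blast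
  next
    fix x y assume "x \<in> carrier CH" "y \<in> carrier CH"
      "counit H (p x) = counit CH x \<and> corepL CH p x \<and> corepR CH p x"
      "counit H (p y) = counit CH y \<and> corepL CH p y \<and> corepR CH p y"
    then show "counit H (p (x \<oplus>\<^bsub>CH\<^esub> y)) = counit CH (x \<oplus>\<^bsub>CH\<^esub> y) \<and> corepL CH p (x \<oplus>\<^bsub>CH\<^esub> y) \<and> corepR CH p (x \<oplus>\<^bsub>CH\<^esub> y)"
      using corep_add[OF CH p_lin] lin_closed[OF p_lin]
      by (simp add: lin_add[OF p_lin] coalgebra.counit_add[OF CH] coalgebra.counit_add[OF H_coalgebra])
  qed
qed

sublocale corep K H P p
  by (rule corep.intro[OF hopf_axioms corep_axioms.intro[OF P_coalgebra P_partial_corep]])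

lemma base_E_eq: "x \<in> carrier P \<Longrightarrow> base_E K H CH p x = E x"
  unfolding base_E_def E_def
  by (simp add: conv_apply, rule tsum_cong[OF comult_closed[OF _ P_coalgebra] conv_bilin[OF P_coalgebra H_alg W_lin W'_lin] _ D_vs D_vs H_vs, symmetric])
    (simp_all add: W_apply)

lemma Ebar_spec: "Ebar \<in> extensional (carrier P) \<and> coalgebra_map K P CH Ebar \<and>
  (\<forall>x\<in>carrier P. p (Ebar x) = base_E K H CH p x)"
proof -
  have "lin P H (base_E K H CH p)"
    by (rule lin_cong[OF conv_carrierD[OF E_closed] D_vs]) (simp add: base_E_eq)
  then have "\<exists>!F. F \<in> extensional (carrier P) \<and> coalgebra_map K P CH F \<and> (\<forall>x\<in>carrier P. p (F x) = base_E K H CH p x)"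
    using cofreeD[OF P_coalgebra] by (simp add: cofree_property_def)
  then show ?thesis unfolding base_Ebar_def by (rule theI')
qed

lemma Ebar_map: "coalgebra_map K P CH Ebar" using Ebar_spec by blast
lemma Ebar_lin: "lin P CH Ebar" by (rule coalgebra_mapD(1)[OF Ebar_map])
lemma p_Ebar: "x \<in> carrier P \<Longrightarrow> p (Ebar x) = E x" using Ebar_spec base_E_eq by simp

text \<open>Uniqueness in the universal property concerns extensional maps, so \<open>F\<close> and
  \<open>G\<close> are compared after restriction to the carrier.\<close>

lemma cofree_unique:
  fixes Q :: "('k, 'c) coalgebra"
  assumes Q: "coalgebra K Q" and F: "coalgebra_map K Q CH F" and G: "coalgebra_map K Q CH G"
    and eq: "\<And>x. x \<in> carrier Q \<Longrightarrow> p (F x) = p (G x)" and x: "x \<in> carrier Q"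
  shows "F x = G x"
proof -
  have "lin Q H (\<lambda>x. p (F x))" by (rule lin_comp[OF coalgebra_mapD(1)[OF F] p_lin])
  then have u: "\<exists>!F'. F' \<in> extensional (carrier Q) \<and> coalgebra_map K Q CH F' \<and> (\<forall>x\<in>carrier Q. p (F' x) = p (F x))"
    using cofreeD[OF Q] by (simp add: cofree_property_def)
  have "A = B" if "A \<in> extensional (carrier Q) \<and> coalgebra_map K Q CH A \<and> (\<forall>x\<in>carrier Q. p (A x) = p (F x))"
    "B \<in> extensional (carrier Q) \<and> coalgebra_map K Q CH B \<and> (\<forall>x\<in>carrier Q. p (B x) = p (F x))" for A B
    using u that by blast
  moreover have "coalgebra_map K Q CH (restrict F (carrier Q))" "coalgebra_map K Q CH (restrict G (carrier Q))"
    using coalgebra_map_cong[OF Q CH_vs F] coalgebra_map_cong[OF Q CH_vs G] by auto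
  ultimately have "restrict F (carrier Q) = restrict G (carrier Q)" using eq by simp
  then show ?thesis using x by (metis restrict_apply')
qed

subsection \<open>Functionals that determine the base\<close>

text \<open>The last clause makes the contraction of the coaction formula with
  \<open>\<alpha>\<close> a function of \<open>Ebar x\<close>, which is what descent to
  \<open>C\<close> requires. \<open>\<alpha>\<close> and \<open>\<beta>\<close> live on
  \<open>CH\<close>, so that convolution products of such pairs are again maps on
  \<open>CH\<close>.\<close>

definition "nice_base \<alpha> \<longleftrightarrow> lin CH scalars \<alpha> \<and> nice (up \<alpha> Ebar) \<and> (\<exists>\<beta>. lin CH H \<beta> \<and> act (up \<alpha> Ebar) = up \<beta> Ebar)"

lemma up_p_Ebar: "up p Ebar = E"
proof (rule extensionalityI[of _ "carrier P"])
  show "E \<in> extensional (carrier P)" using E_closed by (simp add: conv_monoid_def)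
  show "up p Ebar \<in> extensional (carrier P)" by (simp add: compose_def)
  fix x assume "x \<in> carrier P" then show "up p Ebar x = E x" by (simp add: compose_apply p_Ebar)
qed

lemma up_counit_Ebar: "up (counit CH) Ebar = \<one>\<^bsub>dual\<^esub>"
  by (auto simp: compose_def conv_monoid_def coalgebra_mapD(2)[OF Ebar_map] coalgebra.counit_closed[OF P_coalgebra])

lemma nice_base_counit: "nice_base (counit CH)"
  unfolding nice_base_def up_counit_Ebar
  using counit_lin[OF CH] nice_one p_lin by (auto simp: act_one up_p_Ebar[symmetric])

lemma up_comp: "up (\<lambda>x. g (f x)) \<phi> = up g (up f \<phi>)"
  by (auto simp: compose_def)

text \<open>By \<open>act_f_E\<close> the contraction is a product of two maps that depend on
  \<open>E\<close>, that is on \<open>p \<circ> Ebar\<close>; pulling back along the coalgebra map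
  \<open>Ebar\<close> is multiplicative, so it comes from a convolution on
  \<open>CH\<close>.\<close>

lemma nice_base_p: assumes f: "lin H scalars f" shows "nice_base (\<lambda>x. f (p x))"
proof -
  have "lin CH scalars (\<lambda>x. f (p x))" by (rule lin_comp[OF p_lin f])
  moreover have l: "lin CH H (\<lambda>x. rslice f (p x))" by (rule lin_comp[OF p_lin rslice_lin[OF f]])
  moreover have "act (up f E) = up (conv CH H (\<lambda>x. rslice f (p x)) p) Ebar"
    unfolding compose_coalgebra_map[OF P_coalgebra CH Ebar_map H_alg l p_lin] up_comp up_p_Ebar
    by (rule act_f_E[OF f])
  moreover have "lin CH H (conv CH H (\<lambda>x. rslice f (p x)) p)" by (rule conv_lin[OF CH H_alg l p_lin])
  ultimately show ?thesis
    unfolding nice_base_def up_comp up_p_Ebar using nice_f_E[OF f] by blast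
qed

text \<open>\<open>act\<close> turns convolution of functionals into convolution of
  \<open>H\<close>-valued maps, so the witness for the product is the convolution of the two
  witnesses \<open>\<beta>\<close> and \<open>\<beta>'\<close>.\<close>

lemma nice_base_conv: assumes "nice_base \<alpha>" "nice_base \<alpha>'"
  shows "nice_base (conv CH scalars \<alpha> \<alpha>')"
    "up (conv CH scalars \<alpha> \<alpha>') Ebar = conv P scalars (up \<alpha> Ebar) (up \<alpha>' Ebar)"
proof -
  have l: "lin CH scalars \<alpha>" "lin CH scalars \<alpha>'" and n: "nice (up \<alpha> Ebar)" "nice (up \<alpha>' Ebar)"
    using assms by (auto simp: nice_base_def)
  obtain \<beta> \<beta>' where b: "lin CH H \<beta>" "act (up \<alpha> Ebar) = up \<beta> Ebar" "lin CH H \<beta>'" "act (up \<alpha>' Ebar) = up \<beta>' Ebar"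
    using assms by (auto simp: nice_base_def)
  show e: "up (conv CH scalars \<alpha> \<alpha>') Ebar = conv P scalars (up \<alpha> Ebar) (up \<alpha>' Ebar)"
    by (rule compose_coalgebra_map[OF P_coalgebra CH Ebar_map scalars_alg l])
  have n': "up \<alpha>' Ebar \<in> carrier dual" using n(2) by (simp add: nice_def)
  have "act (conv P scalars (up \<alpha> Ebar) (up \<alpha>' Ebar)) = up (conv CH H \<beta> \<beta>') Ebar"
    unfolding act_conv[OF n(1) n'] compose_coalgebra_map[OF P_coalgebra CH Ebar_map H_alg b(1,3)] by (simp add: b)
  moreover have "lin CH H (conv CH H \<beta> \<beta>')" by (rule conv_lin[OF CH H_alg b(1,3)])
  ultimately show "nice_base (conv CH scalars \<alpha> \<alpha>')"
    unfolding nice_base_def e using conv_lin[OF CH scalars_alg l] nice_conv[OF n] by blast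
qed

lemma Ebar_eq_zeroI:
  assumes x: "x \<in> carrier P" and z: "\<And>\<alpha>. nice_base \<alpha> \<Longrightarrow> \<alpha> (Ebar x) = \<zero>"
  shows "Ebar x = \<zero>\<^bsub>CH\<^esub>"
proof -
  text \<open>The counit of \<open>P\<close> agrees with \<open>counit CH \<circ> Ebar\<close> on the carrier only, so it is added separately.\<close>
  let ?\<A> = "insert (counit P) {\<lambda>x. \<alpha> (Ebar x) | \<alpha>. nice_base \<alpha>}"
  interpret P: module K P by (rule D_vs)
  have rep: "\<exists>\<alpha>. nice_base \<alpha> \<and> (\<forall>x\<in>carrier P. A x = \<alpha> (Ebar x))" if "A \<in> ?\<A>" for A
    using that nice_base_counit coalgebra_mapD(2)[OF Ebar_map] by auto
  have l: "lin P scalars A" if "A \<in> ?\<A>" for A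
    using that counit_lin[OF P_coalgebra] lin_comp[OF Ebar_lin] by (auto simp: nice_base_def)
  have zero: "A y = \<zero>" if "A \<in> ?\<A>" "y \<in> carrier P" "\<And>\<alpha>. nice_base \<alpha> \<Longrightarrow> \<alpha> (Ebar y) = \<zero>" for A y
    using rep[OF that(1)] that(2,3) by metis
  have mult: "conv P scalars A B y = \<zero>"
    if A: "A \<in> ?\<A>" and B: "B \<in> ?\<A>" and y: "y \<in> carrier P" and yz: "\<And>F. F \<in> ?\<A> \<Longrightarrow> F y = \<zero>" for A B y
  proof -
    obtain \<alpha> where a: "nice_base \<alpha>" "\<forall>x\<in>carrier P. A x = \<alpha> (Ebar x)" using rep[OF A] by blast
    obtain \<beta> where b: "nice_base \<beta>" "\<forall>x\<in>carrier P. B x = \<beta> (Ebar x)" using rep[OF B] by blast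
    have "conv P scalars A B = conv P scalars (up \<alpha> Ebar) (up \<beta> Ebar)"
      using a(2) b(2) by (intro conv_cong[OF P_coalgebra scalars_alg l[OF A] l[OF B]]) (simp_all add: compose_apply)
    also have "\<dots> = up (conv CH scalars \<alpha> \<beta>) Ebar" by (rule nice_base_conv(2)[OF a(1) b(1), symmetric])
    finally have "conv P scalars A B y = conv CH scalars \<alpha> \<beta> (Ebar y)" using y by (simp add: compose_apply)
    moreover have "(\<lambda>x. conv CH scalars \<alpha> \<beta> (Ebar x)) \<in> ?\<A>"
      by (intro insertI2 CollectI exI[of _ "conv CH scalars \<alpha> \<beta>"] conjI refl nice_base_conv(1)[OF a(1) b(1)])
    from yz[OF this] have "conv CH scalars \<alpha> \<beta> (Ebar y) = \<zero>" .
    ultimately show ?thesis by simp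
  qed
  obtain Q :: "('k, 'c) coalgebra" and q where Q: "coalgebra K Q" and q: "coalgebra_map K P Q q"
    and Qq: "carrier Q = q ` carrier P" and il: "lin Q P (\<lambda>x. x)" and Q0: "zero Q = zero P"
    and qz: "\<And>x. \<lbrakk>x \<in> carrier P; \<forall>A\<in>?\<A>. A x = \<zero>\<rbrakk> \<Longrightarrow> q x = \<zero>\<^bsub>P\<^esub>"
    and dec: "\<And>x. x \<in> carrier P \<Longrightarrow> \<exists>y\<in>carrier P. x = q x \<oplus>\<^bsub>P\<^esub> y \<and> (\<forall>A\<in>?\<A>. A y = \<zero>)"
    by (rule coideal_quotient[OF P_coalgebra l insertI1 mult], assumption+, rule that)
  have qc: "q y \<in> carrier P" if "y \<in> carrier P" for y using lin_closed[OF il, of "q y"] that Qq by blast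
  note pEl = lin_comp[OF Ebar_lin p_lin]
  \<comment> \<open>\<open>y\<close> and \<open>q y\<close> differ by a common zero \<open>n\<close>
    of the family. The family contains all \<open>f \<circ> p \<circ> Ebar\<close>, and functionals
    separate the points of \<open>H\<close>, so \<open>p (Ebar n)\<close> vanishes.\<close>
  have pq: "p (Ebar (q y)) = p (Ebar y)" if y: "y \<in> carrier P" for y
  proof -
    obtain n where n: "n \<in> carrier P" "y = q y \<oplus>\<^bsub>P\<^esub> n" "\<forall>A\<in>?\<A>. A n = \<zero>" using dec[OF y] by blast
    have "p (Ebar n) = \<zero>\<^bsub>H\<^esub>"
    proof (rule separatingD(2)[OF separating_all[OF H_vs] lin_closed[OF pEl n(1)]])
      fix f assume "f \<in> {f. lin H scalars f}"
      then have "lin H scalars f" by simp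
      then have "(\<lambda>x. f (p (Ebar x))) \<in> ?\<A>"
        by (intro insertI2 CollectI exI[of _ "\<lambda>x. f (p x)"] conjI refl nice_base_p)
      from bspec[OF n(3) this] show "f (p (Ebar n)) = \<zero>" .
    qed
    then show ?thesis
      using lin_add[OF pEl qc[OF y] n(1)] n(2) lin_closed[OF pEl qc[OF y]] by simp
  qed
  have "lin Q H (\<lambda>x. p (Ebar x))" by (rule lin_comp[OF il pEl])
  \<comment> \<open>The existence half of cofreeness on \<open>Q\<close> lifts
    \<open>p \<circ> Ebar\<close>; the uniqueness half on \<open>P\<close> then identifies
    \<open>Ebar\<close> with \<open>G \<circ> q\<close>, which kills \<open>x\<close>.\<close>
  then obtain G where G: "coalgebra_map K Q CH G" "\<And>y. y \<in> carrier Q \<Longrightarrow> p (G y) = p (Ebar y)"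
    using cofreeD[OF Q] unfolding cofree_property_def by blast
  have "Ebar x = G (q x)"
  proof (rule cofree_unique[OF P_coalgebra Ebar_map _ _ x])
    show "coalgebra_map K P CH (\<lambda>x. G (q x))" by (rule coalgebra_map_compose[OF P_coalgebra Q CH q G(1)])
    fix y assume y: "y \<in> carrier P"
    then show "p (Ebar y) = p (G (q y))" using G(2)[of "q y"] pq[OF y] by (simp add: Qq)
  qed
  moreover have "q x = \<zero>\<^bsub>P\<^esub>" using zero x z by (intro qz[OF x]) blast
  moreover have "G \<zero>\<^bsub>Q\<^esub> = \<zero>\<^bsub>CH\<^esub>" by (rule lin_zero[OF coalgebra_vs[OF Q] CH_vs coalgebra_mapD(1)[OF G(1)]])
  ultimately show ?thesis by (simp add: Q0)
qed

end

section \<open>The coaction formula on \<open>P\<close>, its coefficients and its descent to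
  \<open>C\<close>\<close>

context vector_spaces
begin

text \<open>Distributivity for Sweedler double sums; it separates the contributions of two
  independent coactions once \<open>g\<close> has factored the summand.\<close>

lemma product_push:
  assumes t1: "t1 \<in> carrier (tensor K A1 B1)" and t2: "t2 \<in> carrier (tensor K A2 B2)"
    and vs: "vs A1" "vs B1" "vs A2" "vs B2" "vs U" and B: "alg B" and g: "lin U B g"
    and b1: "bilin A1 B1 U (\<lambda>a b. tsum K U t2 (\<beta> a b))"
    and b2: "\<And>a b. a \<in> carrier A1 \<Longrightarrow> b \<in> carrier B1 \<Longrightarrow> bilin A2 B2 U (\<beta> a b)"
    and f1: "bilin A1 B1 B f1" and f2: "bilin A2 B2 B f2"
    and eq: "\<And>a b c d. \<lbrakk>a \<in> carrier A1; b \<in> carrier B1; c \<in> carrier A2; d \<in> carrier B2\<rbrakk> \<Longrightarrow>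
      g (\<beta> a b c d) = f1 a b \<otimes>\<^bsub>B\<^esub> f2 c d"
  shows "g (tsum K U t1 (\<lambda>a b. tsum K U t2 (\<beta> a b))) = tsum K B t1 f1 \<otimes>\<^bsub>B\<^esub> tsum K B t2 f2"
proof -
  note BV = alg_vs[OF B] and f1c = bilin_closed[OF f1]
  note t2c = lin_closed[OF tsum_lin[OF vs(3,4) BV f2] t2]
  have "g (tsum K U t1 (\<lambda>a b. tsum K U t2 (\<beta> a b))) = tsum K B t1 (\<lambda>a b. g (tsum K U t2 (\<beta> a b)))"
    by (rule tsum_hom[OF t1 g b1 vs(1,2,5) BV])
  also have "\<dots> = tsum K B t1 (\<lambda>a b. f1 a b \<otimes>\<^bsub>B\<^esub> tsum K B t2 f2)"
  proof (rule tsum_cong[OF t1 bilin_comp[OF b1 g] _ vs(1,2) BV])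
    fix a b assume h: "a \<in> carrier A1" "b \<in> carrier B1"
    have "g (tsum K U t2 (\<beta> a b)) = tsum K B t2 (\<lambda>c d. g (\<beta> a b c d))"
      by (rule tsum_hom[OF t2 g b2[OF h] vs(3,4,5) BV])
    also have "\<dots> = tsum K B t2 (\<lambda>c d. f1 a b \<otimes>\<^bsub>B\<^esub> f2 c d)"
      by (rule tsum_cong[OF t2 bilin_comp[OF b2[OF h] g] _ vs(3,4) BV]) (rule eq[OF h])
    also have "\<dots> = f1 a b \<otimes>\<^bsub>B\<^esub> tsum K B t2 f2"
      by (rule tsum_hom[OF t2 bilin_lin2[OF mult_bilin[OF B] f1c[OF h]] f2 vs(3,4) BV BV, symmetric])
    finally show "g (tsum K U t2 (\<beta> a b)) = \<dots>" .
  qed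
  also have "\<dots> = tsum K B t1 f1 \<otimes>\<^bsub>B\<^esub> tsum K B t2 f2"
    by (rule tsum_hom[OF t1 bilin_lin1[OF mult_bilin[OF B] t2c] f1 vs(1,2) BV BV, symmetric])
  finally show ?thesis .
qed

end

context base
begin

lemma C_subcoalgebra: "subcoalgebra K CH (Ebar ` carrier P)"
  by (rule image_subcoalgebra(1)[OF P_coalgebra CH Ebar_map])

lemma C_coalgebra: "coalgebra K C"
  unfolding base_coalgebra_def by (rule restrict_coalgebra[OF CH C_subcoalgebra])

lemma Ebar_map_C: "coalgebra_map K P C Ebar"
  unfolding base_coalgebra_def by (rule image_subcoalgebra(2)[OF P_coalgebra CH Ebar_map])

lemma C_simps [simp]: "carrier C = Ebar ` carrier P" "zero C = zero CH"
  by (simp_all add: base_coalgebra_def)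

lemma C_vs: "vs C" by (rule coalgebra_vs[OF C_coalgebra])

lemma Ebar_C_lin: "lin P C Ebar" by (rule coalgebra_mapD(1)[OF Ebar_map_C])

lemma nice_base_lin: "nice_base \<alpha> \<Longrightarrow> lin C scalars \<alpha>"
  unfolding base_coalgebra_def nice_base_def
  using lin_restrict_coalgebra[OF CH_vs subcoalgebraD(1)[OF C_subcoalgebra]] by blast

lemma C_separating: "separating C {\<alpha>. nice_base \<alpha>}"
  unfolding separating_def using nice_base_lin Ebar_eq_zeroI by auto

abbreviation "HC \<equiv> tensor K H C"

lemma HC_vs: "vs HC" by (rule tensor_vs[OF H_vs C_vs])

text \<open>The formula for the coaction as a map on \<open>P\<close>, before it is known to depend
  on \<open>Ebar x\<close> only.\<close>

definition "LAM x = tsum K HC (comult P x) (\<lambda>x1 x'.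
        tsum K HC (comult P x') (\<lambda>x2 x3. ptensor K H C (p x1 \<otimes>\<^bsub>H\<^esub> S (p x3)) (Ebar x2)))"

lemma p_closed: "x \<in> carrier P \<Longrightarrow> p x \<in> carrier H" by (rule w_closed)

lemma Ebar_closed: "x \<in> carrier P \<Longrightarrow> Ebar x \<in> carrier C" by (rule lin_closed[OF Ebar_C_lin])

lemmas LAM_rules = D_vs H_vs C_vs HC_vs H_alg P_coalgebra p_closed S_closed Ebar_closed
  lin_app[OF w_lin] lin_app[OF S_lin] lin_app[OF Ebar_C_lin] lins

lemma LAM_inner_bilin: "x1 \<in> carrier P \<Longrightarrow> bilin P P HC (\<lambda>x2 x3. ptensor K H C (p x1 \<otimes>\<^bsub>H\<^esub> S (p x3)) (Ebar x2))"
  by (assumption | rule LAM_rules)+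

lemma LAM_bilin: "bilin P P HC (\<lambda>x1 x'. tsum K HC (comult P x') (\<lambda>x2 x3. ptensor K H C (p x1 \<otimes>\<^bsub>H\<^esub> S (p x3)) (Ebar x2)))"
  by (assumption | rule LAM_inner_bilin LAM_rules)+

lemma LAM_lin: "lin P HC LAM"
  unfolding LAM_def
  by (rule lin_tsum[OF coalgebra.comult_linear[OF P_coalgebra] LAM_bilin D_vs D_vs HC_vs])

text \<open>In the formula the outer Sweedler legs are multiplied with each other while the middle
  leg stands apart. Under \<open>g\<close> the middle leg becomes a factor between them, which
  restores the order of a triple convolution: a scalar in \<open>coef_LAM\<close>, an element of the
  second tensor leg in \<open>coef3_lam2\<close>.\<close>

lemma LAM_push:
  assumes B: "alg B" and g: "lin HC B g" and l: "lin P B \<phi>" "lin P B \<psi>" "lin P B \<chi>"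
    and eq: "\<And>a b c. \<lbrakk>a \<in> carrier P; b \<in> carrier P; c \<in> carrier P\<rbrakk> \<Longrightarrow>
      g (ptensor K H C (p a \<otimes>\<^bsub>H\<^esub> S (p c)) (Ebar b)) = \<phi> a \<otimes>\<^bsub>B\<^esub> (\<psi> b \<otimes>\<^bsub>B\<^esub> \<chi> c)"
    and x: "x \<in> carrier P"
  shows "g (LAM x) = conv P B \<phi> (conv P B \<psi> \<chi>) x"
proof -
  note cc = comult_closed[OF _ P_coalgebra] and BV = alg_vs[OF B]
  have "g (LAM x) = tsum K B (comult P x) (\<lambda>x1 x'. g (tsum K HC (comult P x') (\<lambda>x2 x3. ptensor K H C (p x1 \<otimes>\<^bsub>H\<^esub> S (p x3)) (Ebar x2))))"
    unfolding LAM_def by (rule tsum_hom[OF cc[OF x] g LAM_bilin D_vs D_vs HC_vs BV])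
  also have "\<dots> = tsum K B (comult P x) (\<lambda>x1 x'. tsum K B (comult P x') (\<lambda>x2 x3. \<phi> x1 \<otimes>\<^bsub>B\<^esub> (\<psi> x2 \<otimes>\<^bsub>B\<^esub> \<chi> x3)))"
  proof (rule tsum_cong[OF cc[OF x] bilin_comp[OF LAM_bilin g] _ D_vs D_vs BV])
    fix x1 x' assume h: "x1 \<in> carrier P" "x' \<in> carrier P"
    have "g (tsum K HC (comult P x') (\<lambda>x2 x3. ptensor K H C (p x1 \<otimes>\<^bsub>H\<^esub> S (p x3)) (Ebar x2))) =
      tsum K B (comult P x') (\<lambda>x2 x3. g (ptensor K H C (p x1 \<otimes>\<^bsub>H\<^esub> S (p x3)) (Ebar x2)))"
      by (rule tsum_hom[OF cc[OF h(2)] g LAM_inner_bilin[OF h(1)] D_vs D_vs HC_vs BV])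
    also have "\<dots> = tsum K B (comult P x') (\<lambda>x2 x3. \<phi> x1 \<otimes>\<^bsub>B\<^esub> (\<psi> x2 \<otimes>\<^bsub>B\<^esub> \<chi> x3))"
      by (rule tsum_cong[OF cc[OF h(2)] bilin_comp[OF LAM_inner_bilin[OF h(1)] g] _ D_vs D_vs BV]) (rule eq[OF h(1)])
    finally show "g (tsum K HC (comult P x') (\<lambda>x2 x3. ptensor K H C (p x1 \<otimes>\<^bsub>H\<^esub> S (p x3)) (Ebar x2))) = \<dots>" .
  qed
  also have "\<dots> = conv P B \<phi> (conv P B \<psi> \<chi>) x"
    by (rule conv3_apply[OF P_coalgebra B l x, symmetric])
  finally show ?thesis .
qed

text \<open>The contraction \<open>id \<otimes> \<gamma>\<close> with values in
  \<open>H\<close>.\<close>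

definition "coef \<gamma> t = tsum K H t (\<lambda>h d. \<gamma> d \<odot>\<^bsub>H\<^esub> h)"

context
  fixes \<gamma> assumes \<gamma>: "lin C scalars \<gamma>"
begin

lemma \<gamma>_closed: "d \<in> carrier C \<Longrightarrow> \<gamma> d \<in> carrier K" using lin_closed[OF \<gamma>] by simp

lemma coef_bilin: "bilin H C H (\<lambda>h d. \<gamma> d \<odot>\<^bsub>H\<^esub> h)"
  by (assumption | rule H_vs \<gamma>_closed lin_app[OF \<gamma>] lins)+

lemma coef_lin: "lin HC H (coef \<gamma>)"
  unfolding coef_def by (rule tsum_lin[OF H_vs C_vs H_vs coef_bilin])

lemma coef_ptensor: "h \<in> carrier H \<Longrightarrow> d \<in> carrier C \<Longrightarrow> coef \<gamma> (ptensor K H C h d) = \<gamma> d \<odot>\<^bsub>H\<^esub> h"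
  unfolding coef_def by (rule tsum_ptensor[OF H_vs C_vs H_vs coef_bilin])

lemma up_Ebar_dual: "up \<gamma> Ebar \<in> carrier dual"
  by (rule compose_closed[OF P_coalgebra \<gamma> Ebar_C_lin])

lemma coef_LAM:
  assumes x: "x \<in> carrier P" shows "coef \<gamma> (LAM x) = act (up \<gamma> Ebar) x"
proof -
  note l = conv_carrierD[OF scalar_map_closed[OF up_Ebar_dual]]
  show ?thesis unfolding act_def
  proof (rule LAM_push[OF H_alg coef_lin W_lin l W'_lin _ x])
    fix a b c assume h: "a \<in> carrier P" "b \<in> carrier P" "c \<in> carrier P"
    have g: "\<gamma> (Ebar b) \<in> carrier K" by (rule \<gamma>_closed[OF Ebar_closed[OF h(2)]])
    note c = p_closed[OF h(1)] S_closed[OF p_closed[OF h(3)]]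
    have "coef \<gamma> (ptensor K H C (p a \<otimes>\<^bsub>H\<^esub> S (p c)) (Ebar b)) = \<gamma> (Ebar b) \<odot>\<^bsub>H\<^esub> (p a \<otimes>\<^bsub>H\<^esub> S (p c))"
      using c by (intro coef_ptensor Ebar_closed h) simp
    then show "coef \<gamma> (ptensor K H C (p a \<otimes>\<^bsub>H\<^esub> S (p c)) (Ebar b)) = W a \<otimes>\<^bsub>H\<^esub> (scalar_map (up \<gamma> Ebar) b \<otimes>\<^bsub>H\<^esub> W' c)"
      using h g c by (simp add: W_apply scalar_map_def compose_apply alg_smult1[OF H_alg] alg_smult2[OF H_alg])
  qed
qed

end

text \<open>For \<open>\<alpha>\<close> in the nice family the contraction of \<open>LAM x\<close>
  is \<open>\<beta> (Ebar x)\<close>, hence zero, and this family separates the points of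
  \<open>C\<close>.\<close>

lemma LAM_zero:
  assumes x: "x \<in> carrier P" and z: "Ebar x = \<zero>\<^bsub>CH\<^esub>"
  shows "LAM x = \<zero>\<^bsub>HC\<^esub>"
proof (rule tensor_eq_zeroI[OF H_vs C_vs C_separating])
  show "LAM x \<in> carrier HC" by (rule lin_closed[OF LAM_lin x])
  fix \<alpha> assume "\<alpha> \<in> {\<alpha>. nice_base \<alpha>}"
  then have n: "nice_base \<alpha>" by simp
  then obtain \<beta> where b: "lin CH H \<beta>" "act (up \<alpha> Ebar) = up \<beta> Ebar" by (auto simp: nice_base_def)
  have "coef \<alpha> (LAM x) = \<beta> (Ebar x)"
    using x by (simp add: coef_LAM[OF nice_base_lin[OF n] x] b(2) compose_apply)
  then show "tsum K H (LAM x) (\<lambda>v w. \<alpha> w \<odot>\<^bsub>H\<^esub> v) = \<zero>\<^bsub>H\<^esub>"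
    by (simp add: coef_def z lin_zero[OF CH_vs H_vs b(1)])
qed

text \<open>A preimage is chosen; the choice is immaterial because \<open>LAM_zero\<close> applies
  to the difference of two preimages.\<close>

definition "lam c = LAM (SOME x. x \<in> carrier P \<and> Ebar x = c)"

lemma lam_Ebar: assumes x: "x \<in> carrier P" shows "lam (Ebar x) = LAM x"
proof -
  interpret P: module K P by (rule D_vs)
  interpret CH: module K CH by (rule CH_vs)
  let ?y = "SOME y. y \<in> carrier P \<and> Ebar y = Ebar x"
  have y: "?y \<in> carrier P \<and> Ebar ?y = Ebar x" by (rule someI[of _ x]) (simp add: x)
  have "Ebar (?y \<ominus>\<^bsub>P\<^esub> x) = \<zero>\<^bsub>CH\<^esub>"
    using y x lin_closed[OF Ebar_lin x] by (simp add: lin_minus[OF D_vs CH_vs Ebar_lin] a_minus_def[of CH] CH.r_neg)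
  then have "LAM (?y \<ominus>\<^bsub>P\<^esub> x) = \<zero>\<^bsub>HC\<^esub>" using y x by (intro LAM_zero) auto
  then have "LAM ?y \<ominus>\<^bsub>HC\<^esub> LAM x = \<zero>\<^bsub>HC\<^esub>" using y x by (simp add: lin_minus[OF D_vs HC_vs LAM_lin])
  then have "LAM ?y = LAM x" using y x by (elim eq_of_minus_zero[OF HC_vs]) (simp_all add: lin_closed[OF LAM_lin])
  then show ?thesis by (simp add: lam_def)
qed

lemma lam_lin: "lin C HC lam"
proof -
  interpret P: module K P by (rule D_vs)
  show ?thesis
  proof (rule linI)
    fix c assume "c \<in> carrier C"
    then show "lam c \<in> carrier HC" using lam_Ebar lin_closed[OF LAM_lin] by auto
  next
    fix c d assume "c \<in> carrier C" "d \<in> carrier C"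
    then obtain x y where "x \<in> carrier P" "c = Ebar x" "y \<in> carrier P" "d = Ebar y" by auto
    then show "lam (c \<oplus>\<^bsub>C\<^esub> d) = lam c \<oplus>\<^bsub>HC\<^esub> lam d"
      by (simp add: lin_add[OF Ebar_C_lin, symmetric] lam_Ebar lin_add[OF LAM_lin])
  next
    fix a c assume a: "a \<in> carrier K" and "c \<in> carrier C"
    then obtain x where "x \<in> carrier P" "c = Ebar x" by auto
    then show "lam (a \<odot>\<^bsub>C\<^esub> c) = a \<odot>\<^bsub>HC\<^esub> lam c"
      using a by (simp add: lin_smult[OF Ebar_C_lin, symmetric] lam_Ebar lin_smult[OF LAM_lin])
  qed
qed

lemma lam_closed: "c \<in> carrier C \<Longrightarrow> lam c \<in> carrier HC" by (rule lin_closed[OF lam_lin])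

text \<open>The matrix coefficient of the coaction at \<open>\<gamma>\<close>. Pulled back to
  \<open>P\<close> it is \<open>act\<close>, so the axioms of \<open>lam\<close> become equations in
  the convolution algebras of \<open>P\<close>.\<close>

definition "mat \<gamma> c = coef \<gamma> (lam c)"

lemma mat_lin: "lin C scalars \<gamma> \<Longrightarrow> lin C H (mat \<gamma>)"
  unfolding mat_def by (rule lin_comp[OF lam_lin coef_lin])

lemma up_mat: "lin C scalars \<gamma> \<Longrightarrow> up (mat \<gamma>) Ebar = act (up \<gamma> Ebar)"
proof (rule extensionalityI[of _ "carrier P"])
  assume g: "lin C scalars \<gamma>"
  show "up (mat \<gamma>) Ebar \<in> extensional (carrier P)" by (simp add: compose_def)
  show "act (up \<gamma> Ebar) \<in> extensional (carrier P)"
    using act_closed[OF up_Ebar_dual[OF g]] by (simp add: conv_monoid_def)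
  fix x assume "x \<in> carrier P"
  then show "up (mat \<gamma>) Ebar x = act (up \<gamma> Ebar) x"
    by (simp add: compose_apply mat_def lam_Ebar coef_LAM[OF g])
qed

text \<open>This is how the factors with the counit of \<open>C\<close> in the third axiom turn into
  \<open>E\<close>.\<close>

lemma up_mat_counit: "up (mat (counit C)) Ebar = E"
proof -
  have "counit C = counit CH" by (simp add: base_coalgebra_def)
  then show ?thesis
    using up_mat[OF counit_lin[OF C_coalgebra]] up_counit_Ebar act_one by simp
qed

lemma comult_push:
  assumes B: "alg B" and U: "vs U" and g: "lin U B g" and b: "bilin C C U Z"
    and l: "lin C B \<phi>" "lin C B \<psi>"
    and eq: "\<And>c d. c \<in> carrier C \<Longrightarrow> d \<in> carrier C \<Longrightarrow> g (Z c d) = \<phi> c \<otimes>\<^bsub>B\<^esub> \<psi> d"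
    and x: "x \<in> carrier P"
  shows "g (tsum K U (comult C (Ebar x)) Z) = conv P B (up \<phi> Ebar) (up \<psi> Ebar) x"
proof -
  note cc = comult_closed[OF Ebar_closed[OF x] C_coalgebra] and BV = alg_vs[OF B]
  have "g (tsum K U (comult C (Ebar x)) Z) = tsum K B (comult C (Ebar x)) (\<lambda>c d. g (Z c d))"
    by (rule tsum_hom[OF cc g b C_vs C_vs U BV])
  also have "\<dots> = tsum K B (comult C (Ebar x)) (\<lambda>c d. \<phi> c \<otimes>\<^bsub>B\<^esub> \<psi> d)"
    by (rule tsum_cong[OF cc bilin_comp[OF b g] _ C_vs C_vs BV]) (rule eq)
  also have "\<dots> = up (conv C B \<phi> \<psi>) Ebar x"
    using x Ebar_closed[OF x] by (simp add: compose_apply conv_apply)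
  also have "\<dots> = conv P B (up \<phi> Ebar) (up \<psi> Ebar) x"
    unfolding compose_coalgebra_map[OF P_coalgebra C_coalgebra Ebar_map_C B l] ..
  finally show ?thesis .
qed

subsection \<open>The axioms of a partial comodule coalgebra\<close>

text \<open>Tested on \<open>\<alpha>\<close>, the left side is the counit of \<open>H\<close>
  applied to \<open>act A\<close>, with \<open>A\<close> the pullback of \<open>\<alpha>\<close>.
  That counit is multiplicative and invariant under \<open>S\<close>, and \<open>p\<close> preserves
  counits, so the outer factors become units and \<open>A\<close> is left.\<close>

lemma lam_counit:
  assumes c: "c \<in> carrier C"
  shows "tsum K C (lam c) (\<lambda>h d. counit H h \<odot>\<^bsub>C\<^esub> d) = c"
proof -
  obtain x where x: "x \<in> carrier P" "c = Ebar x" using c by auto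
  have b: "bilin H C C (\<lambda>h d. counit H h \<odot>\<^bsub>C\<^esub> d)"
    by (assumption | rule H_vs C_vs H_coalgebra lins)+
  let ?y = "tsum K C (lam c) (\<lambda>h d. counit H h \<odot>\<^bsub>C\<^esub> d)"
  have y: "?y \<in> carrier C" by (rule lin_closed[OF tsum_lin[OF H_vs C_vs C_vs b] lam_closed[OF c]])
  interpret C: module K C by (rule C_vs)
  show ?thesis
  proof (rule eq_of_minus_zero[OF C_vs _ y c], rule separatingD(2)[OF C_separating])
    show "?y \<ominus>\<^bsub>C\<^esub> c \<in> carrier C" using y c by (rule C.minus_closed)
    fix \<alpha> assume "\<alpha> \<in> {\<alpha>. nice_base \<alpha>}"
    then have n: "nice_base \<alpha>" by simp
    note al = nice_base_lin[OF n]
    have ac: "\<alpha> d \<in> carrier K" if "d \<in> carrier C" for d using lin_closed[OF al that] by simp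
    let ?A = "up \<alpha> Ebar"
    note Ac = up_Ebar_dual[OF al]
    note cH = counit_lin[OF H_coalgebra]
    interpret du: monoid dual by (rule conv_monoid[OF P_coalgebra scalars_alg])
    have "\<alpha> ?y = tsum K scalars (lam c) (\<lambda>h d. \<alpha> (counit H h \<odot>\<^bsub>C\<^esub> d))"
      by (rule tsum_hom[OF lam_closed[OF c] al b H_vs C_vs C_vs scalars_vs])
    also have "\<dots> = tsum K scalars (lam c) (\<lambda>h d. counit H (\<alpha> d \<odot>\<^bsub>H\<^esub> h))"
      by (rule tsum_cong[OF lam_closed[OF c] bilin_comp[OF b al] _ H_vs C_vs scalars_vs])
        (simp add: lin_smult[OF al] lin_smult[OF cH] ac coalgebra.counit_closed[OF H_coalgebra] m_comm del: C_simps)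
    also have "\<dots> = counit H (mat \<alpha> c)" unfolding mat_def coef_def
      by (rule tsum_hom[OF lam_closed[OF c] cH coef_bilin[OF al] H_vs C_vs H_vs scalars_vs, symmetric])
    also have "\<dots> = up (counit H) (act ?A) x"
      using x up_mat[OF al] by (simp add: compose_apply fun_eq_iff) (metis compose_apply)
    also have "up (counit H) (act ?A) = ?A"
    proof -
      have l: "lin P H (scalar_map ?A)" by (rule conv_carrierD[OF scalar_map_closed[OF Ac]])
      have cv: "lin P H (conv P H (scalar_map ?A) W')" by (rule conv_lin[OF P_coalgebra H_alg l W'_lin])
      have w1: "counit H (p x) = counit P x" if "x \<in> carrier P" for x
        using P_partial_corep that by (simp add: partial_corep_def)
      have u1: "up (counit H) W = \<one>\<^bsub>dual\<^esub>" "up (counit H) W' = \<one>\<^bsub>dual\<^esub>"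
        by (auto simp: compose_def conv_monoid_def W_apply w1 counit_antipode p_closed coalgebra.counit_closed[OF P_coalgebra])
      have u2: "up (counit H) (scalar_map ?A) = ?A"
        using lin_closed[OF conv_carrierD[OF Ac]]
        by (auto simp: scalar_map_def compose_def lin_smult[OF cH] hopf_algebra.counit_one[OF hopf])
      show ?thesis
        unfolding act_def compose_conv[OF P_coalgebra H_alg scalars_alg counit_hom W_lin cv]
          compose_conv[OF P_coalgebra H_alg scalars_alg counit_hom l W'_lin] u1 u2
        using Ac by simp
    qed
    finally have "\<alpha> ?y = \<alpha> c" using x by (simp add: compose_apply)
    then show "\<alpha> (?y \<ominus>\<^bsub>C\<^esub> c) = \<zero>"
      using lin_minus[OF C_vs scalars_vs al y c] lin_minus[OF C_vs scalars_vs al c c] c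
        lin_zero[OF C_vs scalars_vs al] by (simp add: a_minus_def[of C] C.r_neg del: C_simps(1))
  qed
qed

abbreviation "HHC \<equiv> tensor3 K H H C"

lemma HHC_vs: "vs HHC" by (rule tensor_vs[OF H_vs HC_vs])

text \<open>Contraction of the last leg only, so that an identity in
  \<open>H \<otimes> H \<otimes> C\<close> becomes one in the algebra
  \<open>H \<otimes> H\<close>.\<close>

definition "coef3 \<alpha> t = tmap H H (\<lambda>h. h) (coef \<alpha>) t"

context
  fixes \<alpha> assumes \<alpha>: "nice_base \<alpha>"
begin

lemma coef3_lin: "lin HHC (tensor K H H) (coef3 \<alpha>)"
  unfolding coef3_def
  by (rule tmap_lin[OF H_vs HC_vs H_vs H_vs lin_id coef_lin[OF nice_base_lin[OF \<alpha>]]])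

lemma coef3_ptensor: "h \<in> carrier H \<Longrightarrow> s \<in> carrier HC \<Longrightarrow> coef3 \<alpha> (ptensor K H HC h s) = ptensor K H H h (coef \<alpha> s)"
  unfolding coef3_def
  by (rule tmap_ptensor[OF H_vs HC_vs H_vs H_vs lin_id coef_lin[OF nice_base_lin[OF \<alpha>]]])

lemma coef3_ptensor3: "h \<in> carrier H \<Longrightarrow> k \<in> carrier H \<Longrightarrow> d \<in> carrier C \<Longrightarrow>
    coef3 \<alpha> (ptensor3 K H H C h k d) = ptensor K H H h (\<alpha> d \<odot>\<^bsub>H\<^esub> k)"
  by (simp only: coef3_ptensor ptensor_closed[OF H_vs C_vs] coef_ptensor[OF nice_base_lin[OF \<alpha>]])

lemma slice_coef3:
  assumes f: "lin H scalars f" and t: "t \<in> carrier HHC"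
  shows "slice f (coef3 \<alpha> t) = tsum K H t (\<lambda>h s. tsum K scalars s (\<lambda>k d. f k \<otimes> \<alpha> d) \<odot>\<^bsub>H\<^esub> h)"
proof -
  note al = nice_base_lin[OF \<alpha>]
  note cl = coef_lin[OF al] and fcl = lin_comp[OF coef_lin[OF al] f]
  have b: "bilin H HC H (\<lambda>h s. f (coef \<alpha> s) \<odot>\<^bsub>H\<^esub> h)"
    by (rule functional_slice_bilin'[OF H_vs HC_vs fcl])
  have "slice f (coef3 \<alpha> t) = tsum K H t (\<lambda>h s. f (coef \<alpha> s) \<odot>\<^bsub>H\<^esub> h)"
    by (rule tensor_eqI[OF H_vs HC_vs H_vs lin_comp[OF coef3_lin slice_lin[OF f]] tsum_lin[OF H_vs HC_vs H_vs b] _ t])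
      (simp add: coef3_ptensor tsum_ptensor[OF H_vs HC_vs H_vs b] slice_ptensor[OF f] lin_closed[OF cl])
  also have "\<dots> = tsum K H t (\<lambda>h s. tsum K scalars s (\<lambda>k d. f k \<otimes> \<alpha> d) \<odot>\<^bsub>H\<^esub> h)"
  proof (rule tsum_cong[OF t b _ H_vs HC_vs H_vs])
    fix h s assume s: "s \<in> carrier HC"
    have "f (coef \<alpha> s) = tsum K scalars s (\<lambda>k d. f (\<alpha> d \<odot>\<^bsub>H\<^esub> k))"
      unfolding coef_def by (rule tsum_hom[OF s f coef_bilin[OF al] H_vs C_vs H_vs scalars_vs])
    also have "\<dots> = tsum K scalars s (\<lambda>k d. f k \<otimes> \<alpha> d)"
      using lin_closed[OF f] \<gamma>_closed[OF al]
      by (intro tsum_cong[OF s bilin_comp[OF coef_bilin[OF al] f] _ H_vs C_vs scalars_vs])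
        (simp add: lin_smult[OF f] m_comm del: C_simps)
    finally show "f (coef \<alpha> s) \<odot>\<^bsub>H\<^esub> h = tsum K scalars s (\<lambda>k d. f k \<otimes> \<alpha> d) \<odot>\<^bsub>H\<^esub> h" by simp
  qed
  finally show ?thesis .
qed

end

text \<open>The last two legs are separated by pairs of a functional \<open>f\<close> on
  \<open>H\<close> and a nice \<open>\<alpha>\<close>; by \<open>slice_coef3\<close> the contraction
  with such a pair is a slice of \<open>coef3 \<alpha>\<close>.\<close>

lemma HHC_eqI:
  assumes t: "t \<in> carrier HHC" and s: "s \<in> carrier HHC"
    and eq: "\<And>\<alpha>. nice_base \<alpha> \<Longrightarrow> coef3 \<alpha> t = coef3 \<alpha> s"
  shows "t = s"
proof (rule tensor_eqI_separating[OF H_vs HC_vs separating_tensor[OF H_vs C_vs separating_all[OF H_vs] C_separating] t s],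
    elim CollectE exE conjE)
  fix g f \<alpha> assume g: "g = (\<lambda>s. tsum K scalars s (\<lambda>k d. f k \<otimes> \<alpha> d))" and f: "lin H scalars f" and n: "nice_base \<alpha>"
  show "tsum K H t (\<lambda>v w. g w \<odot>\<^bsub>H\<^esub> v) = tsum K H s (\<lambda>v w. g w \<odot>\<^bsub>H\<^esub> v)"
    unfolding g slice_coef3[OF n f t, symmetric] slice_coef3[OF n f s, symmetric] eq[OF n] ..
qed

text \<open>The three compatibility axioms all expand a sum over \<open>c\<^sub>1\<close>, \<open>c\<^sub>2\<close>, \<open>lam c\<^sub>1\<close>, \<open>lam c\<^sub>2\<close> whose
  summand factors after applying a coefficient map \<open>g\<close>; the factors are then values of \<open>mat\<close>.\<close>

lemma coaction_push:
  assumes B: "alg B" and U: "vs U" and g: "lin U B g" and F: "lin H B F" and G: "lin H B G"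
    and \<gamma>: "lin C scalars \<gamma>" and \<delta>: "lin C scalars \<delta>"
    and b: "\<And>h d. h \<in> carrier H \<Longrightarrow> d \<in> carrier C \<Longrightarrow> bilin H C U (N h d)"
    and b': "\<And>k e. k \<in> carrier H \<Longrightarrow> e \<in> carrier C \<Longrightarrow> bilin H C U (\<lambda>h d. N h d k e)"
    and eq: "\<And>h d k e. \<lbrakk>h \<in> carrier H; d \<in> carrier C; k \<in> carrier H; e \<in> carrier C\<rbrakk> \<Longrightarrow>
      g (N h d k e) = F (\<gamma> d \<odot>\<^bsub>H\<^esub> h) \<otimes>\<^bsub>B\<^esub> G (\<delta> e \<odot>\<^bsub>H\<^esub> k)"
    and x: "x \<in> carrier P"
  defines "Z \<equiv> \<lambda>c1 c2. tsum K U (lam c1) (\<lambda>h1 d1. tsum K U (lam c2) (\<lambda>h2 d2. N h1 d1 h2 d2))"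
  shows "tsum K U (comult C (Ebar x)) Z \<in> carrier U"
    "g (tsum K U (comult C (Ebar x)) Z) =
      conv P B (up F (up (mat \<gamma>) Ebar)) (up G (up (mat \<delta>) Ebar)) x"
proof -
  note rls = U H_vs C_vs lam_closed lin_app[OF lam_lin] bilin_lin1[OF b'] bilin_lin2[OF b'] lins
  have B2: "bilin H C U (\<lambda>h1 d1. tsum K U (lam c2) (\<lambda>h2 d2. N h1 d1 h2 d2))" if "c2 \<in> carrier C" for c2
    using that by - (assumption | rule b rls)+
  have B3: "bilin C C U Z" unfolding Z_def by (assumption | rule b B2 rls)+
  show "tsum K U (comult C (Ebar x)) Z \<in> carrier U"
    by (rule lin_closed[OF tsum_lin[OF C_vs C_vs U B3] comult_closed[OF Ebar_closed[OF x] C_coalgebra]])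
  have "g (tsum K U (comult C (Ebar x)) Z) = conv P B (up (\<lambda>d. F (mat \<gamma> d)) Ebar) (up (\<lambda>d. G (mat \<delta> d)) Ebar) x"
  proof (rule comult_push[OF B U g B3 lin_comp[OF mat_lin[OF \<gamma>] F] lin_comp[OF mat_lin[OF \<delta>] G] _ x])
    fix c1 c2 assume h: "c1 \<in> carrier C" "c2 \<in> carrier C"
    note lc = lam_closed[OF h(1)] lam_closed[OF h(2)]
    have "g (Z c1 c2) = tsum K B (lam c1) (\<lambda>h d. F (\<gamma> d \<odot>\<^bsub>H\<^esub> h)) \<otimes>\<^bsub>B\<^esub> tsum K B (lam c2) (\<lambda>h d. G (\<delta> d \<odot>\<^bsub>H\<^esub> h))"
      unfolding Z_def
      by (rule product_push[OF lc H_vs C_vs H_vs C_vs U B g B2[OF h(2)] b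
        bilin_comp[OF coef_bilin[OF \<gamma>] F] bilin_comp[OF coef_bilin[OF \<delta>] G] eq])
    then show "g (Z c1 c2) = F (mat \<gamma> c1) \<otimes>\<^bsub>B\<^esub> G (mat \<delta> c2)"
      unfolding mat_def coef_def
      using tsum_hom[OF lc(1) F coef_bilin[OF \<gamma>] H_vs C_vs H_vs alg_vs[OF B]]
        tsum_hom[OF lc(2) G coef_bilin[OF \<delta>] H_vs C_vs H_vs alg_vs[OF B]] by simp
  qed
  then show "g (tsum K U (comult C (Ebar x)) Z) =
      conv P B (up F (up (mat \<gamma>) Ebar)) (up G (up (mat \<delta>) Ebar)) x"
    by (simp only: up_comp)
qed

lemmas lam_rules = H_vs C_vs HC_vs HHC_vs H_alg H_coalgebra C_coalgebra lam_closed lin_app[OF lam_lin] lins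

text \<open>Contracting the two \<open>C\<close>-legs with nice \<open>\<alpha>\<close> and
  \<open>\<alpha>'\<close> turns the left side into the coefficient at their convolution product and
  the right side into the product of the two coefficients. Equality is then
  \<open>act_conv\<close>.\<close>

lemma lam_comult:
  assumes c: "c \<in> carrier C"
  shows "tsum K (tensor3 K H C C) (lam c) (\<lambda>h d.
        tsum K (tensor3 K H C C) (comult C d) (\<lambda>d1 d2. ptensor3 K H C C h d1 d2)) =
      tsum K (tensor3 K H C C) (comult C c) (\<lambda>c1 c2.
        tsum K (tensor3 K H C C) (lam c1) (\<lambda>h1 d1.
          tsum K (tensor3 K H C C) (lam c2) (\<lambda>h2 d2.
            ptensor3 K H C C (h1 \<otimes>\<^bsub>H\<^esub> h2) d1 d2)))" (is "?L = ?R")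
proof -
  let ?T = "tensor3 K H C C"
  obtain x where x: "x \<in> carrier P" "c = Ebar x" using c by auto
  have CC: "vs (tensor K C C)" by (rule tensor_vs[OF C_vs C_vs])
  have T: "vs ?T" by (rule tensor_vs[OF H_vs CC])
  note rls = CC T lam_rules
  have b1: "bilin C C ?T (\<lambda>d1 d2. ptensor3 K H C C h d1 d2)" if "h \<in> carrier H" for h
    using that by - (assumption | rule rls)+
  have B1: "bilin H C ?T (\<lambda>h d. tsum K ?T (comult C d) (\<lambda>d1 d2. ptensor3 K H C C h d1 d2))"
    by (assumption | rule b1 rls)+
  have b2: "bilin H C ?T (\<lambda>h2 d2. ptensor3 K H C C (h1 \<otimes>\<^bsub>H\<^esub> h2) d1 d2)" if "h1 \<in> carrier H" "d1 \<in> carrier C" for h1 d1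
    using that by - (assumption | rule rls)+
  have b3: "bilin H C ?T (\<lambda>h1 d1. ptensor3 K H C C (h1 \<otimes>\<^bsub>H\<^esub> h2) d1 d2)" if "h2 \<in> carrier H" "d2 \<in> carrier C" for h2 d2
    using that by - (assumption | rule rls)+
  have Lc: "?L \<in> carrier ?T" by (rule lin_closed[OF tsum_lin[OF H_vs C_vs T B1] lam_closed[OF c]])
  note sepCC = separating_tensor[OF C_vs C_vs C_separating C_separating]
  have test: "\<exists>g. lin ?T H g \<and> (\<forall>h\<in>carrier H. \<forall>s\<in>carrier (tensor K C C). g (ptensor K H (tensor K C C) h s) = f s \<odot>\<^bsub>H\<^esub> h) \<and>
      g = (\<lambda>t. tsum K H t (\<lambda>h s. f s \<odot>\<^bsub>H\<^esub> h))" if "lin (tensor K C C) scalars f" for f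
    using functional_slice_bilin'[OF H_vs CC that] tsum_lin[OF H_vs CC H_vs] tsum_ptensor[OF H_vs CC H_vs] by blast
  have key: "?R \<in> carrier ?T \<and> tsum K H ?L (\<lambda>v w. f w \<odot>\<^bsub>H\<^esub> v) = tsum K H ?R (\<lambda>v w. f w \<odot>\<^bsub>H\<^esub> v)"
    if f: "f = (\<lambda>s. tsum K scalars s (\<lambda>d d'. \<alpha> d \<otimes> \<alpha>' d'))" and n: "nice_base \<alpha>" "nice_base \<alpha>'" for f \<alpha> \<alpha>'
  proof -
    note al = nice_base_lin[OF n(1)] nice_base_lin[OF n(2)]
    note ac = \<gamma>_closed[OF al(1)] \<gamma>_closed[OF al(2)]
    have bf: "bilin C C scalars (\<lambda>d d'. \<alpha> d \<otimes> \<alpha>' d')"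
      using bilin_precomp[OF mult_bilin[OF scalars_alg] al] by simp
    have fl: "lin (tensor K C C) scalars f" unfolding f by (rule tsum_lin[OF C_vs C_vs scalars_vs bf])
    have fp: "f (ptensor K C C d d') = \<alpha> d \<otimes> \<alpha>' d'" if "d \<in> carrier C" "d' \<in> carrier C" for d d'
      unfolding f by (rule tsum_ptensor[OF C_vs C_vs scalars_vs bf that])
    obtain g where g: "lin ?T H g" and gp: "\<And>h s. \<lbrakk>h \<in> carrier H; s \<in> carrier (tensor K C C)\<rbrakk> \<Longrightarrow>
        g (ptensor K H (tensor K C C) h s) = f s \<odot>\<^bsub>H\<^esub> h" and g_def: "g = (\<lambda>t. tsum K H t (\<lambda>h s. f s \<odot>\<^bsub>H\<^esub> h))"
      using test[OF fl] by blast
    \<comment> \<open>Evaluating \<open>\<alpha> \<otimes> \<alpha>'\<close> on the comultiplication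
      of the \<open>C\<close>-leg is the convolution product in the dual of
      \<open>C\<close>.\<close>
    define \<gamma> where "\<gamma> = conv C scalars \<alpha> \<alpha>'"
    have gl: "lin C scalars \<gamma>" unfolding \<gamma>_def by (rule conv_lin[OF C_coalgebra scalars_alg al])
    have "g ?L = tsum K H (lam c) (\<lambda>h d. g (tsum K ?T (comult C d) (\<lambda>d1 d2. ptensor3 K H C C h d1 d2)))"
      by (rule tsum_hom[OF lam_closed[OF c] g B1 H_vs C_vs T H_vs])
    also have "\<dots> = coef \<gamma> (lam c)"
      unfolding coef_def
    proof (rule tsum_cong[OF lam_closed[OF c] bilin_comp[OF B1 g] _ H_vs C_vs H_vs])
      fix h d assume hd: "h \<in> carrier H" "d \<in> carrier C"
      note cd = comult_closed[OF hd(2) C_coalgebra]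
      have "tsum K ?T (comult C d) (\<lambda>d1 d2. ptensor3 K H C C h d1 d2) = ptensor K H (tensor K C C) h (comult C d)"
        using tsum_hom[OF cd bilin_lin2[OF ptensor_bilin[OF H_vs CC] hd(1)] ptensor_bilin[OF C_vs C_vs] C_vs C_vs CC T]
          tsum_id[OF cd C_vs C_vs] by simp
      then show "g (tsum K ?T (comult C d) (\<lambda>d1 d2. ptensor3 K H C C h d1 d2)) = \<gamma> d \<odot>\<^bsub>H\<^esub> h"
        using hd cd by (simp add: gp f \<gamma>_def conv_apply del: C_simps)
    qed
    also have "\<dots> = act (up \<gamma> Ebar) x"
      unfolding x(2) lam_Ebar[OF x(1)] by (rule coef_LAM[OF gl x(1)])
    also have "up \<gamma> Ebar = conv P scalars (up \<alpha> Ebar) (up \<alpha>' Ebar)"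
      unfolding \<gamma>_def by (rule compose_coalgebra_map[OF P_coalgebra C_coalgebra Ebar_map_C scalars_alg al])
    also have "act (conv P scalars (up \<alpha> Ebar) (up \<alpha>' Ebar)) = conv P H (act (up \<alpha> Ebar)) (act (up \<alpha>' Ebar))"
      using n by (intro act_conv up_Ebar_dual[OF al(2)]) (simp add: nice_base_def)
    also have "\<dots> = conv P H (up (\<lambda>h. h) (up (mat \<alpha>) Ebar)) (up (\<lambda>h. h) (up (mat \<alpha>') Ebar))"
      by (simp add: up_mat al up_id[OF act_closed[OF up_Ebar_dual]])
    finally have L: "g ?L = conv P H (up (\<lambda>h. h) (up (mat \<alpha>) Ebar)) (up (\<lambda>h. h) (up (mat \<alpha>') Ebar)) x" .
    have eq: "g (ptensor3 K H C C (h1 \<otimes>\<^bsub>H\<^esub> h2) d1 d2) = (\<alpha> d1 \<odot>\<^bsub>H\<^esub> h1) \<otimes>\<^bsub>H\<^esub> (\<alpha>' d2 \<odot>\<^bsub>H\<^esub> h2)"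
      if "h1 \<in> carrier H" "d1 \<in> carrier C" "h2 \<in> carrier H" "d2 \<in> carrier C" for h1 d1 h2 d2
      using that by (simp add: gp fp ptensor_closed[OF C_vs C_vs] ac alg_smult1[OF H_alg] alg_smult2[OF H_alg]
        Hm.smult_assoc1[symmetric] m_comm del: C_simps)
    note cp = coaction_push[OF H_alg T g lin_id lin_id al b2 b3 eq x(1)]
    show ?thesis using cp L unfolding x(2) g_def by simp
  qed
  show ?thesis
  proof (rule tensor_eqI_separating[OF H_vs CC sepCC Lc], goal_cases)
    case 1
    \<comment> \<open>Membership of the right side in the triple tensor product is part of
      \<open>key\<close> for any pair of nice functionals; the counit supplies one.\<close>
    show ?case using key[OF refl nice_base_counit nice_base_counit] by blast
  next
    case (2 f)
    then show ?case using key by blast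
  qed
qed

end

section \<open>The iterated coaction and both forms of the third axiom\<close>

context base
begin

lemma mat_nice: assumes n: "nice_base \<alpha>" shows "good (up (mat \<alpha>) Ebar)"
  using n by (simp add: up_mat[OF nice_base_lin[OF n]] nice_base_def nice_def)

lemma up_mat_closed: "nice_base \<alpha> \<Longrightarrow> up (mat \<alpha>) Ebar \<in> carrier (conv_monoid P H)"
  using mat_nice by (simp add: good_def)

context
  fixes x assumes x: "x \<in> carrier P"
begin

abbreviation (input) "c \<equiv> Ebar x"

lemma Ebar_x_closed: "c \<in> carrier C" by (rule Ebar_closed[OF x])

abbreviation (input) "lam2 \<equiv> tsum K HHC (lam c) (\<lambda>h d. tsum K HHC (lam d) (\<lambda>h' d'. ptensor3 K H H C h h' d'))"

lemma lam2_inner_bilin: "h \<in> carrier H \<Longrightarrow> bilin H C HHC (\<lambda>h' d'. ptensor3 K H H C h h' d')"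
  by (assumption | rule lam_rules)+

lemma lam2_bilin: "bilin H C HHC (\<lambda>h d. tsum K HHC (lam d) (\<lambda>h' d'. ptensor3 K H H C h h' d'))"
  by (assumption | rule lam2_inner_bilin lam_rules)+

lemma lam2_closed: "lam2 \<in> carrier HHC"
  by (rule lin_closed[OF tsum_lin[OF H_vs C_vs HHC_vs lam2_bilin] lam_closed[OF Ebar_x_closed]])

text \<open>With \<open>\<phi>\<close> the pullback of \<open>mat \<alpha>\<close>, contracting the
  iterated coaction gives \<open>up i1 W\<close>, \<open>up i2 \<phi>\<close>,
  \<open>up i1 W'\<close> in this order. The first rule in \<open>good \<phi>\<close> moves
  \<open>\<phi>\<close> to the front as \<open>up (comult H) \<phi>\<close>, after which the two
  outer factors meet and form \<open>up i1 E\<close>.\<close>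

lemma coef3_lam2:
  assumes n: "nice_base \<alpha>"
  shows "coef3 \<alpha> lam2 = conv P HH (up (comult H) (up (mat \<alpha>) Ebar)) (up i1 E) x"
proof -
  note al = nice_base_lin[OF n]
  note g = coef3_lin[OF n] and m = mat_lin[OF al]
  have mc: "mat \<alpha> d \<in> carrier H" if "d \<in> carrier C" for d by (rule lin_closed[OF m that])
  have bk: "bilin H C (tensor K H H) (\<lambda>h d. ptensor K H H h (mat \<alpha> d))"
    by (rule bilin_precomp[OF ptensor_bilin[OF H_vs H_vs] lin_id m])
  define k where "k t = tsum K (tensor K H H) t (\<lambda>h d. ptensor K H H h (mat \<alpha> d))" for t
  have k: "lin HC HH k" unfolding k_def HH_lin by (rule tsum_lin[OF H_vs C_vs HT_vs bk])
  have kp: "k (ptensor K H C h d) = ptensor K H H h (mat \<alpha> d)" if "h \<in> carrier H" "d \<in> carrier C" for h d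
    unfolding k_def by (rule tsum_ptensor[OF H_vs C_vs HT_vs bk that])
  have "coef3 \<alpha> lam2 = tsum K (tensor K H H) (lam c) (\<lambda>h d. coef3 \<alpha> (tsum K HHC (lam d) (\<lambda>h' d'. ptensor3 K H H C h h' d')))"
    by (rule tsum_hom[OF lam_closed[OF Ebar_x_closed] g lam2_bilin H_vs C_vs HHC_vs HT_vs])
  also have "\<dots> = k (lam c)"
    unfolding k_def
  proof (rule tsum_cong[OF lam_closed[OF Ebar_x_closed] bilin_comp[OF lam2_bilin g] _ H_vs C_vs HT_vs])
    fix h d assume hd: "h \<in> carrier H" "d \<in> carrier C"
    note ld = lam_closed[OF hd(2)]
    have "tsum K HHC (lam d) (\<lambda>h' d'. ptensor3 K H H C h h' d') = ptensor K H HC h (lam d)"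
      using tsum_hom[OF ld bilin_lin2[OF ptensor_bilin[OF H_vs HC_vs] hd(1)] ptensor_bilin[OF H_vs C_vs] H_vs C_vs HC_vs HHC_vs]
        tsum_id[OF ld H_vs C_vs] by simp
    then show "coef3 \<alpha> (tsum K HHC (lam d) (\<lambda>h' d'. ptensor3 K H H C h h' d')) = ptensor K H H h (mat \<alpha> d)"
      using hd ld by (simp add: coef3_ptensor[OF n] mat_def del: C_simps)
  qed
  also have "\<dots> = k (LAM x)" by (simp only: lam_Ebar[OF x])
  also have "\<dots> = conv P HH (up i1 W) (conv P HH (up i2 (up (mat \<alpha>) Ebar)) (up i1 W')) x"
  proof (rule LAM_push[OF HH_alg k _ _ _ _ x])
    show "lin P HH (up i1 W)" "lin P HH (up i2 (up (mat \<alpha>) Ebar))" "lin P HH (up i1 W')"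
      using conv_carrierD[OF up_closed(1)[OF W_closed]] conv_carrierD[OF up_closed(1)[OF W'_closed]]
        conv_carrierD[OF up_closed(2)[OF up_mat_closed[OF n]]] by blast+
    fix a b d assume h: "a \<in> carrier P" "b \<in> carrier P" "d \<in> carrier P"
    note hc = p_closed[OF h(1)] S_closed[OF p_closed[OF h(3)]] mc[OF Ebar_closed[OF h(2)]]
    show "k (ptensor K H C (p a \<otimes>\<^bsub>H\<^esub> S (p d)) (Ebar b)) =
      up i1 W a \<otimes>\<^bsub>HH\<^esub> (up i2 (up (mat \<alpha>) Ebar) b \<otimes>\<^bsub>HH\<^esub> up i1 W' d)"
      using h hc Ebar_closed[OF h(2)]
      by (simp add: kp compose_apply W_apply i1_def i2_def HH_def tensor_mult_ptensor[OF H_alg H_alg] del: C_simps)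
  qed
  also have "conv P HH (up i1 W) (conv P HH (up i2 (up (mat \<alpha>) Ebar)) (up i1 W')) =
    conv P HH (conv P HH (up (comult H) (up (mat \<alpha>) Ebar)) (up i1 W)) (up i1 W')"
    using mat_nice[OF n] by (simp add: good_def MM.m_assoc[symmetric])
  also have "\<dots> = conv P HH (up (comult H) (up (mat \<alpha>) Ebar)) (up i1 E)"
    using up_mat_closed[OF n] by (simp add: E_def up_conv MM.m_assoc)
  finally show ?thesis .
qed

text \<open>Multiplying the first leg by \<open>k\<close> is multiplication by \<open>i1 k\<close>
  in \<open>H \<otimes> H\<close>, and the scalar \<open>\<alpha> d\<close> moves inside the
  comultiplication by linearity.\<close>

lemma coef3_comult:
  assumes n: "nice_base \<alpha>" and k: "k \<in> carrier H" and h: "h \<in> carrier H" and d: "d \<in> carrier C"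
  shows "coef3 \<alpha> (tsum K HHC (comult H h) (\<lambda>a b. ptensor3 K H H C (a \<otimes>\<^bsub>H\<^esub> k) b d)) = comult H (\<alpha> d \<odot>\<^bsub>H\<^esub> h) \<otimes>\<^bsub>HH\<^esub> i1 k"
    "coef3 \<alpha> (tsum K HHC (comult H h) (\<lambda>a b. ptensor3 K H H C (k \<otimes>\<^bsub>H\<^esub> a) b d)) = i1 k \<otimes>\<^bsub>HH\<^esub> comult H (\<alpha> d \<odot>\<^bsub>H\<^esub> h)"
proof -
  note ad = \<gamma>_closed[OF nice_base_lin[OF n] d] and ch = comult_closed[OF h H_coalgebra]
  have sl: "lin (tensor K H H) (tensor K H H) (\<lambda>t. \<alpha> d \<odot>\<^bsub>tensor K H H\<^esub> t)"
    by (rule lin_smult_fun[OF lin_id ad HT_vs])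
  have push: "coef3 \<alpha> (tsum K HHC (comult H h) (\<lambda>a b. ptensor3 K H H C (u a) b d)) =
      \<alpha> d \<odot>\<^bsub>tensor K H H\<^esub> tsum K (tensor K H H) (comult H h) (\<lambda>a b. ptensor K H H (u a) b)"
    if u: "lin H H u" for u
  proof -
    have b: "bilin H H HHC (\<lambda>a b. ptensor3 K H H C (u a) b d)"
      using d lin_closed[OF u] by - (assumption | rule lin_app[OF u] lam_rules)+
    have "coef3 \<alpha> (tsum K HHC (comult H h) (\<lambda>a b. ptensor3 K H H C (u a) b d)) =
      tsum K (tensor K H H) (comult H h) (\<lambda>a b. coef3 \<alpha> (ptensor3 K H H C (u a) b d))"
      by (rule tsum_hom[OF ch coef3_lin[OF n] b H_vs H_vs HHC_vs HT_vs])
    also have "\<dots> = tsum K (tensor K H H) (comult H h) (\<lambda>a b. \<alpha> d \<odot>\<^bsub>tensor K H H\<^esub> ptensor K H H (u a) b)"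
      by (rule tsum_cong[OF ch bilin_comp[OF b coef3_lin[OF n]] _ H_vs H_vs HT_vs])
        (simp add: coef3_ptensor3[OF n] d lin_closed[OF u] ad lin_smult[OF bilin_lin2[OF ptensor_bilin[OF H_vs H_vs]]] del: C_simps)
    also have "\<dots> = \<alpha> d \<odot>\<^bsub>tensor K H H\<^esub> tsum K (tensor K H H) (comult H h) (\<lambda>a b. ptensor K H H (u a) b)"
      by (rule tsum_hom[OF ch sl bilin_precomp[OF ptensor_bilin[OF H_vs H_vs] u lin_id] H_vs H_vs HT_vs HT_vs, symmetric])
    finally show ?thesis .
  qed
  have ul: "lin H H (\<lambda>a. a \<otimes>\<^bsub>H\<^esub> k)" "lin H H (\<lambda>a. k \<otimes>\<^bsub>H\<^esub> a)"
    using k by (auto intro: lin_mult1 lin_mult2 lin_id H_alg)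
  show "coef3 \<alpha> (tsum K HHC (comult H h) (\<lambda>a b. ptensor3 K H H C (a \<otimes>\<^bsub>H\<^esub> k) b d)) = comult H (\<alpha> d \<odot>\<^bsub>H\<^esub> h) \<otimes>\<^bsub>HH\<^esub> i1 k"
    using push[OF ul(1)] mult_i1[of "comult H h" k] alg_smult1[OF HH_alg ad, of "comult H h" "i1 k"]
      ch k lin_closed[OF i1_lin k] lin_smult[OF comult_lin ad h] by (simp add: HH_def)
  show "coef3 \<alpha> (tsum K HHC (comult H h) (\<lambda>a b. ptensor3 K H H C (k \<otimes>\<^bsub>H\<^esub> a) b d)) = i1 k \<otimes>\<^bsub>HH\<^esub> comult H (\<alpha> d \<odot>\<^bsub>H\<^esub> h)"
    using push[OF ul(2)] i1_mult[of "comult H h" k] alg_smult2[OF HH_alg ad, of "i1 k" "comult H h"]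
      ch k lin_closed[OF i1_lin k] lin_smult[OF comult_lin ad h] by (simp add: HH_def)
qed

lemma counit_C_closed: "d \<in> carrier C \<Longrightarrow> k \<in> carrier H \<Longrightarrow> counit C d \<odot>\<^bsub>H\<^esub> k \<in> carrier H"
  by (intro Hm.smult_closed counit_closed'[OF _ C_coalgebra])

text \<open>The counit factor contributes \<open>up i1 E\<close> on the right of
  \<open>up (comult H) (up (mat \<alpha>) Ebar)\<close>, which is exactly the contraction of the
  iterated coaction.\<close>

lemma lam_coaction_right:
  "lam2 = tsum K HHC (comult C c) (\<lambda>c1 c2.
        tsum K HHC (lam c1) (\<lambda>h1 d1.
          tsum K HHC (lam c2) (\<lambda>h2 d2.
            tsum K HHC (comult H h1) (\<lambda>a b.
              ptensor3 K H H C (a \<otimes>\<^bsub>H\<^esub> (counit C d2 \<odot>\<^bsub>H\<^esub> h2)) b d1))))" (is "_ = ?R")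
proof -
  have b0: "bilin H H HHC (\<lambda>a b. ptensor3 K H H C (a \<otimes>\<^bsub>H\<^esub> k) b d)" if "k \<in> carrier H" "d \<in> carrier C" for k d
    using that by - (assumption | rule lam_rules)+
  have b1: "bilin H C HHC (\<lambda>h2 d2. tsum K HHC (comult H h1) (\<lambda>a b.
              ptensor3 K H H C (a \<otimes>\<^bsub>H\<^esub> (counit C d2 \<odot>\<^bsub>H\<^esub> h2)) b d1))" if "h1 \<in> carrier H" "d1 \<in> carrier C" for h1 d1
    using that by - (assumption | rule b0 lam_rules)+
  have b2: "bilin H C HHC (\<lambda>h1 d1. tsum K HHC (comult H h1) (\<lambda>a b.
              ptensor3 K H H C (a \<otimes>\<^bsub>H\<^esub> (counit C d2 \<odot>\<^bsub>H\<^esub> h2)) b d1))" if "h2 \<in> carrier H" "d2 \<in> carrier C" for h2 d2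
    using that by - (assumption | rule b0 lam_rules)+
  have push: "?R \<in> carrier HHC"
    "coef3 \<alpha> ?R = conv P HH (up (comult H) (up (mat \<alpha>) Ebar)) (up i1 (up (mat (counit C)) Ebar)) x"
    if n: "nice_base \<alpha>" for \<alpha>
  proof -
    have l: "lin HHC HH (coef3 \<alpha>)" "lin H HH (comult H)" "lin H HH i1"
      by (simp_all add: coef3_lin[OF n] comult_lin i1_lin)
    have eq: "coef3 \<alpha> (tsum K HHC (comult H h1) (\<lambda>a b. ptensor3 K H H C (a \<otimes>\<^bsub>H\<^esub> (counit C d2 \<odot>\<^bsub>H\<^esub> h2)) b d1)) =
        comult H (\<alpha> d1 \<odot>\<^bsub>H\<^esub> h1) \<otimes>\<^bsub>HH\<^esub> i1 (counit C d2 \<odot>\<^bsub>H\<^esub> h2)"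
      if "h1 \<in> carrier H" "d1 \<in> carrier C" "h2 \<in> carrier H" "d2 \<in> carrier C" for h1 d1 h2 d2
      by (rule coef3_comult(1)[OF n counit_C_closed[OF that(4,3)] that(1,2)])
    show "?R \<in> carrier HHC"
      "coef3 \<alpha> ?R = conv P HH (up (comult H) (up (mat \<alpha>) Ebar)) (up i1 (up (mat (counit C)) Ebar)) x"
      by (rule coaction_push[where N = "\<lambda>h1 d1 h2 d2. tsum K HHC (comult H h1) (\<lambda>a b.
              ptensor3 K H H C (a \<otimes>\<^bsub>H\<^esub> (counit C d2 \<odot>\<^bsub>H\<^esub> h2)) b d1)" and U = HHC and B = HH and g = "coef3 \<alpha>"
              and F = "comult H" and G = i1 and \<gamma> = \<alpha> and \<delta> = "counit C", OF HH_alg HHC_vs l nice_base_lin[OF n] counit_lin[OF C_coalgebra] b1 b2 eq x]; assumption)+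
  qed
  show ?thesis
    by (rule HHC_eqI[OF lam2_closed push(1)[OF nice_base_counit]]) (simp add: coef3_lam2 push(2) up_mat_counit)
qed

text \<open>The same two factors as in the right-hand form appear in the opposite order; the second
  rule in \<open>good\<close>, commutation with \<open>up i1 E\<close>, exchanges them.\<close>

lemma lam_coaction_left:
  "lam2 = tsum K HHC (comult C c) (\<lambda>c1 c2.
        tsum K HHC (lam c1) (\<lambda>h1 d1.
          tsum K HHC (lam c2) (\<lambda>h2 d2.
            tsum K HHC (comult H h2) (\<lambda>a b.
              ptensor3 K H H C ((counit C d1 \<odot>\<^bsub>H\<^esub> h1) \<otimes>\<^bsub>H\<^esub> a) b d2))))" (is "_ = ?R")
proof -
  have b0: "bilin H H HHC (\<lambda>a b. ptensor3 K H H C (k \<otimes>\<^bsub>H\<^esub> a) b d)" if "k \<in> carrier H" "d \<in> carrier C" for k d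
    using that by - (assumption | rule lam_rules)+
  have b1: "bilin H C HHC (\<lambda>h2 d2. tsum K HHC (comult H h2) (\<lambda>a b.
              ptensor3 K H H C ((counit C d1 \<odot>\<^bsub>H\<^esub> h1) \<otimes>\<^bsub>H\<^esub> a) b d2))" if "h1 \<in> carrier H" "d1 \<in> carrier C" for h1 d1
    using that by - (assumption | rule b0 lam_rules)+
  have b2: "bilin H C HHC (\<lambda>h1 d1. tsum K HHC (comult H h2) (\<lambda>a b.
              ptensor3 K H H C ((counit C d1 \<odot>\<^bsub>H\<^esub> h1) \<otimes>\<^bsub>H\<^esub> a) b d2))" if "h2 \<in> carrier H" "d2 \<in> carrier C" for h2 d2
    using that by - (assumption | rule b0 lam_rules)+
  have push: "?R \<in> carrier HHC"
    "coef3 \<alpha> ?R = conv P HH (up i1 (up (mat (counit C)) Ebar)) (up (comult H) (up (mat \<alpha>) Ebar)) x"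
    if n: "nice_base \<alpha>" for \<alpha>
  proof -
    have l: "lin HHC HH (coef3 \<alpha>)" "lin H HH i1" "lin H HH (comult H)"
      by (simp_all add: coef3_lin[OF n] comult_lin i1_lin)
    have eq: "coef3 \<alpha> (tsum K HHC (comult H h2) (\<lambda>a b. ptensor3 K H H C ((counit C d1 \<odot>\<^bsub>H\<^esub> h1) \<otimes>\<^bsub>H\<^esub> a) b d2)) =
        i1 (counit C d1 \<odot>\<^bsub>H\<^esub> h1) \<otimes>\<^bsub>HH\<^esub> comult H (\<alpha> d2 \<odot>\<^bsub>H\<^esub> h2)"
      if "h1 \<in> carrier H" "d1 \<in> carrier C" "h2 \<in> carrier H" "d2 \<in> carrier C" for h1 d1 h2 d2
      by (rule coef3_comult(2)[OF n counit_C_closed[OF that(2,1)] that(3,4)])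
    show "?R \<in> carrier HHC"
      "coef3 \<alpha> ?R = conv P HH (up i1 (up (mat (counit C)) Ebar)) (up (comult H) (up (mat \<alpha>) Ebar)) x"
      by (rule coaction_push[where N = "\<lambda>h1 d1 h2 d2. tsum K HHC (comult H h2) (\<lambda>a b.
              ptensor3 K H H C ((counit C d1 \<odot>\<^bsub>H\<^esub> h1) \<otimes>\<^bsub>H\<^esub> a) b d2)" and U = HHC and B = HH and g = "coef3 \<alpha>"
              and F = i1 and G = "comult H" and \<gamma> = "counit C" and \<delta> = \<alpha>, OF HH_alg HHC_vs l counit_lin[OF C_coalgebra] nice_base_lin[OF n] b1 b2 eq x]; assumption)+
  qed
  have comm: "conv P HH (up i1 E) (up (comult H) (up (mat \<alpha>) Ebar)) = conv P HH (up (comult H) (up (mat \<alpha>) Ebar)) (up i1 E)"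
    if "nice_base \<alpha>" for \<alpha>
    using mat_nice[OF that] by (simp add: good_def)
  show ?thesis
    by (rule HHC_eqI[OF lam2_closed push(1)[OF nice_base_counit]]) (simp add: coef3_lam2 push(2) up_mat_counit comm)
qed

end

lemma base_partial_comodule_coalgebra: "partial_comodule_coalgebra K H C lam"
proof (intro partial_comodule_coalgebra.intro partial_comodule_coalgebra_axioms.intro hopf C_coalgebra lam_lin lam_counit lam_comult)
  fix d assume "d \<in> carrier C"
  then obtain x where x: "x \<in> carrier P" and d: "d = Ebar x" by auto
  show "tsum K HHC (lam d) (\<lambda>h d. tsum K HHC (lam d) (\<lambda>h' d'. ptensor3 K H H C h h' d')) =
    tsum K HHC (comult C d) (\<lambda>c1 c2. tsum K HHC (lam c1) (\<lambda>h1 d1. tsum K HHC (lam c2) (\<lambda>h2 d2.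
            tsum K HHC (comult H h2) (\<lambda>a b. ptensor3 K H H C ((counit C d1 \<odot>\<^bsub>H\<^esub> h1) \<otimes>\<^bsub>H\<^esub> a) b d2))))"
    unfolding d by (rule lam_coaction_left[OF x])
  show "tsum K HHC (lam d) (\<lambda>h d. tsum K HHC (lam d) (\<lambda>h' d'. ptensor3 K H H C h h' d')) =
    tsum K HHC (comult C d) (\<lambda>c1 c2. tsum K HHC (lam c1) (\<lambda>h1 d1. tsum K HHC (lam c2) (\<lambda>h2 d2.
            tsum K HHC (comult H h1) (\<lambda>a b. ptensor3 K H H C (a \<otimes>\<^bsub>H\<^esub> (counit C d2 \<odot>\<^bsub>H\<^esub> h2)) b d1))))"
    unfolding d by (rule lam_coaction_right[OF x])
qed

end

theorem theorem5p14:
  fixes K :: "('k, 'r) ring_scheme"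
    and H :: "('k, 'h, 'm) hopf_algebra_scheme"
    and CH :: "('k, 'c) coalgebra"
    and p :: "'c \<Rightarrow> 'h"
  assumes "field K"
    and "hopf_algebra K H"
    and "cofree_coalgebra K H CH p"
  defines "P \<equiv> hpar K H CH p"
    and "Ebar \<equiv> base_Ebar K H CH p"
    and "C \<equiv> base_coalgebra K H CH p"
  shows "\<exists>lam.
    (\<forall>x\<in>carrier P. lam (Ebar x) =
      tsum K (tensor K H C) (comult P x) (\<lambda>x1 x'.
        tsum K (tensor K H C) (comult P x') (\<lambda>x2 x3.
          ptensor K H C (p x1 \<otimes>\<^bsub>H\<^esub> antipode H (p x3)) (Ebar x2)))) \<and>
    partial_comodule_coalgebra K H C lam"
proof -
  interpret base K H CH p
    using assms(1-3) by (simp add: base_def base_axioms_def hopf_def hopf_axioms_def vector_spaces_def)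
  show ?thesis
    unfolding P_def Ebar_def C_def
    using base_partial_comodule_coalgebra lam_Ebar by (auto simp: LAM_def)
qed

end
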